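(* Let $k$ be a field of characteristic $0$ and $n\ge 1$. Then $k[GO_n^\bullet]^{\mathrm{Ad}\,GO_n}$ is generated as an FFG-algebra by $\mathrm{tr}$ and $\lambda$ (both regarded as elements of $k[GO_n]^{\mathrm{Ad}\,GO_n}$); that is, the smallest sub-FFG-algebra of $k[GO_n^\bullet]^{\mathrm{Ad}\,GO_n}$ containing $\mathrm{tr}$ and $\lambda$ is $k[GO_n^\bullet]^{\mathrm{Ad}\,GO_n}$ itself.
   Context: $GO_n$ is the general orthogonal group, $GO_n(k)=\{A\in M_n(k)\mid AA^t=\lambda I\text{ for some }\lambda\in k^\times\}$, where $A^t$ is the transpose. The function $\lambda:GO_n\to k^\times$ is defined by $AA^t=\lambda(A)I$, and $\mathrm{tr}$ is the matrix trace. FFG is the category of free groups $\mathrm{FG}(I)$ on finite nonempty sets $I$, with group homomorphisms. An FFG-algebra over $k$ is a functor $A^\bullet$ from FFG to (commutative) $k$-algebras; $A^I$ is its value at $\mathrm{FG}(I)$, $A^\phi:A^I\to A^J$ the map attached to $\phi:\mathrm{FG}(I)\to\mathrm{FG}(J)$. $k[GO_n^\bullet]^{\mathrm{Ad}\,GO_n}$ is the FFG-algebra $I\mapsto k[GO_n^I]^{\mathrm{Ad}\,GO_n}$ of regular functions on $GO_n^I$ invariant under simultaneous conjugation by $GO_n$; $\phi:\mathrm{FG}(I)\to\mathrm{FG}(J)$ induces $GO_n^J=\mathrm{Hom}(\mathrm{FG}(J),GO_n)\to\mathrm{Hom}(\mathrm{FG}(I),GO_n)=GO_n^I$, and $A^\phi$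 is pullback along this map. *)

theory Defs
  imports "HOL-Analysis.Analysis" "HOL-Algebra.Algebraic_Closure_Type"
begin

no_notation fps_nth (infixl "$" 75)

section \<open>Free groups on finite sets\<close>

text \<open>
  A letter \<open>(i, True)\<close> is the generator \<open>i\<close>, and \<open>(i, False)\<close> is its inverse. The free group on
  \<open>I\<close> consists of the reduced words in the letters over \<open>I\<close>; the product of \<open>v\<close> and \<open>w\<close> is the
  reduced form of the concatenation, computed by putting the letters of \<open>v\<close> in front of \<open>w\<close> one
  after the other, with cancellation.
\<close>

type_synonym letter = "nat \<times> bool"
type_synonym word = "letter list"

definition inv_letter :: "letter \<Rightarrow> letter" where
  "inv_letter a = (fst a, \<not> snd a)"

definition reduced_word :: "word \<Rightarrow> bool" where
  "reduced_word w \<longleftrightarrow> successively (\<lambda>a b. b \<noteq> inv_letter a) w"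

fun cons_red :: "letter \<Rightarrow> word \<Rightarrow> word" where
  "cons_red a [] = [a]"
| "cons_red a (b # w) = (if b = inv_letter a then w else a # b # w)"

definition FG :: "nat set \<Rightarrow> word monoid" where
  "FG I = \<lparr>carrier = {w. reduced_word w \<and> fst ` set w \<subseteq> I}, mult = foldr cons_red, one = []\<rparr>"

definition gen :: "nat \<Rightarrow> word" where
  "gen i = [(i, True)]"

definition eval_letter :: "('a, 'm) monoid_scheme \<Rightarrow> (nat \<Rightarrow> 'a) \<Rightarrow> letter \<Rightarrow> 'a" where
  "eval_letter G g a = (if snd a then g (fst a) else inv\<^bsub>G\<^esub> (g (fst a)))"

definition eval_word :: "('a, 'm) monoid_scheme \<Rightarrow> (nat \<Rightarrow> 'a) \<Rightarrow> word \<Rightarrow> 'a" where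
  "eval_word G g w = foldr (\<lambda>a x. eval_letter G g a \<otimes>\<^bsub>G\<^esub> x) w \<one>\<^bsub>G\<^esub>"

lemma inv_letter_inv_letter [simp]: "inv_letter (inv_letter a) = a"
  by (simp add: inv_letter_def)

lemma fst_inv_letter [simp]: "fst (inv_letter a) = fst a"
  by (simp add: inv_letter_def)

lemma inv_letter_neq [simp]: "inv_letter a \<noteq> a" "a \<noteq> inv_letter a"
  by (metis inv_letter_def snd_conv)+

lemma reduced_Nil [simp]: "reduced_word []"
  by (simp add: reduced_word_def)

lemma reduced_single [simp]: "reduced_word [a]"
  by (simp add: reduced_word_def)

lemma reduced_Cons: "reduced_word (a # w) \<longleftrightarrow> reduced_word w \<and> (w = [] \<or> hd w \<noteq> inv_letter a)"
  by (auto simp: reduced_word_def successively_Cons)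

lemma reduced_cons_red: "reduced_word w \<Longrightarrow> reduced_word (cons_red a w)"
  by (cases w) (auto simp: reduced_Cons)

lemma cons_red_eq_Cons: "reduced_word (a # w) \<Longrightarrow> cons_red a w = a # w"
  by (cases w) (auto simp: reduced_Cons)

lemma cons_red_inverse: "reduced_word w \<Longrightarrow> cons_red a (cons_red (inv_letter a) w) = w"
  by (cases w) (auto simp: reduced_Cons cons_red_eq_Cons)

lemma set_cons_red: "fst ` set (cons_red a w) \<subseteq> insert (fst a) (fst ` set w)"
  by (cases w) auto

lemma reduced_foldr: "reduced_word w \<Longrightarrow> reduced_word (foldr cons_red v w)"
  by (induction v) (auto intro: reduced_cons_red)

lemma set_foldr_cons_red: "fst ` set (foldr cons_red v w) \<subseteq> fst ` set v \<union> fst ` set w"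
proof (induction v)
  case (Cons a v)
  show ?case
    using set_cons_red[of a "foldr cons_red v w"] Cons.IH
    unfolding foldr_Cons o_apply list.set image_insert by blast
qed auto

lemma foldr_cons_red_cons_red:
  assumes "reduced_word v" "reduced_word w"
  shows "foldr cons_red (cons_red a v) w = cons_red a (foldr cons_red v w)"
proof (cases v)
  case (Cons b v')
  have "reduced_word (foldr cons_red v' w)" using assms by (intro reduced_foldr)
  then show ?thesis using cons_red_inverse[of "foldr cons_red v' w" a] by (simp add: Cons)
qed auto

lemma foldr_cons_red_assoc:
  assumes "reduced_word v" "reduced_word w"
  shows "foldr cons_red (foldr cons_red u v) w = foldr cons_red u (foldr cons_red v w)"
  by (induction u) (auto simp: assms foldr_cons_red_cons_red reduced_foldr)

lemma foldr_cons_red_Nil: "reduced_word w \<Longrightarrow> foldr cons_red w [] = w"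
  by (induction w) (auto simp: reduced_Cons cons_red_eq_Cons)

lemma foldr_cons_red_inverse:
  "reduced_word w \<Longrightarrow> foldr cons_red (rev (map inv_letter v)) (foldr cons_red v w) = w"
proof (induction v)
  case (Cons a v)
  then show ?case
    using cons_red_inverse[of "foldr cons_red v w" "inv_letter a"] by (simp add: reduced_foldr)
qed auto

lemma group_FG: "group (FG I)"
proof (rule groupI)
  fix x assume "x \<in> carrier (FG I)"
  then have x: "reduced_word x" "fst ` set x \<subseteq> I" by (simp_all add: FG_def)
  define y where "y = foldr cons_red (rev (map inv_letter x)) []"
  have y: "reduced_word y" unfolding y_def by (intro reduced_foldr) simp
  have "fst ` set (rev (map inv_letter x)) = fst ` set x" by (simp add: image_image)
  then have "fst ` set y \<subseteq> I"
    using set_foldr_cons_red[of "rev (map inv_letter x)" "[]"] x(2) by (simp add: y_def)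
  then have "y \<in> carrier (FG I)" using y by (simp add: FG_def)
  moreover have "foldr cons_red y x = []"
  proof -
    have "foldr cons_red y x = foldr cons_red (rev (map inv_letter x)) (foldr cons_red [] x)"
      unfolding y_def by (rule foldr_cons_red_assoc) (simp_all add: x)
    also have "\<dots> = foldr cons_red (rev (map inv_letter x)) (foldr cons_red x [])"
      by (simp only: foldr.simps id_apply foldr_cons_red_Nil[OF x(1)])
    also have "\<dots> = []" by (rule foldr_cons_red_inverse) simp
    finally show ?thesis .
  qed
  ultimately show "\<exists>y\<in>carrier (FG I). y \<otimes>\<^bsub>FG I\<^esub> x = \<one>\<^bsub>FG I\<^esub>"
    by (auto simp: FG_def)
next
  fix x y assume "x \<in> carrier (FG I)" "y \<in> carrier (FG I)"
  then show "x \<otimes>\<^bsub>FG I\<^esub> y \<in> carrier (FG I)"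
    by (simp add: FG_def reduced_foldr order_trans[OF set_foldr_cons_red])
next
  fix x y z assume "x \<in> carrier (FG I)" "y \<in> carrier (FG I)" "z \<in> carrier (FG I)"
  then show "x \<otimes>\<^bsub>FG I\<^esub> y \<otimes>\<^bsub>FG I\<^esub> z = x \<otimes>\<^bsub>FG I\<^esub> (y \<otimes>\<^bsub>FG I\<^esub> z)"
    by (simp add: FG_def foldr_cons_red_assoc)
qed (simp_all add: FG_def)

lemma gen_in_FG [simp]: "i \<in> I \<Longrightarrow> gen i \<in> carrier (FG I)"
  by (simp add: gen_def FG_def)

lemma inv_gen: "i \<in> I \<Longrightarrow> inv\<^bsub>FG I\<^esub> (gen i) = [(i, False)]"
  by (rule group.inv_equality[OF group_FG]) (auto simp: gen_def FG_def inv_letter_def)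

lemma (in group) eval_letter_closed:
  "g ` I \<subseteq> carrier G \<Longrightarrow> fst a \<in> I \<Longrightarrow> eval_letter G g a \<in> carrier G"
  by (auto simp: eval_letter_def)

lemma (in group) eval_word_closed:
  "g ` I \<subseteq> carrier G \<Longrightarrow> fst ` set w \<subseteq> I \<Longrightarrow> eval_word G g w \<in> carrier G"
  by (induction w) (auto simp: eval_word_def intro!: eval_letter_closed)

lemma eval_word_Nil [simp]: "eval_word G g [] = \<one>\<^bsub>G\<^esub>"
  by (simp add: eval_word_def)

lemma eval_word_Cons [simp]: "eval_word G g (a # w) = eval_letter G g a \<otimes>\<^bsub>G\<^esub> eval_word G g w"
  by (simp add: eval_word_def)

lemma eval_word_cong:
  "(\<And>i. i \<in> fst ` set w \<Longrightarrow> g i = g' i) \<Longrightarrow> eval_word G g w = eval_word G g' w"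
  by (induction w) (auto simp: eval_letter_def)

lemma (in group) eval_cons_red:
  assumes "g ` I \<subseteq> carrier G" "fst a \<in> I" "fst ` set w \<subseteq> I"
  shows "eval_word G g (cons_red a w) = eval_letter G g a \<otimes> eval_word G g w"
proof (cases w)
  case (Cons b v)
  have c: "g (fst a) \<in> carrier G" "eval_word G g v \<in> carrier G"
    using assms Cons by (auto intro!: eval_word_closed[of g I])
  show ?thesis
    using c by (auto simp: Cons eval_letter_def inv_letter_def m_assoc[symmetric])
qed auto

lemma (in group) eval_word_mult:
  assumes "g ` I \<subseteq> carrier G" "fst ` set v \<subseteq> I" "fst ` set w \<subseteq> I"
  shows "eval_word G g (foldr cons_red v w) = eval_word G g v \<otimes> eval_word G g w"
  using assms(2)
proof (induction v)
  case Nil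
  then show ?case using assms eval_word_closed by (simp add: eval_word_def)
next
  case (Cons a v)
  have "fst ` set (foldr cons_red v w) \<subseteq> I"
    by (rule order_trans[OF set_foldr_cons_red]) (use Cons.prems assms in auto)
  then have "eval_word G g (foldr cons_red (a # v) w)
      = eval_letter G g a \<otimes> (eval_word G g v \<otimes> eval_word G g w)"
    using Cons assms by (simp add: eval_cons_red)
  moreover have "eval_word G g (a # v) = eval_letter G g a \<otimes> eval_word G g v"
    by (simp add: eval_word_def)
  ultimately show ?case
    using Cons.prems assms eval_letter_closed[of g I a] eval_word_closed[of g I]
    by (simp add: m_assoc)
qed

lemma (in group) eval_word_hom:
  assumes "g ` I \<subseteq> carrier G"
  shows "eval_word G g \<in> hom (FG I) G"
  using assms by (auto simp: hom_def FG_def intro!: eval_word_closed[of g I] eval_word_mult[of g I])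

lemma (in group) eval_word_gen:
  "g i \<in> carrier G \<Longrightarrow> eval_word G g (gen i) = g i"
  by (simp add: eval_word_def eval_letter_def gen_def)

lemma (in group) hom_FG_eq_eval_word:
  assumes "\<phi> \<in> hom (FG I) G" "w \<in> carrier (FG I)" and eq: "\<And>i. i \<in> I \<Longrightarrow> g i = \<phi> (gen i)"
  shows "\<phi> w = eval_word G g w"
proof -
  interpret h: group_hom "FG I" G \<phi>
    using group_FG is_group assms(1) by (simp add: group_hom_def group_hom_axioms_def)
  from assms(2) show ?thesis
  proof (induction w)
    case Nil
    show ?case using h.hom_one by (simp add: eval_word_def FG_def)
  next
    case (Cons a w)
    have w: "w \<in> carrier (FG I)" and a: "fst a \<in> I" and aw: "reduced_word (a # w)"
      using Cons.prems by (auto simp: FG_def reduced_Cons)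
    have "[a] \<in> carrier (FG I)" using a by (simp add: FG_def)
    moreover have "a # w = [a] \<otimes>\<^bsub>FG I\<^esub> w"
      using aw by (simp add: FG_def cons_red_eq_Cons)
    ultimately have "\<phi> (a # w) = \<phi> [a] \<otimes> \<phi> w" using w by simp
    moreover have "\<phi> [a] = eval_letter G g a"
    proof (cases "snd a")
      case True
      then have "[a] = gen (fst a)" by (simp add: gen_def prod_eq_iff)
      then show ?thesis using True a eq by (simp add: eval_letter_def)
    next
      case False
      then have "[a] = inv\<^bsub>FG I\<^esub> (gen (fst a))" using a by (simp add: inv_gen prod_eq_iff)
      then show ?thesis using False a eq by (simp add: eval_letter_def)
    qed
    ultimately show ?case using Cons.IH[OF w] by (simp add: eval_word_def)
  qed
qed


section \<open>FFG-algebras\<close>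

text \<open>
  The objects of FFG are the free groups \<open>FG I\<close> on the finite nonempty sets \<open>I\<close> of natural numbers,
  and its morphisms are all group homomorphisms between them. A homomorphism is a function that
  matters on the carrier only, hence the congruence condition below.
\<close>

definition FFG_obj :: "nat set set" where
  "FFG_obj = {I. finite I \<and> I \<noteq> {}}"

record ('k, 'a) FFG_data =
  alg :: "nat set \<Rightarrow> ('k, 'a) module"
  amap :: "nat set \<Rightarrow> nat set \<Rightarrow> (word \<Rightarrow> word) \<Rightarrow> 'a \<Rightarrow> 'a"

definition alg_hom ::
    "('k, 'm) ring_scheme \<Rightarrow> ('k, 'a, 'c) module_scheme \<Rightarrow> ('k, 'b, 'd) module_scheme \<Rightarrow> ('a \<Rightarrow> 'b) set"
  where
  "alg_hom R M N = {h \<in> ring_hom M N.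
     \<forall>c\<in>carrier R. \<forall>x\<in>carrier M. h (c \<odot>\<^bsub>M\<^esub> x) = c \<odot>\<^bsub>N\<^esub> h x}"

locale FFG_algebra =
  fixes R :: "'k ring" and A :: "('k, 'a) FFG_data"
  assumes algebra_alg: "I \<in> FFG_obj \<Longrightarrow> algebra R (alg A I)"
    and amap_hom: "\<lbrakk>I \<in> FFG_obj; J \<in> FFG_obj; \<phi> \<in> hom (FG I) (FG J)\<rbrakk>
      \<Longrightarrow> amap A I J \<phi> \<in> alg_hom R (alg A I) (alg A J)"
    and amap_cong: "\<lbrakk>I \<in> FFG_obj; J \<in> FFG_obj; \<phi> \<in> hom (FG I) (FG J);
        \<And>w. w \<in> carrier (FG I) \<Longrightarrow> \<phi> w = \<psi> w; x \<in> carrier (alg A I)\<rbrakk>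
      \<Longrightarrow> amap A I J \<phi> x = amap A I J \<psi> x"
    and amap_id: "\<lbrakk>I \<in> FFG_obj; x \<in> carrier (alg A I)\<rbrakk> \<Longrightarrow> amap A I I (\<lambda>w. w) x = x"
    and amap_comp: "\<lbrakk>I \<in> FFG_obj; J \<in> FFG_obj; L \<in> FFG_obj; \<phi> \<in> hom (FG I) (FG J);
        \<psi> \<in> hom (FG J) (FG L); x \<in> carrier (alg A I)\<rbrakk>
      \<Longrightarrow> amap A I L (\<psi> \<circ> \<phi>) x = amap A J L \<psi> (amap A I J \<phi> x)"

text \<open>The condition \<open>subring\<close> includes \<open>\<one> \<in> B I\<close>, and \<open>submodule\<close> is stability under scalars.\<close>

definition sub_FFG_algebra :: "'k ring \<Rightarrow> ('k, 'a) FFG_data \<Rightarrow> (nat set \<Rightarrow> 'a set) \<Rightarrow> bool" where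
  "sub_FFG_algebra R A B \<longleftrightarrow>
     (\<forall>I\<in>FFG_obj. subring (B I) (alg A I) \<and> submodule (B I) R (alg A I)) \<and>
     (\<forall>I\<in>FFG_obj. \<forall>J\<in>FFG_obj. \<forall>\<phi>\<in>hom (FG I) (FG J). amap A I J \<phi> ` B I \<subseteq> B J)"

definition FFG_generated ::
    "'k ring \<Rightarrow> ('k, 'a) FFG_data \<Rightarrow> (nat set \<Rightarrow> 'a set) \<Rightarrow> nat set \<Rightarrow> 'a set" where
  "FFG_generated R A S I = \<Inter> {B I | B. sub_FFG_algebra R A B \<and> (\<forall>J\<in>FFG_obj. S J \<subseteq> B J)}"


section \<open>The general orthogonal group\<close>

definition GO :: "('a::field ^ 'n ^ 'n) monoid" where
  "GO = \<lparr>carrier = {A. \<exists>c. c \<noteq> 0 \<and> A ** Finite_Cartesian_Product.transpose A = mat c},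
         mult = (**), one = mat 1\<rparr>"

definition similitude :: "'a::field ^ 'n ^ 'n \<Rightarrow> 'a" where
  "similitude A = (THE c. A ** Finite_Cartesian_Product.transpose A = mat c)"

abbreviation GO_pow :: "nat set \<Rightarrow> (nat \<Rightarrow> 'a::field ^ 'n ^ 'n) set" where
  "GO_pow I \<equiv> I \<rightarrow>\<^sub>E carrier GO"


text \<open>
  The elements of \<open>k[GO\<^sub>n\<^sup>I]\<close> are the regular functions that are defined over \<open>k\<close> on the
  variety \<open>GO\<^sub>n\<^sup>I\<close>, which is identified with its set of points over the algebraic closure of \<open>k\<close>:
  the polynomials with coefficients in \<open>k\<close> in the matrix entries and the functions
  \<open>\<lambda>(g\<^sub>i)\<^sup>-\<^sup>1\<close>. Working with points over \<open>k\<close> itself would in general lose information when \<open>k\<close>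
  is not algebraically closed. Functions are \<open>undefined\<close> outside of \<open>GO_pow I\<close>.
\<close>

inductive_set regular ::
    "nat set \<Rightarrow> ((nat \<Rightarrow> 'k::field alg_closure ^ 'n ^ 'n) \<Rightarrow> 'k alg_closure) set"
  for I where
  const: "(\<lambda>g\<in>GO_pow I. to_ac c) \<in> regular I"
| entry: "i \<in> I \<Longrightarrow> (\<lambda>g\<in>GO_pow I. g i $ a $ b) \<in> regular I"
| inv_similitude: "i \<in> I \<Longrightarrow> (\<lambda>g\<in>GO_pow I. inverse (similitude (g i))) \<in> regular I"
| add: "f \<in> regular I \<Longrightarrow> h \<in> regular I \<Longrightarrow> (\<lambda>g\<in>GO_pow I. f g + h g) \<in> regular I"
| mult: "f \<in> regular I \<Longrightarrow> h \<in> regular I \<Longrightarrow> (\<lambda>g\<in>GO_pow I. f g * h g) \<in> regular I"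

definition Ad_invariants ::
    "nat set \<Rightarrow> ((nat \<Rightarrow> 'k::field alg_closure ^ 'n ^ 'n) \<Rightarrow> 'k alg_closure) set" where
  "Ad_invariants I = {f \<in> regular I. \<forall>h\<in>carrier GO. \<forall>g\<in>GO_pow I.
     f (\<lambda>i\<in>I. h \<otimes>\<^bsub>GO\<^esub> g i \<otimes>\<^bsub>GO\<^esub> inv\<^bsub>GO\<^esub> h) = f g}"

text \<open>
  Under the identification of \<open>GO\<^sub>n\<^sup>J\<close> with \<open>Hom(FG J, GO\<^sub>n)\<close>, the tuple \<open>g\<close> corresponds to the
  homomorphism \<open>eval_word GO g\<close>, so \<open>GO_subst I \<phi> g\<close> corresponds to \<open>eval_word GO g \<circ> \<phi>\<close>.
\<close>

definition GO_subst ::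
    "nat set \<Rightarrow> (word \<Rightarrow> word) \<Rightarrow> (nat \<Rightarrow> 'a::field ^ 'n ^ 'n) \<Rightarrow> nat \<Rightarrow> 'a ^ 'n ^ 'n" where
  "GO_subst I \<phi> g = (\<lambda>i\<in>I. eval_word GO g (\<phi> (gen i)))"

definition GO_invariants ::
    "('k::field, (nat \<Rightarrow> 'k alg_closure ^ 'n ^ 'n) \<Rightarrow> 'k alg_closure) FFG_data" where
  "GO_invariants = \<lparr>
     alg = (\<lambda>I. \<lparr>
       carrier = Ad_invariants I,
       monoid.mult = (\<lambda>f h. \<lambda>g\<in>GO_pow I. f g * h g),
       one = (\<lambda>g\<in>GO_pow I. 1),
       ring.zero = (\<lambda>g\<in>GO_pow I. 0),
       ring.add = (\<lambda>f h. \<lambda>g\<in>GO_pow I. f g + h g),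
       module.smult = (\<lambda>c f. \<lambda>g\<in>GO_pow I. to_ac c * f g)\<rparr>),
     amap = (\<lambda>I J \<phi> f. \<lambda>g\<in>GO_pow J. f (GO_subst I \<phi> g))\<rparr>"

text \<open>Elements of \<open>k[GO\<^sub>n]\<close> are the functions on \<open>GO\<^sub>n\<^sup>I\<close> for the one-element set \<open>I = {0}\<close>.\<close>

definition tr_fun :: "(nat \<Rightarrow> 'a::field ^ 'n ^ 'n) \<Rightarrow> 'a" where
  "tr_fun = (\<lambda>g\<in>GO_pow {0}. trace (g 0))"

definition similitude_fun :: "(nat \<Rightarrow> 'a::field ^ 'n ^ 'n) \<Rightarrow> 'a" where
  "similitude_fun = (\<lambda>g\<in>GO_pow {0}. similitude (g 0))"


subsection \<open>The invariants form an FFG-algebra\<close>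

lemma mat_mult_nth: "(mat c ** (M :: 'a::comm_ring_1 ^ 'n ^ 'n)) $ i $ j = c * M $ i $ j"
  by (simp add: matrix_matrix_mult_def mat_def if_distrib[of "\<lambda>x. x * _"] cong: if_cong)

lemma mult_mat_nth: "((M :: 'a::comm_ring_1 ^ 'n ^ 'n) ** mat c) $ i $ j = c * M $ i $ j"
  by (simp add: matrix_matrix_mult_def mat_def if_distrib[of "\<lambda>x. _ * x"] mult.commute cong: if_cong)

lemma mat_commute: "(M :: 'a::comm_ring_1 ^ 'n ^ 'n) ** mat c = mat c ** M"
  by (simp add: vec_eq_iff mat_mult_nth mult_mat_nth)

lemma mat_mult_mat: "mat c ** (mat d :: 'a::comm_ring_1 ^ 'n ^ 'n) = mat (c * d)"
  by (simp add: vec_eq_iff mat_mult_nth) (simp add: mat_def)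

lemma mat_eq_iff: "mat c = (mat d :: 'a::zero ^ 'n ^ 'n) \<longleftrightarrow> c = d"
  by (auto simp: vec_eq_iff mat_def split: if_splits)

lemma similitude_eqI: "A ** Finite_Cartesian_Product.transpose A = mat c \<Longrightarrow> similitude A = c"
  unfolding similitude_def by (rule the_equality) (auto simp: mat_eq_iff)

lemma GO_carrier_iff:
  "A \<in> carrier GO \<longleftrightarrow> similitude A \<noteq> 0 \<and> A ** Finite_Cartesian_Product.transpose A = mat (similitude A)"
  by (auto simp: GO_def dest: similitude_eqI)

lemma GO_mult: "A \<otimes>\<^bsub>GO\<^esub> B = A ** B"
  by (simp add: GO_def)

lemma GO_I: "A ** Finite_Cartesian_Product.transpose A = mat c \<Longrightarrow> c \<noteq> 0 \<Longrightarrow> A \<in> carrier GO"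
  by (auto simp: GO_def)

lemma GO_mult_gram:
  assumes "A \<in> carrier GO" "B \<in> carrier GO"
  shows "(A ** B) ** Finite_Cartesian_Product.transpose (A ** B) = mat (similitude A * similitude B)"
proof -
  have "(A ** B) ** Finite_Cartesian_Product.transpose (A ** B)
      = A ** (B ** Finite_Cartesian_Product.transpose B) ** Finite_Cartesian_Product.transpose A"
    by (simp add: matrix_transpose_mul matrix_mul_assoc)
  also have "\<dots> = mat (similitude B) ** A ** Finite_Cartesian_Product.transpose A"
    using assms by (simp add: GO_carrier_iff mat_commute[of A])
  also have "\<dots> = mat (similitude B) ** (A ** Finite_Cartesian_Product.transpose A)"
    by (simp only: matrix_mul_assoc)
  finally show ?thesis using assms by (simp add: GO_carrier_iff mat_mult_mat mult.commute)
qed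

lemma similitude_mult:
  "A \<in> carrier GO \<Longrightarrow> B \<in> carrier GO \<Longrightarrow> similitude (A \<otimes>\<^bsub>GO\<^esub> B) = similitude A * similitude B"
  using GO_mult_gram[of A B] by (simp add: GO_def similitude_eqI)

lemma GO_left_inverse:
  fixes A :: "'a::field ^ 'n ^ 'n"
  assumes "A \<in> carrier GO"
  defines "B \<equiv> mat (inverse (similitude A)) ** Finite_Cartesian_Product.transpose A"
  shows "B \<in> carrier GO" "B ** A = mat 1" "similitude B = inverse (similitude A)"
proof -
  let ?T = "Finite_Cartesian_Product.transpose"
  have nz: "similitude A \<noteq> 0" and A: "A ** ?T A = mat (similitude A)"
    using assms(1) by (auto simp: GO_carrier_iff)
  have "A ** B = A ** mat (inverse (similitude A)) ** ?T A"
    by (simp only: B_def matrix_mul_assoc)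
  also have "\<dots> = mat (inverse (similitude A)) ** (A ** ?T A)"
    by (simp only: mat_commute[of A] matrix_mul_assoc)
  also have "\<dots> = mat 1" using nz A by (simp add: mat_mult_mat)
  finally show BA: "B ** A = mat 1" by (simp add: matrix_left_right_inverse)
  have "B ** ?T B = B ** A ** mat (inverse (similitude A))"
    by (simp add: B_def matrix_transpose_mul matrix_mul_assoc transpose_mat)
  then have "B ** ?T B = mat (inverse (similitude A))" using BA by simp
  then show "B \<in> carrier GO" "similitude B = inverse (similitude A)"
    using nz by (auto intro: GO_I similitude_eqI)
qed

lemma group_GO: "group (GO :: ('a::field ^ 'n ^ 'n) monoid)"
proof (rule groupI)
  fix A B :: "'a ^ 'n ^ 'n" assume "A \<in> carrier GO" "B \<in> carrier GO"
  then show "A \<otimes>\<^bsub>GO\<^esub> B \<in> carrier GO"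
    using GO_I[OF GO_mult_gram[of A B]] by (simp add: GO_carrier_iff) (simp add: GO_def)
next
  show "\<one>\<^bsub>GO\<^esub> \<in> carrier (GO :: ('a ^ 'n ^ 'n) monoid)"
    by (auto simp: GO_def intro!: exI[of _ 1])
next
  fix A :: "'a ^ 'n ^ 'n" assume "A \<in> carrier GO"
  then show "\<exists>B\<in>carrier GO. B \<otimes>\<^bsub>GO\<^esub> A = \<one>\<^bsub>GO\<^esub>"
    using GO_left_inverse[of A] by (auto simp: GO_def)
qed (auto simp: GO_def matrix_mul_assoc)

lemma inv_GO:
  "A \<in> carrier GO \<Longrightarrow>
    inv\<^bsub>GO\<^esub> A = mat (inverse (similitude A)) ** Finite_Cartesian_Product.transpose A"
  using GO_left_inverse[of A] by (intro group.inv_equality[OF group_GO]) (auto simp: GO_def)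

lemma similitude_inv: "A \<in> carrier GO \<Longrightarrow> similitude (inv\<^bsub>GO\<^esub> A) = inverse (similitude A)"
  using GO_left_inverse(3) by (simp add: inv_GO)

lemma similitude_eq_sum:
  "A \<in> carrier GO \<Longrightarrow> similitude A = (\<Sum>b\<in>UNIV. A $ a $ b * A $ a $ b)"
proof -
  assume "A \<in> carrier GO"
  then have "(A ** Finite_Cartesian_Product.transpose A) $ a $ a = mat (similitude A) $ a $ a"
    by (simp add: GO_carrier_iff)
  then show ?thesis
    by (simp add: mat_def matrix_matrix_mult_def Finite_Cartesian_Product.transpose_def)
qed

lemma regular_extensional: "f \<in> regular I \<Longrightarrow> f \<in> extensional (GO_pow I)"
  by (induction rule: regular.induct) (rule restrict_extensional)+

lemma regular_cong:
  "(\<lambda>g\<in>GO_pow I. F g) \<in> regular I \<Longrightarrow> (\<And>g. g \<in> GO_pow I \<Longrightarrow> F g = G g) \<Longrightarrow>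
    (\<lambda>g\<in>GO_pow I. G g) \<in> regular I"
  using restrict_ext[of "GO_pow I" F G] by metis

lemma regular_add':
  assumes "(\<lambda>g\<in>GO_pow I. F g) \<in> regular I" "(\<lambda>g\<in>GO_pow I. G g) \<in> regular I"
  shows "(\<lambda>g\<in>GO_pow I. F g + G g) \<in> regular I"
  by (rule regular_cong[OF regular.add[OF assms]]) simp

lemma regular_mult':
  assumes "(\<lambda>g\<in>GO_pow I. F g) \<in> regular I" "(\<lambda>g\<in>GO_pow I. G g) \<in> regular I"
  shows "(\<lambda>g\<in>GO_pow I. F g * G g) \<in> regular I"
  by (rule regular_cong[OF regular.mult[OF assms]]) simp

lemma regular_sum:
  assumes "finite S" "\<And>s. s \<in> S \<Longrightarrow> (\<lambda>g\<in>GO_pow I. F s g) \<in> regular I"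
  shows "(\<lambda>g\<in>GO_pow I. \<Sum>s\<in>S. F s g) \<in> regular I"
  using assms
proof (induction S rule: finite_induct)
  case empty
  show ?case by (rule regular_cong[OF regular.const[where c = 0]]) simp
next
  case (insert s S)
  have "(\<lambda>g\<in>GO_pow I. F s g + (\<Sum>s\<in>S. F s g)) \<in> regular I"
    by (intro regular_add' insert.prems insert.IH) simp_all
  then show ?case by (rule regular_cong) (simp add: insert.hyps)
qed

lemma regular_similitude:
  assumes "i \<in> I"
  shows "(\<lambda>g\<in>GO_pow I. similitude (g i)) \<in> regular I"
proof (rule regular_cong)
  show "(\<lambda>g\<in>GO_pow I. \<Sum>b\<in>UNIV. g i $ undefined $ b * g i $ undefined $ b) \<in> regular I"
    by (intro regular_sum[OF finite] regular_mult' regular.entry assms)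
  show "(\<Sum>b\<in>UNIV. g i $ undefined $ b * g i $ undefined $ b) = similitude (g i)"
    if "g \<in> GO_pow I" for g
    using that assms by (intro similitude_eq_sum[symmetric]) auto
qed

definition regular_point ::
    "nat set \<Rightarrow> ((nat \<Rightarrow> 'k::field alg_closure ^ 'n ^ 'n) \<Rightarrow> 'k alg_closure ^ 'n ^ 'n) \<Rightarrow> bool" where
  "regular_point J F \<longleftrightarrow> (\<forall>g\<in>GO_pow J. F g \<in> carrier GO) \<and>
     (\<forall>a b. (\<lambda>g\<in>GO_pow J. F g $ a $ b) \<in> regular J) \<and>
     (\<lambda>g\<in>GO_pow J. inverse (similitude (F g))) \<in> regular J"

lemma regular_point_mult:
  assumes "regular_point J F" "regular_point J G"
  shows "regular_point J (\<lambda>g. F g \<otimes>\<^bsub>GO\<^esub> G g)"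
proof -
  have "(\<lambda>g\<in>GO_pow J. \<Sum>k\<in>UNIV. F g $ a $ k * G g $ k $ b) \<in> regular J" for a b
    using assms by (intro regular_sum regular_mult') (auto simp: regular_point_def)
  then have "(\<lambda>g\<in>GO_pow J. (F g \<otimes>\<^bsub>GO\<^esub> G g) $ a $ b) \<in> regular J" for a b
    by (simp add: GO_def matrix_matrix_mult_def)
  moreover have "(\<lambda>g\<in>GO_pow J. inverse (similitude (F g \<otimes>\<^bsub>GO\<^esub> G g))) \<in> regular J"
    by (rule regular_cong[OF regular_mult'[of "\<lambda>g. inverse (similitude (F g))" J
            "\<lambda>g. inverse (similitude (G g))"]])
       (use assms in \<open>auto simp: regular_point_def similitude_mult\<close>)
  ultimately show ?thesis
    using assms group.is_monoid[OF group_GO] by (auto simp: regular_point_def intro: monoid.m_closed)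
qed

lemma regular_point_letter:
  assumes "fst a \<in> J"
  shows "regular_point J (\<lambda>g. eval_letter GO g a)"
proof (cases "snd a")
  case True
  then show ?thesis
    using assms by (auto simp: regular_point_def eval_letter_def intro: regular.intros)
next
  case False
  have "(\<lambda>g\<in>GO_pow J. (inv\<^bsub>GO\<^esub> (g (fst a))) $ c $ d) \<in> regular J" for c d
    by (rule regular_cong[OF regular_mult'[of "\<lambda>g. inverse (similitude (g (fst a)))" J
            "\<lambda>g. g (fst a) $ d $ c"]])
       (use assms in \<open>auto intro!: regular.intros simp: inv_GO mat_mult_nth
          Finite_Cartesian_Product.transpose_def PiE_iff\<close>)
  moreover have "(\<lambda>g\<in>GO_pow J. inverse (similitude (inv\<^bsub>GO\<^esub> (g (fst a))))) \<in> regular J"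
    by (rule regular_cong[OF regular_similitude[of "fst a" J]])
       (use assms in \<open>auto simp: similitude_inv PiE_iff\<close>)
  ultimately show ?thesis
    using False assms group.inv_closed[OF group_GO]
    by (auto simp: regular_point_def eval_letter_def PiE_iff)
qed

lemma regular_point_word:
  fixes w :: word
  assumes "fst ` set w \<subseteq> J"
  shows "regular_point J (\<lambda>g :: nat \<Rightarrow> 'k::field alg_closure ^ 'n ^ 'n. eval_word GO g w)"
  using assms
proof (induction w)
  case Nil
  have c: "(\<lambda>g\<in>GO_pow J. to_ac d) \<in>
      (regular J :: ((nat \<Rightarrow> 'k alg_closure ^ 'n ^ 'n) \<Rightarrow> 'k alg_closure) set)" for d
    by (rule regular.const)
  have "similitude \<one>\<^bsub>GO\<^esub> = (1 :: 'k alg_closure)"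
    by (rule similitude_eqI) (simp add: GO_def)
  then have "(\<lambda>g\<in>GO_pow J. inverse (similitude \<one>\<^bsub>GO\<^esub>)) \<in>
      (regular J :: ((nat \<Rightarrow> 'k alg_closure ^ 'n ^ 'n) \<Rightarrow> 'k alg_closure) set)"
    by (intro regular_cong[OF c[of 1]]) (simp add: GO_def)
  moreover have "(\<lambda>g\<in>GO_pow J. \<one>\<^bsub>GO\<^esub> $ a $ b) \<in>
      (regular J :: ((nat \<Rightarrow> 'k alg_closure ^ 'n ^ 'n) \<Rightarrow> 'k alg_closure) set)" for a b
    by (rule regular_cong[OF c[of "if a = b then 1 else 0"]]) (simp add: GO_def mat_def)
  moreover have "\<one>\<^bsub>GO\<^esub> \<in> carrier (GO :: ('k alg_closure ^ 'n ^ 'n) monoid)"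
    by (rule monoid.one_closed[OF group.is_monoid[OF group_GO]])
  ultimately show ?case unfolding regular_point_def eval_word_Nil by blast
next
  case (Cons a w)
  then show ?case by (auto intro!: regular_point_mult regular_point_letter)
qed

lemma regular_pullback:
  assumes "f \<in> regular I" "\<And>i. i \<in> I \<Longrightarrow> regular_point J (F i)"
  shows "(\<lambda>g\<in>GO_pow J. f (\<lambda>i\<in>I. F i g)) \<in> regular J"
proof -
  have in_pow: "(\<lambda>i\<in>I. F i g) \<in> GO_pow I" if "g \<in> GO_pow J" for g
    using that assms(2) by (auto simp: regular_point_def)
  show ?thesis
    using assms(1)
  proof (induction rule: regular.induct)
    case (const c)
    show ?case by (rule regular_cong[OF regular.const[where c = c and I = J]]) (simp only: restrict_apply'[OF in_pow] restrict_apply')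
  next
    case (entry i a b)
    then have "(\<lambda>g\<in>GO_pow J. F i g $ a $ b) \<in> regular J"
      using assms(2) by (simp add: regular_point_def)
    then show ?case by (rule regular_cong) (simp only: restrict_apply'[OF in_pow] restrict_apply' entry)
  next
    case (inv_similitude i)
    then have "(\<lambda>g\<in>GO_pow J. inverse (similitude (F i g))) \<in> regular J"
      using assms(2) by (simp add: regular_point_def)
    then show ?case by (rule regular_cong) (simp only: restrict_apply'[OF in_pow] restrict_apply' inv_similitude)
  next
    case (add f h)
    from regular.add[OF add.IH] show ?case by (rule regular_cong) (simp only: restrict_apply'[OF in_pow] restrict_apply')
  next
    case (mult f h)
    from regular.mult[OF mult.IH] show ?case by (rule regular_cong) (simp only: restrict_apply'[OF in_pow] restrict_apply')
  qed
qed

lemma conj_in_GO_pow: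
  "h \<in> carrier GO \<Longrightarrow> g \<in> GO_pow I \<Longrightarrow> (\<lambda>i\<in>I. h \<otimes>\<^bsub>GO\<^esub> g i \<otimes>\<^bsub>GO\<^esub> inv\<^bsub>GO\<^esub> h) \<in> GO_pow I"
proof -
  interpret group GO by (rule group_GO)
  show "h \<in> carrier GO \<Longrightarrow> g \<in> GO_pow I \<Longrightarrow> ?thesis" by (auto simp: PiE_iff)
qed

lemma hom_gen_letters:
  "\<phi> \<in> hom (FG I) (FG J) \<Longrightarrow> i \<in> I \<Longrightarrow> fst ` set (\<phi> (gen i)) \<subseteq> J"
  using gen_in_FG[of i I] by (auto simp: hom_def FG_def Pi_iff)

lemma GO_subst_in_GO_pow:
  assumes "\<phi> \<in> hom (FG I) (FG J)" "g \<in> GO_pow J"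
  shows "GO_subst I \<phi> g \<in> GO_pow I"
proof -
  have "g ` J \<subseteq> carrier GO" using assms(2) by auto
  then show ?thesis
    using hom_gen_letters[OF assms(1)] group.eval_word_closed[OF group_GO, of g J]
    by (auto simp: GO_subst_def)
qed

lemma (in group) eval_word_conj:
  assumes "h \<in> carrier G" "g ` I \<subseteq> carrier G" "fst ` set w \<subseteq> I"
  shows "eval_word G (\<lambda>i\<in>I. h \<otimes> g i \<otimes> inv h) w = h \<otimes> eval_word G g w \<otimes> inv h"
  using assms(3)
proof (induction w)
  case Nil
  show ?case using assms by simp
next
  case (Cons a w)
  define x y where "x = eval_letter G g a" and "y = eval_word G g w"
  have xy: "x \<in> carrier G" "y \<in> carrier G"
    using Cons.prems assms eval_letter_closed[of g I a] eval_word_closed[of g I w]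
    by (auto simp: x_def y_def)
  have "eval_letter G (\<lambda>i\<in>I. h \<otimes> g i \<otimes> inv h) a = h \<otimes> x \<otimes> inv h"
  proof -
    have "g (fst a) \<in> carrier G" "fst a \<in> I" using Cons.prems assms by auto
    then show ?thesis
      using assms(1) by (auto simp: eval_letter_def x_def inv_mult_group m_assoc)
  qed
  moreover have "(h \<otimes> x \<otimes> inv h) \<otimes> (h \<otimes> y \<otimes> inv h) = h \<otimes> (x \<otimes> y) \<otimes> inv h"
    using xy assms(1) by (simp add: m_assoc) (simp add: m_assoc[symmetric])
  ultimately show ?case using Cons by (simp add: x_def y_def del: restrict_apply)
qed

lemma GO_subst_conj:
  assumes "\<phi> \<in> hom (FG I) (FG J)" "g \<in> GO_pow J" "h \<in> carrier GO"
  shows "GO_subst I \<phi> (\<lambda>j\<in>J. h \<otimes>\<^bsub>GO\<^esub> g j \<otimes>\<^bsub>GO\<^esub> inv\<^bsub>GO\<^esub> h)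
       = (\<lambda>i\<in>I. h \<otimes>\<^bsub>GO\<^esub> GO_subst I \<phi> g i \<otimes>\<^bsub>GO\<^esub> inv\<^bsub>GO\<^esub> h)"
proof -
  have "g ` J \<subseteq> carrier GO" using assms(2) by auto
  then show ?thesis
    unfolding GO_subst_def
    by (intro restrict_ext)
       (simp only: restrict_apply' group.eval_word_conj[OF group_GO assms(3)] hom_gen_letters[OF assms(1)])
qed

lemma GO_subst_comp:
  assumes "\<phi> \<in> hom (FG I) (FG J)" "\<psi> \<in> hom (FG J) (FG L)" "g \<in> GO_pow L"
  shows "GO_subst I (\<psi> \<circ> \<phi>) g = GO_subst I \<phi> (GO_subst J \<psi> g)"
proof -
  interpret group GO by (rule group_GO)
  have "eval_word GO g \<in> hom (FG L) GO" using assms(3) by (intro eval_word_hom) auto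
  then have hom: "eval_word GO g \<circ> \<psi> \<in> hom (FG J) GO"
    using assms(2) by (auto simp: hom_def)
  have "(eval_word GO g \<circ> \<psi>) (\<phi> (gen i)) = eval_word GO (GO_subst J \<psi> g) (\<phi> (gen i))"
    if "i \<in> I" for i
    using assms(1) that
    by (intro hom_FG_eq_eval_word[OF hom]) (auto simp: GO_subst_def hom_def)
  then show ?thesis by (auto simp: GO_subst_def fun_eq_iff)
qed

lemma GO_subst_id: "g \<in> GO_pow I \<Longrightarrow> GO_subst I (\<lambda>w. w) g = g"
  using group.eval_word_gen[OF group_GO, of g]
  by (auto simp: GO_subst_def fun_eq_iff PiE_iff extensional_def)

lemma Ad_invariants_regular: "f \<in> Ad_invariants I \<Longrightarrow> f \<in> regular I"
  by (simp add: Ad_invariants_def)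

lemma Ad_invariants_conj:
  "f \<in> Ad_invariants I \<Longrightarrow> h \<in> carrier GO \<Longrightarrow> g \<in> GO_pow I \<Longrightarrow>
    f (\<lambda>i\<in>I. h \<otimes>\<^bsub>GO\<^esub> g i \<otimes>\<^bsub>GO\<^esub> inv\<^bsub>GO\<^esub> h) = f g"
  unfolding Ad_invariants_def by blast

lemma Ad_invariantsI:
  assumes "(\<lambda>g\<in>GO_pow I. F g) \<in> regular I"
    and "\<And>h g. h \<in> carrier GO \<Longrightarrow> g \<in> GO_pow I \<Longrightarrow>
      F (\<lambda>i\<in>I. h \<otimes>\<^bsub>GO\<^esub> g i \<otimes>\<^bsub>GO\<^esub> inv\<^bsub>GO\<^esub> h) = F g"
  shows "(\<lambda>g\<in>GO_pow I. F g) \<in> Ad_invariants I"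
  unfolding Ad_invariants_def
  using assms(1) by (intro CollectI conjI ballI)
    (simp_all only: restrict_apply'[OF conj_in_GO_pow] restrict_apply' assms(2))

lemma Ad_invariants_eqI:
  assumes "f \<in> Ad_invariants I" "f' \<in> Ad_invariants I" "\<And>g. g \<in> GO_pow I \<Longrightarrow> f g = f' g"
  shows "f = f'"
  by (rule extensionalityI[of f "GO_pow I"])
     (rule assms Ad_invariants_regular regular_extensional | assumption)+

lemma Ad_invariants_const: "(\<lambda>g\<in>GO_pow I. to_ac c) \<in> Ad_invariants I"
  by (rule Ad_invariantsI[OF regular.const]) (rule refl)

lemma Ad_invariants_add:
  assumes "f \<in> Ad_invariants I" "h \<in> Ad_invariants I"
  shows "(\<lambda>g\<in>GO_pow I. f g + h g) \<in> Ad_invariants I"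
  by (rule Ad_invariantsI[OF regular.add]) (simp_all only: assms Ad_invariants_regular Ad_invariants_conj)

lemma Ad_invariants_mult:
  assumes "f \<in> Ad_invariants I" "h \<in> Ad_invariants I"
  shows "(\<lambda>g\<in>GO_pow I. f g * h g) \<in> Ad_invariants I"
  by (rule Ad_invariantsI[OF regular.mult]) (simp_all only: assms Ad_invariants_regular Ad_invariants_conj)

lemma Ad_invariants_smult:
  assumes "f \<in> Ad_invariants I"
  shows "(\<lambda>g\<in>GO_pow I. to_ac c * f g) \<in> Ad_invariants I"
proof (rule Ad_invariantsI)
  show "(\<lambda>g\<in>GO_pow I. to_ac c * f g) \<in> regular I"
    by (rule regular_cong[OF regular.mult[OF regular.const[where c = c] Ad_invariants_regular[OF assms]]])
       (simp only: restrict_apply')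
qed (simp only: assms Ad_invariants_conj)

lemma Ad_invariants_pullback:
  assumes "f \<in> Ad_invariants I" "\<phi> \<in> hom (FG I) (FG J)"
  shows "(\<lambda>g\<in>GO_pow J. f (GO_subst I \<phi> g)) \<in> Ad_invariants J"
proof (rule Ad_invariantsI)
  show "(\<lambda>g\<in>GO_pow J. f (GO_subst I \<phi> g)) \<in> regular J"
    unfolding GO_subst_def
    by (intro regular_pullback Ad_invariants_regular assms(1) regular_point_word
        hom_gen_letters[OF assms(2)])
qed (simp only: GO_subst_conj[OF assms(2)] Ad_invariants_conj[OF assms(1)] GO_subst_in_GO_pow[OF assms(2)])

lemma GO_invariants_simps:
  fixes I :: "nat set"
  defines "M \<equiv> alg (GO_invariants ::
     ('k::field, (nat \<Rightarrow> 'k alg_closure ^ 'n ^ 'n) \<Rightarrow> 'k alg_closure) FFG_data) I"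
  shows "carrier M = Ad_invariants I"
    "f \<otimes>\<^bsub>M\<^esub> h = (\<lambda>g\<in>GO_pow I. f g * h g)"
    "f \<oplus>\<^bsub>M\<^esub> h = (\<lambda>g\<in>GO_pow I. f g + h g)"
    "\<one>\<^bsub>M\<^esub> = (\<lambda>g\<in>GO_pow I. to_ac 1)"
    "\<zero>\<^bsub>M\<^esub> = (\<lambda>g\<in>GO_pow I. to_ac 0)"
    "c \<odot>\<^bsub>M\<^esub> f = (\<lambda>g\<in>GO_pow I. to_ac c * f g)"
    "amap GO_invariants I J \<phi> f = (\<lambda>g\<in>GO_pow J. f (GO_subst I \<phi> g))"
  by (simp_all add: M_def GO_invariants_def)

lemmas Ad_invariants_closed =
  Ad_invariants_const Ad_invariants_const[where c = 0, unfolded to_ac_0]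
  Ad_invariants_const[where c = 1, unfolded to_ac_1] Ad_invariants_add Ad_invariants_mult Ad_invariants_smult

lemma ring_of_type_algebra_simps:
  "x \<oplus>\<^bsub>ring_of_type_algebra\<^esub> y = x + y" "x \<otimes>\<^bsub>ring_of_type_algebra\<^esub> y = x * y"
  "\<one>\<^bsub>ring_of_type_algebra\<^esub> = 1"
  by (simp_all add: ring_of_type_algebra_def)

lemma GO_invariants_algebra:
  "algebra ring_of_type_algebra (alg (GO_invariants ::
     ('k::field, (nat \<Rightarrow> 'k alg_closure ^ 'n ^ 'n) \<Rightarrow> 'k alg_closure) FFG_data) I)"
  (is "algebra ?R ?M")
proof -
  note [simp del] = restrict_apply
  note [simp] = GO_invariants_simps Ad_invariants_closed ring_of_type_algebra_simps
  have neg: "\<exists>h\<in>carrier ?M. h \<oplus>\<^bsub>?M\<^esub> f = \<zero>\<^bsub>?M\<^esub>" if "f \<in> carrier ?M" for f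
  proof (rule bexI)
    show "(-1) \<odot>\<^bsub>?M\<^esub> f \<oplus>\<^bsub>?M\<^esub> f = \<zero>\<^bsub>?M\<^esub>"
      by (simp, rule restrict_ext) (simp add: restrict_apply')
    show "(-1) \<odot>\<^bsub>?M\<^esub> f \<in> carrier ?M" using that by (simp del: to_ac_minus)
  qed
  have ag: "abelian_group ?M"
  proof (rule abelian_groupI)
    fix f h k assume [simp]: "f \<in> carrier ?M" "h \<in> carrier ?M" "k \<in> carrier ?M"
    show "f \<oplus>\<^bsub>?M\<^esub> h \<oplus>\<^bsub>?M\<^esub> k = f \<oplus>\<^bsub>?M\<^esub> (h \<oplus>\<^bsub>?M\<^esub> k)"
      by (simp, rule restrict_ext) (simp add: restrict_apply' add.assoc)
  next
    fix f h assume "f \<in> carrier ?M" "h \<in> carrier ?M"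
    then show "f \<oplus>\<^bsub>?M\<^esub> h = h \<oplus>\<^bsub>?M\<^esub> f" by (simp add: add.commute)
  next
    fix f assume f: "f \<in> carrier ?M"
    then show "\<zero>\<^bsub>?M\<^esub> \<oplus>\<^bsub>?M\<^esub> f = f"
      by (intro Ad_invariants_eqI[of _ I]) (simp_all add: restrict_apply')
    show "\<exists>h\<in>carrier ?M. h \<oplus>\<^bsub>?M\<^esub> f = \<zero>\<^bsub>?M\<^esub>" by (rule neg[OF f])
  qed simp_all
  have cm: "comm_monoid ?M"
  proof (rule comm_monoidI)
    fix f h k assume "f \<in> carrier ?M" "h \<in> carrier ?M" "k \<in> carrier ?M"
    show "f \<otimes>\<^bsub>?M\<^esub> h \<otimes>\<^bsub>?M\<^esub> k = f \<otimes>\<^bsub>?M\<^esub> (h \<otimes>\<^bsub>?M\<^esub> k)"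
      by (simp, rule restrict_ext) (simp add: restrict_apply' mult.assoc)
  next
    fix f h assume "f \<in> carrier ?M" "h \<in> carrier ?M"
    then show "f \<otimes>\<^bsub>?M\<^esub> h = h \<otimes>\<^bsub>?M\<^esub> f" by (simp add: mult.commute)
  next
    fix f assume "f \<in> carrier ?M"
    then show "\<one>\<^bsub>?M\<^esub> \<otimes>\<^bsub>?M\<^esub> f = f"
      by (intro Ad_invariants_eqI[of _ I]) (simp_all add: restrict_apply')
  qed simp_all
  have "cring ?M"
  proof (rule cringI[OF ag cm])
    fix f h k assume "f \<in> carrier ?M" "h \<in> carrier ?M" "k \<in> carrier ?M"
    show "(f \<oplus>\<^bsub>?M\<^esub> h) \<otimes>\<^bsub>?M\<^esub> k = f \<otimes>\<^bsub>?M\<^esub> k \<oplus>\<^bsub>?M\<^esub> h \<otimes>\<^bsub>?M\<^esub> k"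
      by (simp, rule restrict_ext) (simp add: restrict_apply' distrib_right)
  qed
  then show ?thesis
  proof (rule algebraI[OF cring_from_type_algebra])
    fix c d :: 'k and f h assume f: "f \<in> carrier ?M" "h \<in> carrier ?M"
    show "(c \<oplus>\<^bsub>?R\<^esub> d) \<odot>\<^bsub>?M\<^esub> f = c \<odot>\<^bsub>?M\<^esub> f \<oplus>\<^bsub>?M\<^esub> d \<odot>\<^bsub>?M\<^esub> f"
      by (simp, rule restrict_ext) (simp add: restrict_apply' distrib_right)
    show "c \<odot>\<^bsub>?M\<^esub> (f \<oplus>\<^bsub>?M\<^esub> h) = c \<odot>\<^bsub>?M\<^esub> f \<oplus>\<^bsub>?M\<^esub> c \<odot>\<^bsub>?M\<^esub> h"
      by (simp, rule restrict_ext) (simp add: restrict_apply' distrib_left)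
    show "(c \<otimes>\<^bsub>?R\<^esub> d) \<odot>\<^bsub>?M\<^esub> f = c \<odot>\<^bsub>?M\<^esub> (d \<odot>\<^bsub>?M\<^esub> f)"
      by (simp, rule restrict_ext) (simp add: restrict_apply' mult.assoc)
    show "(c \<odot>\<^bsub>?M\<^esub> f) \<otimes>\<^bsub>?M\<^esub> h = c \<odot>\<^bsub>?M\<^esub> (f \<otimes>\<^bsub>?M\<^esub> h)"
      by (simp, rule restrict_ext) (simp add: restrict_apply' mult.assoc)
    show "\<one>\<^bsub>?R\<^esub> \<odot>\<^bsub>?M\<^esub> f = f"
      using f by (intro Ad_invariants_eqI[of _ I]) (simp_all add: restrict_apply' del: to_ac_1)
    show "c \<odot>\<^bsub>?M\<^esub> f \<in> carrier ?M" using f by simp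
  qed
qed

theorem GO_invariants_FFG_algebra:
  "FFG_algebra ring_of_type_algebra (GO_invariants ::
     ('k::field, (nat \<Rightarrow> 'k alg_closure ^ 'n ^ 'n) \<Rightarrow> 'k alg_closure) FFG_data)"
proof (rule FFG_algebra.intro)
  fix I J \<phi> assume \<phi>: "\<phi> \<in> hom (FG I) (FG J)"
  note [simp del] = restrict_apply
  note [simp] = GO_invariants_simps Ad_invariants_closed Ad_invariants_pullback[OF _ \<phi>]
    restrict_apply'[OF GO_subst_in_GO_pow[OF \<phi>]]
  let ?M = "\<lambda>I. alg (GO_invariants ::
     ('k::field, (nat \<Rightarrow> 'k alg_closure ^ 'n ^ 'n) \<Rightarrow> 'k alg_closure) FFG_data) I"
  let ?h = "amap (GO_invariants ::
     ('k::field, (nat \<Rightarrow> 'k alg_closure ^ 'n ^ 'n) \<Rightarrow> 'k alg_closure) FFG_data) I J \<phi>"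
  have "?h \<in> ring_hom (?M I) (?M J)"
  proof (rule ring_hom_memI)
    fix x y assume "x \<in> carrier (?M I)" "y \<in> carrier (?M I)"
    show "?h (x \<otimes>\<^bsub>?M I\<^esub> y) = ?h x \<otimes>\<^bsub>?M J\<^esub> ?h y"
      by (simp, rule restrict_ext) (simp add: restrict_apply')
    show "?h (x \<oplus>\<^bsub>?M I\<^esub> y) = ?h x \<oplus>\<^bsub>?M J\<^esub> ?h y"
      by (simp, rule restrict_ext) (simp add: restrict_apply')
  next
    show "?h \<one>\<^bsub>?M I\<^esub> = \<one>\<^bsub>?M J\<^esub>"
      by (simp, rule restrict_ext) (simp add: restrict_apply')
  qed simp
  moreover have "?h (c \<odot>\<^bsub>?M I\<^esub> x) = c \<odot>\<^bsub>?M J\<^esub> ?h x" for c x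
    by (simp, rule restrict_ext) (simp add: restrict_apply')
  ultimately show "?h \<in> alg_hom ring_of_type_algebra (?M I) (?M J)"
    by (simp only: alg_hom_def mem_Collect_eq) blast
next
  fix I J and \<phi> \<psi> :: "word \<Rightarrow> word"
    and x :: "(nat \<Rightarrow> 'k alg_closure ^ 'n ^ 'n) \<Rightarrow> 'k alg_closure"
  assume eq: "\<And>w. w \<in> carrier (FG I) \<Longrightarrow> \<phi> w = \<psi> w"
  have "GO_subst I \<phi> g = GO_subst I \<psi> g" for g :: "nat \<Rightarrow> 'k alg_closure ^ 'n ^ 'n"
    unfolding GO_subst_def by (rule restrict_ext) (simp only: eq gen_in_FG)
  then show "amap GO_invariants I J \<phi> x = amap GO_invariants I J \<psi> x"
    by (simp only: GO_invariants_simps)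
next
  fix I and x :: "(nat \<Rightarrow> 'k alg_closure ^ 'n ^ 'n) \<Rightarrow> 'k alg_closure"
  assume "x \<in> carrier (alg GO_invariants I)"
  then have "x \<in> extensional (GO_pow I)"
    by (intro regular_extensional Ad_invariants_regular) (simp only: GO_invariants_simps)
  moreover have "amap GO_invariants I I (\<lambda>w. w) x = restrict x (GO_pow I)"
    unfolding GO_invariants_simps by (rule restrict_ext) (simp only: GO_subst_id)
  ultimately show "amap GO_invariants I I (\<lambda>w. w) x = x"
    by (simp only: extensional_restrict)
next
  fix I J L \<phi> \<psi> and x :: "(nat \<Rightarrow> 'k alg_closure ^ 'n ^ 'n) \<Rightarrow> 'k alg_closure"
  assume *: "\<phi> \<in> hom (FG I) (FG J)" "\<psi> \<in> hom (FG J) (FG L)"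
  show "amap GO_invariants I L (\<psi> \<circ> \<phi>) x
      = amap GO_invariants J L \<psi> (amap GO_invariants I J \<phi> x)"
    unfolding GO_invariants_simps
    by (rule restrict_ext)
       (simp only: GO_subst_comp[OF *] restrict_apply'[OF GO_subst_in_GO_pow[OF *(2)]])
qed (rule GO_invariants_algebra)

lemma conj_trace:
  fixes A h :: "'a::field ^ 'n ^ 'n"
  assumes "A \<in> carrier GO" "h \<in> carrier GO"
  shows "trace (h \<otimes>\<^bsub>GO\<^esub> A \<otimes>\<^bsub>GO\<^esub> inv\<^bsub>GO\<^esub> h) = trace A"
proof -
  interpret group GO by (rule group_GO)
  have "trace (h \<otimes>\<^bsub>GO\<^esub> A \<otimes>\<^bsub>GO\<^esub> inv\<^bsub>GO\<^esub> h) = trace (inv\<^bsub>GO\<^esub> h \<otimes>\<^bsub>GO\<^esub> (h \<otimes>\<^bsub>GO\<^esub> A))"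
    unfolding GO_mult by (rule trace_mul_sym)
  also have "inv\<^bsub>GO\<^esub> h \<otimes>\<^bsub>GO\<^esub> (h \<otimes>\<^bsub>GO\<^esub> A) = A"
    using assms by (simp add: m_assoc[symmetric])
  finally show ?thesis .
qed

lemma conj_similitude:
  fixes A h :: "'a::field ^ 'n ^ 'n"
  assumes "A \<in> carrier GO" "h \<in> carrier GO"
  shows "similitude (h \<otimes>\<^bsub>GO\<^esub> A \<otimes>\<^bsub>GO\<^esub> inv\<^bsub>GO\<^esub> h) = similitude A"
proof -
  interpret group "GO :: ('a ^ 'n ^ 'n) monoid" by (rule group_GO)
  have nz: "similitude h \<noteq> 0" using assms(2) unfolding GO_carrier_iff by blast
  have "similitude (h \<otimes>\<^bsub>GO\<^esub> A \<otimes>\<^bsub>GO\<^esub> inv\<^bsub>GO\<^esub> h)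
      = similitude h * similitude A * inverse (similitude h)"
    by (simp only: similitude_mult similitude_inv m_closed inv_closed assms)
  then show ?thesis using nz by simp
qed

lemma invariant_of_point:
  fixes F :: "'k::field alg_closure ^ 'n ^ 'n \<Rightarrow> 'k alg_closure"
  assumes "(\<lambda>g\<in>GO_pow {0}. F (g 0)) \<in> regular {0}"
    and F: "\<And>A h. A \<in> carrier GO \<Longrightarrow> h \<in> carrier GO \<Longrightarrow> F (h \<otimes>\<^bsub>GO\<^esub> A \<otimes>\<^bsub>GO\<^esub> inv\<^bsub>GO\<^esub> h) = F A"
  shows "(\<lambda>g\<in>GO_pow {0}. F (g 0)) \<in> carrier (alg GO_invariants {0})"
  unfolding GO_invariants_simps
proof (rule Ad_invariantsI[OF assms(1)])
  fix g :: "nat \<Rightarrow> 'k alg_closure ^ 'n ^ 'n" and h :: "'k alg_closure ^ 'n ^ 'n"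
  assume h: "h \<in> carrier GO" and g: "g \<in> GO_pow {0}"
  have "g 0 \<in> carrier GO" using g by (rule PiE_mem) simp
  then show "F ((\<lambda>i\<in>{0}. h \<otimes>\<^bsub>GO\<^esub> g i \<otimes>\<^bsub>GO\<^esub> inv\<^bsub>GO\<^esub> h) 0) = F (g 0)"
    using F h by simp
qed

lemma tr_fun_invariant: "tr_fun \<in> carrier (alg GO_invariants {0})"
  unfolding tr_fun_def
proof (rule invariant_of_point)
  show "(\<lambda>g\<in>GO_pow {0}. trace (g 0)) \<in> regular {0}"
    unfolding trace_def by (rule regular_sum[OF finite]) (rule regular.entry, simp)
qed (rule conj_trace)

lemma similitude_fun_invariant: "similitude_fun \<in> carrier (alg GO_invariants {0})"
  unfolding similitude_fun_def
proof (rule invariant_of_point)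
  show "(\<lambda>g\<in>GO_pow {0}. similitude (g 0)) \<in> regular {0}"
    by (rule regular_similitude) simp
qed (rule conj_similitude)

end

theory Submission
  imports Defs "HOL-Library.Function_Algebras"
begin

text \<open>
  After multiplication by a power of the similitudes, an invariant regular function is a polynomial
  in the matrix entries, that is, a combination of coordinates of \<open>g\<^sub>1 \<otimes> \<dots> \<otimes> g\<^sub>M\<close>, where each factor is
  a variable or the identity. Contractions of this tensor along perfect matchings of its \<open>2 M\<close> slots
  are products of traces of words in the \<open>g\<^sub>i\<close> and their transposes \<open>\<lambda>(g\<^sub>i) g\<^sub>i\<^sup>-\<^sup>1\<close>.

  On rational tensors, let \<open>H\<close> be the sum of \<open>1 - s\<close> over finitely many rational reflections \<open>s\<close>. It is
  symmetric and positive semidefinite, and its kernel consists of the tensors fixed by these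
  reflections. With enough reflections, such tensors are even in every index value and annihilated by
  the Lie algebra of the orthogonal group, and positivity shows that those orthogonal to all matchings
  vanish (first fundamental theorem). Hence \<open>1 = p(H) + Q\<close> with a rational polynomial \<open>p\<close> without
  constant term and \<open>Q\<close> with values in the span of the matchings. The corresponding operator on
  functions annihilates the given invariant function, which is therefore equal to its image under \<open>Q\<close>,
  a polynomial in traces of words. This replaces averaging over the group and works over every field
  of characteristic zero.
\<close>


section \<open>Invariant tensors and matchings\<close>


text \<open>Extensional functions, with the value \<open>undefined\<close> off \<open>S\<close>, so
  that a finite \<open>S\<close> has finitely many index tuples. A tensor with slots
  \<open>S\<close> is a function on them.\<close>

abbreviation idx :: "'s set \<Rightarrow> ('s \<Rightarrow> 'n) set" where
  "idx S \<equiv> S \<rightarrow>\<^sub>E UNIV"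

lemma finite_idx: "finite S \<Longrightarrow> finite (idx S :: ('s \<Rightarrow> 'n::finite) set)"
  by (intro finite_PiE) auto

lemma upd_in_idx: "x \<in> S \<Longrightarrow> \<alpha> \<in> idx S \<Longrightarrow> \<alpha>(x := w) \<in> idx S"
  by (auto simp: PiE_iff extensional_def)

lemma sum_idx_insert:
  assumes "x \<notin> S"
  shows "(\<Sum>\<alpha>\<in>idx (insert x S). f \<alpha>) = (\<Sum>\<alpha>\<in>idx S. \<Sum>w\<in>(UNIV :: 'n::finite set). f (\<alpha>(x := w)))"
proof -
  have "(\<Sum>\<alpha>\<in>idx (insert x S). f \<alpha>) = (\<Sum>(w, \<alpha>)\<in>UNIV \<times> idx S. f (\<alpha>(x := w)))"
    unfolding PiE_insert_eq
    using inj_combinator[OF assms, of "\<lambda>_. UNIV :: 'n set"]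
    by (subst sum.reindex) (simp_all add: case_prod_unfold)
  also have "\<dots> = (\<Sum>w\<in>UNIV. \<Sum>\<alpha>\<in>idx S. f (\<alpha>(x := w)))"
    by (simp add: sum.cartesian_product)
  finally show ?thesis by (simp add: sum.swap[of _ "idx S"])
qed

lemma sum_idx_insert2:
  assumes "y \<notin> S" "z \<notin> S" "y \<noteq> z"
  shows "(\<Sum>\<alpha>\<in>idx (insert y (insert z S)). f \<alpha>)
    = (\<Sum>\<alpha>\<in>idx S. \<Sum>w\<in>(UNIV :: 'n::finite set). \<Sum>w'\<in>UNIV. f (\<alpha>(y := w, z := w')))"
  unfolding insert_commute[of y] using assms by (simp add: sum_idx_insert)

text \<open>Overwriting slot \<open>x\<close> is a bijection between the tuples with value
  \<open>a\<close> there and those with value \<open>b\<close>. This is the one-slot case of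
  transposing a matrix unit.\<close>

lemma sum_idx_update:
  fixes a b :: "'n::finite"
  assumes "finite S" "x \<in> S"
  shows "(\<Sum>\<alpha>\<in>idx S. if \<alpha> x = a then F \<alpha> (\<alpha>(x := b)) else 0)
    = (\<Sum>\<alpha>\<in>idx S. if \<alpha> x = b then F (\<alpha>(x := a)) \<alpha> else 0)"
proof -
  have "(\<Sum>\<alpha>\<in>{\<alpha>\<in>idx S. \<alpha> x = a}. F \<alpha> (\<alpha>(x := b))) = (\<Sum>\<alpha>\<in>{\<alpha>\<in>idx S. \<alpha> x = b}. F (\<alpha>(x := a)) \<alpha>)"
    by (rule sum.reindex_bij_witness[of _ "\<lambda>\<alpha>. \<alpha>(x := a)" "\<lambda>\<alpha>. \<alpha>(x := b)"])
       (use assms in \<open>auto simp: upd_in_idx\<close>)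
  then show ?thesis
    by (simp add: sum.inter_filter finite_idx assms(1))
qed

text \<open>The action of the matrix unit with entry \<open>1\<close> at \<open>(a, b)\<close> on tensors, as a derivation.\<close>

definition unit_action :: "'s set \<Rightarrow> 'n \<Rightarrow> 'n \<Rightarrow> (('s \<Rightarrow> 'n) \<Rightarrow> rat) \<Rightarrow> ('s \<Rightarrow> 'n) \<Rightarrow> rat" where
  "unit_action S a b c \<alpha> = (\<Sum>x\<in>S. if \<alpha> x = a then c (\<alpha>(x := b)) else 0)"

text \<open>Transposing the matrix unit at \<open>(a, b)\<close> gives the one at
  \<open>(b, a)\<close>; \<open>sum_idx_update\<close> realizes this in each slot
  separately.\<close>

lemma unit_action_adjoint:
  fixes a b :: "'n::finite"
  assumes "finite S"
  shows "(\<Sum>\<alpha>\<in>idx S. u \<alpha> * unit_action S a b c \<alpha>) = (\<Sum>\<alpha>\<in>idx S. unit_action S b a u \<alpha> * c \<alpha>)"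
proof -
  have "(\<Sum>\<alpha>\<in>idx S. u \<alpha> * unit_action S a b c \<alpha>)
      = (\<Sum>x\<in>S. \<Sum>\<alpha>\<in>idx S. if \<alpha> x = a then u \<alpha> * c (\<alpha>(x := b)) else 0)"
    by (subst sum.swap) (simp add: unit_action_def sum_distrib_left if_distrib[of "\<lambda>y. _ * y"] cong: if_cong)
  also have "\<dots> = (\<Sum>x\<in>S. \<Sum>\<alpha>\<in>idx S. if \<alpha> x = b then u (\<alpha>(x := a)) * c \<alpha> else 0)"
    by (intro sum.cong refl sum_idx_update assms)
  also have "\<dots> = (\<Sum>\<alpha>\<in>idx S. unit_action S b a u \<alpha> * c \<alpha>)"
    by (subst sum.swap) (simp add: unit_action_def sum_distrib_right if_distrib[of "\<lambda>y. y * _"] cong: if_cong)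
  finally show ?thesis .
qed

text \<open>The double action overwrites two slots of value \<open>b\<close> by \<open>a\<close>.
  For distinct slots the sum over \<open>a\<close> is a trace of \<open>c\<close> and vanishes.
  Hitting the same slot twice is possible only for \<open>a = b\<close> and returns
  \<open>c \<alpha>\<close>, once for every slot with value \<open>b\<close>.\<close>

lemma unit_action_twice:
  fixes b :: "'n::finite"
  assumes "finite S"
    and traceless: "\<And>x y. x \<in> S \<Longrightarrow> y \<in> S \<Longrightarrow> x \<noteq> y \<Longrightarrow> (\<Sum>w\<in>UNIV. c (\<alpha>(x := w, y := w))) = 0"
  shows "(\<Sum>a\<in>UNIV. unit_action S b a (unit_action S b a c) \<alpha>) = of_nat (card {x\<in>S. \<alpha> x = b}) * c \<alpha>"
proof -
  have inner: "(\<Sum>a\<in>UNIV. unit_action S b a c (\<alpha>(x := a))) = c \<alpha>" if x: "x \<in> S" "\<alpha> x = b" for x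
  proof -
    have "(\<Sum>a\<in>UNIV. unit_action S b a c (\<alpha>(x := a)))
        = (\<Sum>y\<in>S. \<Sum>a\<in>UNIV. if (\<alpha>(x := a)) y = b then c (\<alpha>(x := a, y := a)) else 0)"
      unfolding unit_action_def by (rule sum.swap)
    also have "\<dots> = (\<Sum>y\<in>S. if y = x then c \<alpha> else 0)"
    proof (rule sum.cong[OF refl])
      fix y assume y: "y \<in> S"
      show "(\<Sum>a\<in>UNIV. if (\<alpha>(x := a)) y = b then c (\<alpha>(x := a, y := a)) else 0)
          = (if y = x then c \<alpha> else 0)"
      proof (cases "y = x")
        case True
        have "\<alpha>(x := b) = \<alpha>" using x by auto
        then show ?thesis using True by simp
      next
        case False
        then show ?thesis using traceless[OF x(1) y] by (cases "\<alpha> y = b") auto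
      qed
    qed
    finally show ?thesis using x assms(1) by simp
  qed
  have "(\<Sum>a\<in>UNIV. unit_action S b a (unit_action S b a c) \<alpha>)
      = (\<Sum>x\<in>S. if \<alpha> x = b then \<Sum>a\<in>UNIV. unit_action S b a c (\<alpha>(x := a)) else 0)"
    unfolding unit_action_def[of S b _ "unit_action S b _ c"]
    by (subst sum.swap) (intro sum.cong refl, simp)
  also have "\<dots> = (\<Sum>x\<in>S. if \<alpha> x = b then c \<alpha> else 0)"
    using inner by (intro sum.cong refl) auto
  finally show ?thesis using assms(1) by (simp add: sum.inter_filter[symmetric])
qed

lemma sum_multiplicities:
  fixes \<alpha> :: "'s \<Rightarrow> 'n::finite"
  assumes "finite S"
  shows "(\<Sum>a\<in>UNIV. card {x\<in>S. \<alpha> x = a}) = card S"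
  using sum.group[of S UNIV \<alpha> "\<lambda>_. 1::nat"] assms by simp

text \<open>
  The squared norms of all \<open>unit_action S a b c\<close> add up to \<open>card S\<close> times that of \<open>c\<close>, while those with
  \<open>a = b\<close> alone contribute at least twice as much, since the multiplicities are even.
\<close>

lemma traceless_invariant_eq_0:
  fixes c :: "('s \<Rightarrow> 'n::finite) \<Rightarrow> rat"
  assumes S: "finite S" "S \<noteq> {}"
    and even: "\<And>\<alpha> a. \<alpha> \<in> idx S \<Longrightarrow> odd (card {x\<in>S. \<alpha> x = a}) \<Longrightarrow> c \<alpha> = 0"
    and inv: "\<And>\<alpha> a b. \<alpha> \<in> idx S \<Longrightarrow> unit_action S a b c \<alpha> = unit_action S b a c \<alpha>"
    and traceless: "\<And>\<alpha> x y. \<alpha> \<in> idx S \<Longrightarrow> x \<in> S \<Longrightarrow> y \<in> S \<Longrightarrow> x \<noteq> y \<Longrightarrow>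
      (\<Sum>w\<in>UNIV. c (\<alpha>(x := w, y := w))) = 0"
    and \<alpha>: "\<alpha> \<in> idx S"
  shows "c \<alpha> = 0"
proof -
  define \<mu> where "\<mu> a \<alpha> = card {x\<in>S. \<alpha> x = a}" for a :: 'n and \<alpha>
  note fin = finite_idx[OF S(1), where ?'n = 'n]
  have diag: "unit_action S a a c \<alpha> = of_nat (\<mu> a \<alpha>) * c \<alpha>" for a \<alpha>
    unfolding unit_action_def \<mu>_def
    by (subst sum.cong[OF refl, of S _ "\<lambda>x. if \<alpha> x = a then c \<alpha> else 0"])
       (auto simp: sum.inter_filter[symmetric] S fun_upd_idem)
  have "(\<Sum>\<alpha>\<in>idx S. \<Sum>a\<in>UNIV. (of_nat (\<mu> a \<alpha>) * c \<alpha>)\<^sup>2)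
      = (\<Sum>a\<in>UNIV. \<Sum>\<alpha>\<in>idx S. (unit_action S a a c \<alpha>)\<^sup>2)"
    unfolding diag by (rule sum.swap)
  \<comment> \<open>All terms are squares, so the terms with \<open>b = a\<close> are bounded by the
    full sum over \<open>b\<close>.\<close>
  also have "\<dots> \<le> (\<Sum>a\<in>UNIV. \<Sum>b\<in>UNIV. \<Sum>\<alpha>\<in>idx S. (unit_action S a b c \<alpha>)\<^sup>2)"
    by (intro sum_mono member_le_sum) (auto intro: sum_nonneg)
  \<comment> \<open>Invariance swaps the indices in one factor, so that adjointness can turn the
    product into the double action evaluated by \<open>unit_action_twice\<close>.\<close>
  also have "\<dots> = (\<Sum>a\<in>UNIV. \<Sum>b\<in>UNIV. \<Sum>\<alpha>\<in>idx S. unit_action S a b c \<alpha> * unit_action S b a c \<alpha>)"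
    by (intro sum.cong refl) (simp add: power2_eq_square inv)
  also have "\<dots> = (\<Sum>a\<in>UNIV. \<Sum>b\<in>UNIV. \<Sum>\<alpha>\<in>idx S. unit_action S a b (unit_action S a b c) \<alpha> * c \<alpha>)"
    by (simp only: unit_action_adjoint[OF S(1)])
  also have "\<dots> = (\<Sum>a\<in>UNIV. \<Sum>\<alpha>\<in>idx S. of_nat (\<mu> a \<alpha>) * c \<alpha> * c \<alpha>)"
  proof (rule sum.cong[OF refl])
    fix a :: 'n
    have "(\<Sum>b\<in>UNIV. \<Sum>\<alpha>\<in>idx S. unit_action S a b (unit_action S a b c) \<alpha> * c \<alpha>)
        = (\<Sum>\<alpha>\<in>idx S. (\<Sum>b\<in>UNIV. unit_action S a b (unit_action S a b c) \<alpha>) * c \<alpha>)"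
      by (subst sum.swap) (simp add: sum_distrib_right)
    also have "\<dots> = (\<Sum>\<alpha>\<in>idx S. of_nat (\<mu> a \<alpha>) * c \<alpha> * c \<alpha>)"
      by (intro sum.cong refl) (simp add: unit_action_twice[OF S(1)] traceless \<mu>_def)
    finally show "(\<Sum>b\<in>UNIV. \<Sum>\<alpha>\<in>idx S. unit_action S a b (unit_action S a b c) \<alpha> * c \<alpha>)
      = (\<Sum>\<alpha>\<in>idx S. of_nat (\<mu> a \<alpha>) * c \<alpha> * c \<alpha>)" .
  qed
  also have "\<dots> = (\<Sum>\<alpha>\<in>idx S. \<Sum>a\<in>UNIV. of_nat (\<mu> a \<alpha>) * (c \<alpha>)\<^sup>2)"
    by (subst sum.swap) (simp add: power2_eq_square mult.assoc)
  finally have le: "(\<Sum>\<alpha>\<in>idx S. \<Sum>a\<in>UNIV. (of_nat (\<mu> a \<alpha>) * c \<alpha>)\<^sup>2)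
      \<le> (\<Sum>\<alpha>\<in>idx S. \<Sum>a\<in>UNIV. of_nat (\<mu> a \<alpha>) * (c \<alpha>)\<^sup>2)" .
  have "2 * (of_nat (\<mu> a \<alpha>) * (c \<alpha>)\<^sup>2) \<le> (of_nat (\<mu> a \<alpha>) * c \<alpha>)\<^sup>2" if "\<alpha> \<in> idx S" for a \<alpha>
  proof (cases "c \<alpha> = 0")
    case False
    then have "Parity.even (\<mu> a \<alpha>)" using even[OF that, of a] by (auto simp: \<mu>_def)
    then have "2 * \<mu> a \<alpha> \<le> (\<mu> a \<alpha>)\<^sup>2" by (auto elim!: evenE simp: power2_eq_square)
    then have "(of_nat (2 * \<mu> a \<alpha>) :: rat) \<le> of_nat ((\<mu> a \<alpha>)\<^sup>2)"
      by (simp only: of_nat_le_iff)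
    from mult_right_mono[OF this, of "(c \<alpha>)\<^sup>2"] show ?thesis
      by (simp add: power_mult_distrib mult.assoc)
  qed simp
  then have "(\<Sum>\<alpha>\<in>idx S. \<Sum>a\<in>UNIV. 2 * (of_nat (\<mu> a \<alpha>) * (c \<alpha>)\<^sup>2))
      \<le> (\<Sum>\<alpha>\<in>idx S. \<Sum>a\<in>UNIV. (of_nat (\<mu> a \<alpha>) * c \<alpha>)\<^sup>2)"
    by (intro sum_mono)
  \<comment> \<open>Twice a sum of nonnegative terms is at most the sum itself. Since the
    multiplicities add up to \<open>card S\<close>, this sum is \<open>card S\<close> times the
    squared norm of \<open>c\<close>, which must therefore vanish.\<close>
  with le have "2 * (\<Sum>\<alpha>\<in>idx S. \<Sum>a\<in>UNIV. of_nat (\<mu> a \<alpha>) * (c \<alpha>)\<^sup>2)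
      \<le> (\<Sum>\<alpha>\<in>idx S. \<Sum>a\<in>UNIV. of_nat (\<mu> a \<alpha>) * (c \<alpha>)\<^sup>2)"
    by (simp add: sum_distrib_left)
  moreover have "(\<Sum>a\<in>UNIV. of_nat (\<mu> a \<alpha>) * (c \<alpha>)\<^sup>2) = of_nat (card S) * (c \<alpha>)\<^sup>2" for \<alpha>
    unfolding sum_multiplicities[OF S(1), of \<alpha>, symmetric] by (simp add: sum_distrib_right \<mu>_def)
  ultimately have "(\<Sum>\<alpha>\<in>idx S. of_nat (card S) * (c \<alpha>)\<^sup>2) \<le> 0"
    by simp
  moreover have "of_nat (card S) * (c \<alpha>)\<^sup>2 \<le> (\<Sum>\<alpha>\<in>idx S. of_nat (card S) * (c \<alpha>)\<^sup>2)"
    using \<alpha> fin by (intro member_le_sum) auto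
  ultimately have "of_nat (card S) * (c \<alpha>)\<^sup>2 \<le> 0" by simp
  then show ?thesis using S by (simp add: mult_le_0_iff card_0_eq)
qed

text \<open>\<open>matching S \<theta>\<close>: \<open>\<theta>\<close> is the product of the Kronecker deltas along a perfect matching of \<open>S\<close>.\<close>

inductive matching :: "'s set \<Rightarrow> (('s \<Rightarrow> 'n) \<Rightarrow> rat) \<Rightarrow> bool" where
  empty: "matching {} (\<lambda>_. 1)"
| pair: "matching S \<theta> \<Longrightarrow> y \<notin> S \<Longrightarrow> z \<notin> S \<Longrightarrow> y \<noteq> z \<Longrightarrow>
    matching (insert y (insert z S)) (\<lambda>\<alpha>. if \<alpha> y = \<alpha> z then \<theta> \<alpha> else 0)"

lemma matching_cong: "matching S \<theta> \<Longrightarrow> (\<And>x. x \<in> S \<Longrightarrow> \<alpha> x = \<beta> x) \<Longrightarrow> \<theta> \<alpha> = \<theta> \<beta>"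
  by (induction rule: matching.induct) auto

lemma matching_upd: "matching S \<theta> \<Longrightarrow> y \<notin> S \<Longrightarrow> \<theta> (\<alpha>(y := w)) = \<theta> \<alpha>"
  by (rule matching_cong) auto

text \<open>Separates the slots \<open>y\<close> and \<open>z\<close> that are about to be
  contracted. After summation over \<open>w\<close> their contribution is symmetric in
  \<open>a\<close> and \<open>b\<close>, so contraction preserves invariance under the difference of
  the two matrix units.\<close>

lemma unit_action_insert2:
  assumes "finite S" "y \<notin> S" "z \<notin> S" "y \<noteq> z"
  shows "unit_action (insert y (insert z S)) a b c (\<alpha>(y := w, z := w))
    = (\<Sum>x\<in>S. if \<alpha> x = a then c (\<alpha>(x := b, y := w, z := w)) else 0)
    + (if w = a then c (\<alpha>(y := b, z := a)) + c (\<alpha>(y := a, z := b)) else 0)"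
proof -
  have "(\<Sum>x\<in>S. if (\<alpha>(y := w, z := w)) x = a then c ((\<alpha>(y := w, z := w))(x := b)) else 0)
      = (\<Sum>x\<in>S. if \<alpha> x = a then c (\<alpha>(x := b, y := w, z := w)) else 0)"
  proof (rule sum.cong[OF refl])
    fix x assume "x \<in> S"
    then have "x \<noteq> y" "x \<noteq> z" using assms by auto
    then show "(if (\<alpha>(y := w, z := w)) x = a then c ((\<alpha>(y := w, z := w))(x := b)) else 0)
      = (if \<alpha> x = a then c (\<alpha>(x := b, y := w, z := w)) else 0)"
      by (simp add: fun_upd_twist)
  qed
  then show ?thesis
    unfolding unit_action_def using assms by (simp add: fun_upd_twist[of y z])
qed

text \<open>Induction on the number of slots. A contraction of \<open>c\<close> along two slots
  inherits all hypotheses, so it is zero; thus \<open>c\<close> is traceless and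
  \<open>traceless_invariant_eq_0\<close> applies.\<close>

theorem invariant_orthogonal_matchings_eq_0:
  fixes c :: "('s \<Rightarrow> 'n::finite) \<Rightarrow> rat"
  assumes "finite S"
    and "\<And>\<alpha> a. \<alpha> \<in> idx S \<Longrightarrow> odd (card {x\<in>S. \<alpha> x = a}) \<Longrightarrow> c \<alpha> = 0"
    and "\<And>\<alpha> a b. \<alpha> \<in> idx S \<Longrightarrow> unit_action S a b c \<alpha> = unit_action S b a c \<alpha>"
    and "\<And>\<theta>. matching S \<theta> \<Longrightarrow> (\<Sum>\<alpha>\<in>idx S. \<theta> \<alpha> * c \<alpha>) = 0"
    and "\<alpha> \<in> idx S"
  shows "c \<alpha> = 0"
  using assms
proof (induction "card S" arbitrary: S c \<alpha> rule: less_induct)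
  case less
  note S = less.prems(1) and even = less.prems(2) and inv = less.prems(3) and orth = less.prems(4)
  show ?case
  proof (cases "S = {}")
    case True
    then show ?thesis using orth[of "\<lambda>_. 1"] less.prems(5) matching.empty by simp
  next
    case False
    show ?thesis
    proof (rule traceless_invariant_eq_0[OF S False even inv _ less.prems(5)])
      fix \<gamma> :: "'s \<Rightarrow> 'n" and y z assume \<gamma>: "\<gamma> \<in> idx S" and yz: "y \<in> S" "z \<in> S" "y \<noteq> z"
      define T where "T = S - {y, z}"
      define d where "d \<beta> = (\<Sum>w\<in>UNIV. c (\<beta>(y := w, z := w)))" for \<beta>
      have T: "S = insert y (insert z T)" "y \<notin> T" "z \<notin> T" "finite T"
        using yz S by (auto simp: T_def)
      have lt: "card T < card S" using yz by (intro psubset_card_mono S) (auto simp: T_def)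
      have up: "\<beta>(y := w, z := w) \<in> idx S" if "\<beta> \<in> idx T" for \<beta> :: "'s \<Rightarrow> 'n" and w
        using that T by (auto simp: PiE_iff extensional_def)
      have "d (restrict \<gamma> T) = 0"
      proof (rule less.hyps[OF lt T(4)])
        fix \<beta> :: "'s \<Rightarrow> 'n" and a assume \<beta>: "\<beta> \<in> idx T" and odd: "odd (card {x\<in>T. \<beta> x = a})"
        \<comment> \<open>Two equal entries at \<open>y\<close> and \<open>z\<close> change a
          multiplicity by 0 or 2, so its parity survives.\<close>
        have "odd (card {x\<in>S. (\<beta>(y := w, z := w)) x = a})" for w
        proof (cases "w = a")
          case True
          then have "{x\<in>S. (\<beta>(y := w, z := w)) x = a} = insert y (insert z {x\<in>T. \<beta> x = a})"
            using T by auto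
          then show ?thesis using T yz odd by simp
        next
          case False
          then have "{x\<in>S. (\<beta>(y := w, z := w)) x = a} = {x\<in>T. \<beta> x = a}"
            using T by auto
          then show ?thesis using odd by simp
        qed
        then show "d \<beta> = 0" unfolding d_def using even[OF up[OF \<beta>]] by (intro sum.neutral) blast
      next
        fix \<beta> :: "'s \<Rightarrow> 'n" and a b assume \<beta>: "\<beta> \<in> idx T"
        have *: "(\<Sum>w\<in>UNIV. unit_action S a b c (\<beta>(y := w, z := w)))
            = unit_action T a b d \<beta> + (c (\<beta>(y := b, z := a)) + c (\<beta>(y := a, z := b)))" for a b
        proof -
          have "unit_action T a b d \<beta>
              = (\<Sum>w\<in>UNIV. \<Sum>x\<in>T. if \<beta> x = a then c (\<beta>(x := b, y := w, z := w)) else 0)"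
            unfolding unit_action_def d_def by (subst sum.swap) (intro sum.cong refl, simp)
          then show ?thesis
            unfolding T(1) using unit_action_insert2[OF T(4,2,3) yz(3), of a b c \<beta>]
            by (simp add: sum.distrib)
        qed
        \<comment> \<open>The extra terms in \<open>*\<close> are the same for \<open>(a, b)\<close>
          and \<open>(b, a)\<close> and cancel.\<close>
        from *[of a b] *[of b a] show "unit_action T a b d \<beta> = unit_action T b a d \<beta>"
          using inv[OF up[OF \<beta>]] by simp
      next
        fix \<theta> :: "('s \<Rightarrow> 'n) \<Rightarrow> rat" assume \<theta>: "matching T \<theta>"
        \<comment> \<open>Joining \<open>y\<close> and \<open>z\<close> extends a matching of
          \<open>T\<close> to one of \<open>S\<close>, and pairing \<open>c\<close> with the latter
          is pairing the contraction \<open>d\<close> with the former.\<close>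
        have "(\<Sum>\<alpha>\<in>idx S. (if \<alpha> y = \<alpha> z then \<theta> \<alpha> else 0) * c \<alpha>) = 0"
          by (rule orth) (use matching.pair[OF \<theta> T(2,3) yz(3)] T(1) in simp)
        then show "(\<Sum>\<beta>\<in>idx T. \<theta> \<beta> * d \<beta>) = 0"
          unfolding T(1) sum_idx_insert2[OF T(2,3) yz(3)]
          using yz(3) by (simp add: matching_upd[OF \<theta>] T(2,3) d_def sum_distrib_left
              if_distrib[of "\<lambda>y. y * _"] cong: if_cong)
      qed auto
      moreover have "(restrict \<gamma> T)(y := w, z := w) = \<gamma>(y := w, z := w)" for w
        using \<gamma> T by (auto simp: fun_eq_iff PiE_iff extensional_def)
      ultimately show "(\<Sum>w\<in>UNIV. c (\<gamma>(y := w, z := w))) = 0" by (simp add: d_def)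
    qed
  qed
qed


section \<open>Orthogonal projection over the rational numbers\<close>

interpretation rat_fun: vector_space "\<lambda>(c :: rat) (f :: 'i \<Rightarrow> rat) i. c * f i"
  by unfold_locales (auto simp: fun_eq_iff algebra_simps)

lemma orthogonal_to_span:
  assumes "\<And>u. u \<in> W \<Longrightarrow> (\<Sum>i\<in>A. f i * u i) = 0" "u \<in> rat_fun.span W"
  shows "(\<Sum>i\<in>A. f i * u i) = 0"
proof -
  have "rat_fun.subspace {u. (\<Sum>i\<in>A. f i * u i) = 0}"
    by (rule rat_fun.subspaceI)
       (auto simp: distrib_left sum.distrib mult.left_commute[of _ "_ :: rat"] sum_distrib_left[symmetric])
  with rat_fun.span_minimal[of W "{u. (\<Sum>i\<in>A. f i * u i) = 0}"] assms show ?thesis by auto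
qed

text \<open>One Gram-Schmidt step per spanning vector. The vectors are not normalized, so no square
  roots are taken and the rational field suffices.\<close>

lemma orthogonal_projection_finite:
  fixes A :: "'i set"
  assumes "finite B" "finite A"
  shows "\<exists>w\<in>rat_fun.span B. \<forall>u\<in>rat_fun.span B. (\<Sum>i\<in>A. (t i - w i) * u i) = 0"
  using assms(1)
proof (induction B arbitrary: t rule: finite_induct)
  case empty
  show ?case by (intro bexI[of _ 0]) auto
next
  case (insert b B)
  let ?ip = "\<lambda>f g. \<Sum>i\<in>A. f i * g i :: rat"
  obtain p where p: "p \<in> rat_fun.span B"
    and p': "\<And>u. u \<in> rat_fun.span B \<Longrightarrow> ?ip (\<lambda>i. b i - p i) u = 0"
    using insert.IH[of b] by blast
  obtain w where w: "w \<in> rat_fun.span B"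
    and w': "\<And>u. u \<in> rat_fun.span B \<Longrightarrow> ?ip (\<lambda>i. t i - w i) u = 0"
    using insert.IH[of t] by blast
  define b' where "b' = b - p"
  \<comment> \<open>The coefficient of the projection to \<open>b'\<close>, the part of
    \<open>b\<close> orthogonal to the span of \<open>B\<close>.\<close>
  define k where "k = ?ip (\<lambda>i. t i - w i) b' / ?ip b' b'"
  define v where "v = w + (\<lambda>i. k * b' i)"
  have sub: "rat_fun.span B \<subseteq> rat_fun.span (insert b B)" by (intro rat_fun.span_mono) auto
  have b': "b' \<in> rat_fun.span (insert b B)"
    unfolding b'_def using p sub by (intro rat_fun.span_diff) (auto intro: rat_fun.span_base)
  have v: "v \<in> rat_fun.span (insert b B)"
    unfolding v_def using w sub b' by (intro rat_fun.span_add rat_fun.span_scale) auto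
  have ip_v: "?ip (\<lambda>i. t i - v i) u = ?ip (\<lambda>i. t i - w i) u - k * ?ip b' u" for u
    by (simp add: v_def algebra_simps sum_subtractf sum.distrib sum_distrib_left)
  have orth_B: "?ip (\<lambda>i. t i - v i) u = 0" if "u \<in> rat_fun.span B" for u
    using w'[OF that] p'[OF that] by (simp add: ip_v b'_def)
  have "?ip (\<lambda>i. t i - v i) b' = 0"
  proof (cases "?ip b' b' = 0")
    \<comment> \<open>A rational vector of length zero on \<open>A\<close> vanishes on
      \<open>A\<close>, so there is nothing to correct.\<close>
    case True
    then have "b' i = 0" if "i \<in> A" for i
      using that assms(2) sum_nonneg_eq_0_iff[of A "\<lambda>i. b' i * b' i"] by auto
    then show ?thesis by simp
  next
    case False
    then show ?thesis unfolding ip_v by (simp add: k_def)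
  qed
  then have "?ip (\<lambda>i. t i - v i) b = ?ip (\<lambda>i. t i - v i) p"
    by (simp add: b'_def right_diff_distrib sum_subtractf)
  then have "?ip (\<lambda>i. t i - v i) b = 0" using orth_B[OF p] by simp
  then have "?ip (\<lambda>i. t i - v i) u = 0" if "u \<in> rat_fun.span (insert b B)" for u
    using orth_B rat_fun.span_base by (intro orthogonal_to_span[OF _ that]) auto
  then show ?case using v by blast
qed

text \<open>The set \<open>W\<close> may be infinite, but functions supported on the finite set
  \<open>A\<close> lie in the span of the indicators \<open>e i\<close>, so a basis of the span of
  \<open>W\<close> is finite.\<close>

lemma orthogonal_projection:
  fixes A :: "'i set"
  assumes "finite A" and supp: "\<And>u i. u \<in> W \<Longrightarrow> i \<notin> A \<Longrightarrow> u i = 0"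
  shows "\<exists>w\<in>rat_fun.span W. \<forall>u\<in>rat_fun.span W. (\<Sum>i\<in>A. (t i - w i) * u i) = 0"
proof -
  obtain B where B: "B \<subseteq> W" "rat_fun.independent B" "W \<subseteq> rat_fun.span B"
    by (rule rat_fun.maximal_independent_subset)
  define e :: "'i \<Rightarrow> 'i \<Rightarrow> rat" where "e i = (\<lambda>j. of_bool (j = i))" for i
  have "u \<in> rat_fun.span (e ` A)" if "u \<in> B" for u
  proof -
    have "u = (\<Sum>i\<in>A. (\<lambda>j. u i * e i j))"
    proof
      fix j
      have "(\<Sum>i\<in>A. (\<lambda>j. u i * e i j)) j = (\<Sum>i\<in>A. u i * e i j)"
        using assms(1) by (induction A rule: finite_induct) auto
      also have "\<dots> = (\<Sum>i\<in>A. if i = j then u j else 0)"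
        by (intro sum.cong) (auto simp: e_def)
      also have "\<dots> = u j" using that B(1) supp assms(1) by auto
      finally show "u j = (\<Sum>i\<in>A. (\<lambda>j. u i * e i j)) j" by simp
    qed
    moreover have "\<dots> \<in> rat_fun.span (e ` A)"
      by (intro rat_fun.span_sum rat_fun.span_scale rat_fun.span_base) auto
    ultimately show ?thesis by simp
  qed
  then have "finite B"
    using rat_fun.independent_span_bound[OF finite_imageI[OF assms(1)] B(2), of e] by blast
  moreover have "rat_fun.span W = rat_fun.span B"
    using B by (metis rat_fun.span_eq rat_fun.span_superset subset_trans)
  ultimately show ?thesis using orthogonal_projection_finite[of B A t] assms(1) by simp
qed


section \<open>Tensors fixed by reflections\<close>

text \<open>The orthogonal reflection in the hyperplane perpendicular to \<open>v\<close>. For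
  \<open>v = 0\<close> the quotient is zero and the matrix is the identity.\<close>

definition reflection :: "('n::finite \<Rightarrow> rat) \<Rightarrow> 'n \<Rightarrow> 'n \<Rightarrow> rat" where
  "reflection v p q = of_bool (p = q) - 2 * v p * v q / (\<Sum>r\<in>UNIV. (v r)\<^sup>2)"

lemma reflection_sym: "reflection v p q = reflection v q p"
  by (simp add: reflection_def mult.commute mult.left_commute eq_commute)

lemma reflection_involution:
  "(\<Sum>q\<in>UNIV. reflection v p q * reflection v q r) = of_bool (p = r)"
proof -
  define N where "N = (\<Sum>r\<in>UNIV. (v r)\<^sup>2)"
  define i where "i = inverse N"
  \<comment> \<open>This form of \<open>i * N = 1\<close> remains true when \<open>N = 0\<close>, so
    the zero vector needs no separate treatment.\<close>
  have iN: "i * i * N = i" by (cases "N = 0") (simp_all add: i_def)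
  have refl: "reflection v p q = of_bool (p = q) - 2 * i * v p * v q" for p q
    by (simp add: reflection_def N_def[symmetric] i_def field_simps)
  have expand: "(d - 2 * i * a * b) * (e - 2 * i * b * c)
      = d * e - d * (2 * i * b * c) - e * (2 * i * a * b) + 4 * a * c * i * i * b\<^sup>2" for a b c d e
    by (simp add: algebra_simps power2_eq_square)
  have "(\<Sum>q\<in>UNIV. reflection v p q * reflection v q r)
      = (\<Sum>q\<in>UNIV. of_bool (p = q) * of_bool (q = r) - of_bool (p = q) * (2 * i * v q * v r)
        - of_bool (q = r) * (2 * i * v p * v q) + 4 * v p * v r * i * i * (v q)\<^sup>2)"
    unfolding refl by (intro sum.cong expand HOL.refl)
  also have "\<dots> = of_bool (p = r) - 4 * v p * v r * i + 4 * v p * v r * (i * i * N)"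
  proof -
    have delta: "(\<Sum>q\<in>UNIV. of_bool (p = q) * f q) = f p" "(\<Sum>q\<in>UNIV. of_bool (q = r) * f q) = f r"
      for f :: "'a \<Rightarrow> rat"
      by (simp_all add: of_bool_def if_distrib[of "\<lambda>x. x * _"] cong: if_cong)
    show ?thesis
      unfolding sum.distrib sum_subtractf delta sum_distrib_left[symmetric] N_def[symmetric]
      by (simp add: mult_ac)
  qed
  finally show ?thesis by (simp add: iN)
qed

definition tensor_power :: "'s set \<Rightarrow> ('n \<Rightarrow> 'n \<Rightarrow> rat) \<Rightarrow> ('s \<Rightarrow> 'n) \<Rightarrow> ('s \<Rightarrow> 'n) \<Rightarrow> rat" where
  "tensor_power S s \<alpha> \<beta> = (\<Prod>x\<in>S. s (\<alpha> x) (\<beta> x))"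

lemma prod_of_bool_eq_idx:
  assumes "finite S" "\<alpha> \<in> idx S" "\<beta> \<in> idx S"
  shows "(\<Prod>x\<in>S. of_bool (\<alpha> x = \<beta> x)) = (of_bool (\<alpha> = \<beta>) :: 'a::comm_semiring_1)"
proof -
  have "\<alpha> = \<beta> \<longleftrightarrow> (\<forall>x\<in>S. \<alpha> x = \<beta> x)" using assms(2,3) by (auto intro: PiE_ext)
  moreover have "(\<Prod>x\<in>S. of_bool (\<alpha> x = \<beta> x)) = (of_bool (\<forall>x\<in>S. \<alpha> x = \<beta> x) :: 'a)"
    using assms(1) by (induction S rule: finite_induct) auto
  ultimately show ?thesis by simp
qed

lemma tensor_power_reflection_sym:
  "tensor_power S (reflection v) \<alpha> \<beta> = tensor_power S (reflection v) \<beta> \<alpha>"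
  by (simp add: tensor_power_def reflection_sym)

lemma tensor_power_reflection_involution:
  assumes "finite S" "\<alpha> \<in> idx S" "\<beta> \<in> idx S"
  shows "(\<Sum>\<gamma>\<in>idx S. tensor_power S (reflection v) \<alpha> \<gamma> * tensor_power S (reflection v) \<gamma> \<beta>)
    = of_bool (\<alpha> = \<beta>)"
  unfolding tensor_power_def prod.distrib[symmetric]
  by (subst prod_sum_PiE[symmetric]) (simp_all add: assms reflection_involution prod_of_bool_eq_idx)

lemma matching_finite: "matching S \<theta> \<Longrightarrow> finite S"
  by (induction rule: matching.induct) auto

text \<open>A Kronecker delta is fixed by every orthogonal matrix. Summing out the pair
  \<open>y\<close>, \<open>z\<close> leaves the product of the reflection with itself, which is the
  identity.\<close>

lemma matching_fixed:
  assumes "matching S \<theta>"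
  shows "(\<Sum>\<beta>\<in>idx S. tensor_power S (reflection v) \<alpha> \<beta> * \<theta> \<beta>) = \<theta> \<alpha>"
  using assms
proof (induction rule: matching.induct)
  case empty
  show ?case by (simp add: tensor_power_def)
next
  case (pair S \<theta> y z)
  have fin: "finite S" by (rule matching_finite[OF pair.hyps(1)])
  let ?s = "reflection v" and ?t = "tensor_power S (reflection v) \<alpha>"
  have tp: "tensor_power (insert y (insert z S)) ?s \<alpha> (\<beta>(y := w, z := w'))
      = ?s (\<alpha> y) w * (?s (\<alpha> z) w' * ?t \<beta>)" for \<beta> w w'
  proof -
    have "(\<Prod>x\<in>S. ?s (\<alpha> x) ((\<beta>(y := w, z := w')) x)) = (\<Prod>x\<in>S. ?s (\<alpha> x) (\<beta> x))"
      using pair.hyps by (intro prod.cong) auto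
    then show ?thesis using pair.hyps fin by (simp add: tensor_power_def del: fun_upd_apply) simp
  qed
  have "(\<Sum>\<beta>\<in>idx (insert y (insert z S)). tensor_power (insert y (insert z S)) ?s \<alpha> \<beta>
        * (if \<beta> y = \<beta> z then \<theta> \<beta> else 0))
      = (\<Sum>\<beta>\<in>idx S. \<Sum>w\<in>UNIV. \<Sum>w'\<in>UNIV. ?s (\<alpha> y) w * (?s (\<alpha> z) w' * ?t \<beta>) * (if w = w' then \<theta> \<beta> else 0))"
    unfolding sum_idx_insert2[OF pair.hyps(2-4)] tp
    using pair.hyps by (simp add: matching_upd[OF pair.hyps(1)] cong: if_cong)
  also have "\<dots> = (\<Sum>\<beta>\<in>idx S. (\<Sum>w\<in>UNIV. ?s (\<alpha> y) w * ?s w (\<alpha> z)) * (?t \<beta> * \<theta> \<beta>))"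
    by (simp add: if_distrib[of "\<lambda>x. _ * x"] sum_distrib_right sum_distrib_left
        reflection_sym[of v "\<alpha> z"] mult_ac cong: if_cong)
  also have "\<dots> = of_bool (\<alpha> y = \<alpha> z) * (\<Sum>\<beta>\<in>idx S. ?t \<beta> * \<theta> \<beta>)"
    unfolding reflection_involution by (simp add: sum_distrib_left)
  finally show ?case using pair.IH by simp
qed

text \<open>The vectors \<open>e_a + t e_b\<close>. The value \<open>t = 0\<close> gives the
  coordinate flips used for parity; the other values provide enough interpolation points for an
  infinitesimal statement.\<close>

definition test_vectors :: "nat \<Rightarrow> ('n \<Rightarrow> rat) set" where
  "test_vectors L = (\<lambda>(a, b, t) p. of_bool (p = a) + of_nat t * of_bool (p = b)) ` (UNIV \<times> UNIV \<times> {..L})"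

lemma finite_test_vectors: "finite (test_vectors L :: ('n::finite \<Rightarrow> rat) set)"
  by (simp add: test_vectors_def)

lemma test_vectors_memI:
  "t \<le> L \<Longrightarrow> (\<lambda>p. of_bool (p = a) + of_nat t * of_bool (p = b)) \<in> test_vectors L"
  unfolding test_vectors_def by (rule image_eqI[of _ _ "(a, b, t)"]) auto

text \<open>The reflection in a coordinate vector is diagonal and multiplies the entry at
  \<open>\<alpha>\<close> by -1 to the multiplicity of \<open>a\<close> in \<open>\<alpha>\<close>.
  For odd multiplicity this reads \<open>c \<alpha> = - c \<alpha>\<close>.\<close>

lemma flip_invariant_even:
  fixes c :: "('s \<Rightarrow> 'n::finite) \<Rightarrow> rat"
  assumes S: "finite S"
    and fixed: "\<And>\<alpha>. \<alpha> \<in> idx S \<Longrightarrow>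
      (\<Sum>\<beta>\<in>idx S. tensor_power S (reflection (\<lambda>p. of_bool (p = a))) \<alpha> \<beta> * c \<beta>) = c \<alpha>"
    and \<alpha>: "\<alpha> \<in> idx S" and odd: "odd (card {x\<in>S. \<alpha> x = a})"
  shows "c \<alpha> = 0"
proof -
  let ?v = "\<lambda>p. of_bool (p = a) :: rat"
  have N: "(\<Sum>r\<in>UNIV. (?v r)\<^sup>2) = 1" by (simp add: of_bool_def if_distrib[of "\<lambda>x. x\<^sup>2"] cong: if_cong)
  have refl: "reflection ?v p q = of_bool (p = q) * (if p = a then -1 else 1)" for p q
    unfolding reflection_def N by (auto simp: of_bool_def)
  have "tensor_power S (reflection ?v) \<alpha> \<beta> = of_bool (\<alpha> = \<beta>) * (\<Prod>x\<in>S. if \<alpha> x = a then -1 else 1)"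
    if "\<beta> \<in> idx S" for \<beta>
    unfolding tensor_power_def refl prod.distrib prod_of_bool_eq_idx[OF S \<alpha> that] by simp
  then have "c \<alpha> = (\<Sum>\<beta>\<in>idx S. of_bool (\<alpha> = \<beta>) * (\<Prod>x\<in>S. if \<alpha> x = a then -1 else 1) * c \<beta>)"
    using fixed[OF \<alpha>] by simp
  also have "\<dots> = (\<Sum>\<beta>\<in>idx S. if \<beta> = \<alpha> then (\<Prod>x\<in>S. if \<alpha> x = a then -1 else 1) * c \<beta> else 0)"
    by (intro sum.cong) auto
  also have "\<dots> = (\<Prod>x\<in>S. if \<alpha> x = a then -1 else 1) * c \<alpha>"
    using \<alpha> finite_idx[OF S, where ?'n = 'n] by simp
  also have "(\<Prod>x\<in>S. if \<alpha> x = a then -1 else 1 :: rat) = (-1) ^ card {x\<in>S. \<alpha> x = a}"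
    using S by (simp add: prod.inter_filter[symmetric])
  finally show ?thesis using odd by simp
qed

text \<open>
  Multiplied by \<open>(1 + t\<^sup>2) ^ card S\<close>, invariance under the reflection in \<open>e\<^sub>a + t e\<^sub>b\<close> is a polynomial
  identity in \<open>t\<close>. It holds for more values of \<open>t\<close> than its degree, so its linear coefficient vanishes.
\<close>

lemma reflection_invariant_infinitesimal:
  fixes c :: "('s \<Rightarrow> 'n::finite) \<Rightarrow> rat"
  assumes S: "finite S" and L: "2 * card S \<le> L"
    and fixed: "\<And>v \<alpha>. v \<in> test_vectors L \<Longrightarrow> \<alpha> \<in> idx S \<Longrightarrow>
      (\<Sum>\<beta>\<in>idx S. tensor_power S (reflection v) \<alpha> \<beta> * c \<beta>) = c \<alpha>"
    and \<alpha>: "\<alpha> \<in> idx S"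
  shows "unit_action S a b c \<alpha> = unit_action S b a c \<alpha>"
proof (cases "a = b")
  case False
  \<comment> \<open>The polynomial variable stands for \<open>t\<close>: \<open>vp\<close> is the
    vector \<open>e_a + t e_b\<close>, \<open>R\<close> is its reflection multiplied by the squared
    length \<open>1 + t^2\<close>, and \<open>P\<close> is the defect of invariance with
    denominators cleared.\<close>
  define vp :: "'n \<Rightarrow> rat poly" where "vp p = [:of_bool (p = a), of_bool (p = b):]" for p
  define R where "R p q = Polynomial.smult (of_bool (p = q)) [:1, 0, 1:] - Polynomial.smult 2 (vp p * vp q)" for p q
  define P where "P = (\<Sum>\<beta>\<in>idx S. Polynomial.smult (c \<beta>) (\<Prod>x\<in>S. R (\<alpha> x) (\<beta> x))) - Polynomial.smult (c \<alpha>) ([:1, 0, 1:] ^ card S)"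
  have "poly P (of_nat t) = 0" if "t \<le> L" for t :: nat
  proof -
    define v :: "'n \<Rightarrow> rat" where "v = (\<lambda>p. of_bool (p = a) + of_nat t * of_bool (p = b))"
    define N :: rat where "N = 1 + of_nat t * of_nat t"
    have "(\<Sum>r\<in>UNIV. (v r)\<^sup>2) = (\<Sum>r\<in>UNIV. of_bool (r = a) + of_nat t * of_nat t * of_bool (r = b))"
      using False by (intro sum.cong refl) (auto simp: v_def power2_eq_square)
    then have vv: "(\<Sum>r\<in>UNIV. (v r)\<^sup>2) = N"
      by (simp add: sum.distrib sum_distrib_left[symmetric] N_def)
    have N0: "N \<noteq> 0" by (simp add: N_def add_nonneg_eq_0_iff)
    have R: "poly (R p q) (of_nat t) = N * reflection v p q" for p q
      unfolding reflection_def vv using N0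
      by (simp add: R_def vp_def v_def N_def[symmetric] right_diff_distrib) (simp add: N_def algebra_simps)
    have "poly P (of_nat t) = (\<Sum>\<beta>\<in>idx S. c \<beta> * (\<Prod>x\<in>S. N * reflection v (\<alpha> x) (\<beta> x))) - c \<alpha> * N ^ card S"
      by (simp add: P_def poly_sum poly_prod R N_def)
    also have "\<dots> = N ^ card S * ((\<Sum>\<beta>\<in>idx S. tensor_power S (reflection v) \<alpha> \<beta> * c \<beta>) - c \<alpha>)"
      by (simp add: prod.distrib tensor_power_def right_diff_distrib sum_distrib_left mult_ac)
    also have "\<dots> = 0" using fixed[OF test_vectors_memI[OF that] \<alpha>] by (simp add: v_def)
    finally show ?thesis .
  qed
  then have roots: "of_nat ` {..L} \<subseteq> {x. poly P x = 0}" by auto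
  have "P = 0"
  proof (rule ccontr)
    assume "P \<noteq> 0"
    have degR: "Polynomial.degree (R p q) \<le> 2" for p q
      unfolding R_def
    proof (rule degree_diff_le)
      show "Polynomial.degree (Polynomial.smult (of_bool (p = q)) [:1, 0, 1 :: rat:]) \<le> 2"
        by (rule order_trans[OF degree_smult_le]) simp
      have "Polynomial.degree (vp p) \<le> 1" for p
        unfolding vp_def by (rule order_trans[OF degree_pCons_le]) simp
      then show "Polynomial.degree (Polynomial.smult 2 (vp p * vp q)) \<le> 2"
        using degree_mult_le[of "vp p" "vp q"] order_trans[OF degree_smult_le, of "vp p * vp q" 2 2]
        by (metis add_mono one_add_one order_trans)
    qed
    have "Polynomial.degree (\<Prod>x\<in>S. R (\<alpha> x) (\<beta> x)) \<le> 2 * card S" for \<beta>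
    proof -
      have "Polynomial.degree (\<Prod>x\<in>S. R (\<alpha> x) (\<beta> x)) \<le> (\<Sum>x\<in>S. Polynomial.degree (R (\<alpha> x) (\<beta> x)))"
        using degree_prod_sum_le[OF S, of "\<lambda>x. R (\<alpha> x) (\<beta> x)"] by (simp add: o_def)
      also have "\<dots> \<le> (\<Sum>x\<in>S. 2)" by (intro sum_mono degR)
      finally show ?thesis by simp
    qed
    moreover have "Polynomial.degree ([:1, 0, 1::rat:] ^ card S) \<le> 2 * card S"
      using degree_power_le[of "[:1, 0, 1::rat:]" "card S"] by simp
    ultimately have "Polynomial.degree P \<le> 2 * card S"
      unfolding P_def
      by (intro degree_diff_le degree_sum_le finite_idx[OF S] order_trans[OF degree_smult_le])
    moreover have "card {x. poly P x = 0} \<le> Polynomial.degree P" by (rule card_poly_roots_bound) fact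
    moreover have "card (of_nat ` {..L} :: rat set) \<le> card {x. poly P x = 0}"
      by (rule card_mono[OF poly_roots_finite roots]) fact
    moreover have "card (of_nat ` {..L} :: rat set) = Suc L" by (subst card_image) (auto simp: inj_on_def)
    \<comment> \<open>There are \<open>L + 1\<close> roots, but the degree is at most
      \<open>2 * card S\<close>, hence at most \<open>L\<close>.\<close>
    ultimately show False using L by linarith
  qed
  \<comment> \<open>At \<open>t = 0\<close> the reflection is the flip of coordinate
    \<open>a\<close>, with diagonal entries \<open>\<epsilon>\<close>; the derivative there couples
    only \<open>a\<close> with \<open>b\<close>.\<close>
  define \<epsilon> :: "'n \<Rightarrow> rat" where "\<epsilon> p = (if p = a then -1 else 1)" for p
  have R0: "poly (R p q) 0 = of_bool (p = q) * \<epsilon> p" for p q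
    by (auto simp: R_def vp_def \<epsilon>_def)
  have R1: "poly (pderiv (R p q)) 0 = - 2 * (of_bool (p = a) * of_bool (q = b) + of_bool (p = b) * of_bool (q = a))" for p q
    by (simp add: R_def vp_def pderiv_diff pderiv_smult pderiv_mult pderiv_pCons)
  have "poly (pderiv ([:1, 0, 1::rat:] ^ n)) 0 = 0" for n
    by (simp add: pderiv_power pderiv_pCons)
  then have "poly (pderiv P) 0
      = (\<Sum>\<beta>\<in>idx S. c \<beta> * (\<Sum>y\<in>S. (\<Prod>x\<in>S-{y}. of_bool (\<alpha> x = \<beta> x) * \<epsilon> (\<alpha> x)) * poly (pderiv (R (\<alpha> y) (\<beta> y))) 0))"
    by (simp add: P_def pderiv_diff pderiv_smult higher_pderiv_sum[of 1, simplified] pderiv_prod poly_sum poly_prod R0)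
  also have "\<dots> = (\<Sum>y\<in>S. \<Sum>\<beta>\<in>idx S. c \<beta> * ((\<Prod>x\<in>S-{y}. of_bool (\<alpha> x = \<beta> x) * \<epsilon> (\<alpha> x)) * poly (pderiv (R (\<alpha> y) (\<beta> y))) 0))"
    by (simp only: sum_distrib_left) (rule sum.swap)
  also have "\<dots> = (\<Sum>y\<in>S. (\<Prod>x\<in>S-{y}. \<epsilon> (\<alpha> x)) * (\<Sum>w\<in>UNIV. c (\<alpha>(y := w)) * poly (pderiv (R (\<alpha> y) w)) 0))"
  proof (rule sum.cong[OF refl])
    fix y assume y: "y \<in> S"
    let ?T = "S - {y}"
    have ins: "idx S = (idx (insert y ?T) :: ('s \<Rightarrow> 'n) set)" using y by (simp add: insert_absorb)
    have \<alpha>T: "restrict \<alpha> ?T \<in> idx ?T" by auto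
    have upd: "(restrict \<alpha> ?T)(y := w) = \<alpha>(y := w)" for w
      using \<alpha> by (auto simp: fun_eq_iff PiE_iff extensional_def)
    \<comment> \<open>The undifferentiated factors are diagonal, so only tuples that agree with
      \<open>\<alpha>\<close> off \<open>y\<close> contribute.\<close>
    have pr: "(\<Prod>x\<in>?T. of_bool (\<alpha> x = (\<beta>(y := w)) x) * \<epsilon> (\<alpha> x))
        = of_bool (\<beta> = restrict \<alpha> ?T) * (\<Prod>x\<in>?T. \<epsilon> (\<alpha> x))" if "\<beta> \<in> idx ?T" for \<beta> w
    proof -
      have "(\<Prod>x\<in>?T. of_bool (\<alpha> x = (\<beta>(y := w)) x)) = (\<Prod>x\<in>?T. of_bool (restrict \<alpha> ?T x = \<beta> x) :: rat)"
        by (intro prod.cong) auto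
      then show ?thesis
        using prod_of_bool_eq_idx[OF _ \<alpha>T that, where ?'a = rat] S by (simp add: prod.distrib eq_commute)
    qed
    have "(\<Sum>\<beta>\<in>idx S. c \<beta> * ((\<Prod>x\<in>?T. of_bool (\<alpha> x = \<beta> x) * \<epsilon> (\<alpha> x)) * poly (pderiv (R (\<alpha> y) (\<beta> y))) 0))
        = (\<Sum>\<beta>\<in>idx ?T. \<Sum>w\<in>UNIV. c (\<beta>(y := w)) *
            (of_bool (\<beta> = restrict \<alpha> ?T) * (\<Prod>x\<in>?T. \<epsilon> (\<alpha> x)) * poly (pderiv (R (\<alpha> y) w)) 0))"
      by (subst ins, subst sum_idx_insert) (simp, intro sum.cong refl, simp only: pr fun_upd_same)
    also have "\<dots> = (\<Sum>\<beta>\<in>idx ?T. if \<beta> = restrict \<alpha> ?T then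
        (\<Prod>x\<in>?T. \<epsilon> (\<alpha> x)) * (\<Sum>w\<in>UNIV. c (\<beta>(y := w)) * poly (pderiv (R (\<alpha> y) w)) 0) else 0)"
      by (intro sum.cong refl) (auto simp: sum_distrib_left mult_ac)
    also have "\<dots> = (\<Prod>x\<in>?T. \<epsilon> (\<alpha> x)) * (\<Sum>w\<in>UNIV. c (\<alpha>(y := w)) * poly (pderiv (R (\<alpha> y) w)) 0)"
      using \<alpha>T finite_idx[of ?T, where ?'n = 'n] S by (simp add: upd)
    finally show "(\<Sum>\<beta>\<in>idx S. c \<beta> * ((\<Prod>x\<in>?T. of_bool (\<alpha> x = \<beta> x) * \<epsilon> (\<alpha> x)) * poly (pderiv (R (\<alpha> y) (\<beta> y))) 0))
      = (\<Prod>x\<in>?T. \<epsilon> (\<alpha> x)) * (\<Sum>w\<in>UNIV. c (\<alpha>(y := w)) * poly (pderiv (R (\<alpha> y) w)) 0)" .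
  qed
  also have "\<dots> = (\<Sum>y\<in>S. 2 * (\<Prod>x\<in>S. \<epsilon> (\<alpha> x)) *
      ((if \<alpha> y = a then c (\<alpha>(y := b)) else 0) - (if \<alpha> y = b then c (\<alpha>(y := a)) else 0)))"
  proof (rule sum.cong[OF refl])
    fix y assume y: "y \<in> S"
    have "(\<Sum>w\<in>UNIV. c (\<alpha>(y := w)) * poly (pderiv (R (\<alpha> y) w)) 0)
        = (\<Sum>w\<in>UNIV. (if w = b then -2 * of_bool (\<alpha> y = a) * c (\<alpha>(y := w)) else 0)
          + (if w = a then -2 * of_bool (\<alpha> y = b) * c (\<alpha>(y := w)) else 0))"
      unfolding R1 using False by (intro sum.cong) auto
    also have "\<dots> = -2 * of_bool (\<alpha> y = a) * c (\<alpha>(y := b)) - 2 * of_bool (\<alpha> y = b) * c (\<alpha>(y := a))"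
      by (simp add: sum.distrib)
    finally have "(\<Sum>w\<in>UNIV. c (\<alpha>(y := w)) * poly (pderiv (R (\<alpha> y) w)) 0)
        = -2 * of_bool (\<alpha> y = a) * c (\<alpha>(y := b)) - 2 * of_bool (\<alpha> y = b) * c (\<alpha>(y := a))" .
    \<comment> \<open>Restoring the factor of slot \<open>y\<close> costs the sign
      \<open>\<epsilon> (\<alpha> y)\<close>, which is -1 for value \<open>a\<close> and 1 for value
      \<open>b\<close>. It turns the symmetric derivative into the antisymmetric difference of
      matrix units.\<close>
    moreover have "(\<Prod>x\<in>S. \<epsilon> (\<alpha> x)) = \<epsilon> (\<alpha> y) * (\<Prod>x\<in>S-{y}. \<epsilon> (\<alpha> x))"
      using S y by (rule prod.remove)
    ultimately show "(\<Prod>x\<in>S-{y}. \<epsilon> (\<alpha> x)) * (\<Sum>w\<in>UNIV. c (\<alpha>(y := w)) * poly (pderiv (R (\<alpha> y) w)) 0)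
      = 2 * (\<Prod>x\<in>S. \<epsilon> (\<alpha> x)) *
        ((if \<alpha> y = a then c (\<alpha>(y := b)) else 0) - (if \<alpha> y = b then c (\<alpha>(y := a)) else 0))"
      using False by (auto simp: \<epsilon>_def)
  qed
  also have "\<dots> = 2 * (\<Prod>x\<in>S. \<epsilon> (\<alpha> x)) * (unit_action S a b c \<alpha> - unit_action S b a c \<alpha>)"
    by (simp add: unit_action_def sum_distrib_left[symmetric] sum_subtractf)
  finally have "2 * (\<Prod>x\<in>S. \<epsilon> (\<alpha> x)) * (unit_action S a b c \<alpha> - unit_action S b a c \<alpha>) = 0"
    using \<open>P = 0\<close> by simp
  moreover have "(\<Prod>x\<in>S. \<epsilon> (\<alpha> x)) \<noteq> 0" using S by (auto simp: \<epsilon>_def prod_zero_iff)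
  ultimately show ?thesis by simp
qed simp


section \<open>The Laplacian of a finite set of reflections, its kernel, and a decomposition of the
  identity\<close>

definition laplacian :: "'s set \<Rightarrow> ('n::finite \<Rightarrow> rat) set \<Rightarrow> ('s \<Rightarrow> 'n) \<Rightarrow> ('s \<Rightarrow> 'n) \<Rightarrow> rat" where
  "laplacian S V \<alpha> \<beta> = (\<Sum>v\<in>V. of_bool (\<alpha> = \<beta>) - tensor_power S (reflection v) \<alpha> \<beta>)"

primrec laplacian_power ::
    "'s set \<Rightarrow> ('n::finite \<Rightarrow> rat) set \<Rightarrow> nat \<Rightarrow> ('s \<Rightarrow> 'n) \<Rightarrow> ('s \<Rightarrow> 'n) \<Rightarrow> rat" where
  "laplacian_power S V 0 \<alpha> \<beta> = of_bool (\<alpha> = \<beta>)"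
| "laplacian_power S V (Suc i) \<alpha> \<beta> = (\<Sum>\<gamma>\<in>idx S. laplacian S V \<alpha> \<gamma> * laplacian_power S V i \<gamma> \<beta>)"

lemma laplacian_sym: "laplacian S V \<alpha> \<beta> = laplacian S V \<beta> \<alpha>"
  unfolding laplacian_def by (subst tensor_power_reflection_sym) (simp add: eq_commute)

lemma laplacian_apply:
  fixes c :: "('s \<Rightarrow> 'n::finite) \<Rightarrow> rat"
  assumes "finite S" "\<alpha> \<in> idx S"
  shows "(\<Sum>\<gamma>\<in>idx S. laplacian S V \<alpha> \<gamma> * c \<gamma>)
    = (\<Sum>v\<in>V. c \<alpha> - (\<Sum>\<gamma>\<in>idx S. tensor_power S (reflection v) \<alpha> \<gamma> * c \<gamma>))"
proof -
  have "(\<Sum>\<gamma>\<in>idx S. of_bool (\<alpha> = \<gamma>) * c \<gamma>) = c \<alpha>"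
    using assms finite_idx[OF assms(1), where ?'n = 'n]
    by (simp add: of_bool_def if_distrib[of "\<lambda>x. x * _"] cong: if_cong)
  then show ?thesis
    unfolding laplacian_def sum_distrib_right
    by (subst sum.swap) (simp add: left_diff_distrib sum_subtractf)
qed

lemma laplacian_matching:
  assumes "matching S \<theta>" "\<alpha> \<in> idx S"
  shows "(\<Sum>\<gamma>\<in>idx S. laplacian S V \<alpha> \<gamma> * \<theta> \<gamma>) = 0"
  using laplacian_apply[OF matching_finite[OF assms(1)] assms(2)] matching_fixed[OF assms(1)] by simp

text \<open>Each reflection acts as a symmetric involution and preserves the squared norm. Hence the
  sum over \<open>v\<close> of the squared norms of \<open>c - s v\<close> is twice the inner
  product of \<open>c\<close> with its Laplacian, which is zero, and every single summand
  vanishes.\<close>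

lemma laplacian_kernel:
  fixes c :: "('s \<Rightarrow> 'n::finite) \<Rightarrow> rat"
  assumes S: "finite S" and V: "finite V"
    and ker: "\<And>\<alpha>. \<alpha> \<in> idx S \<Longrightarrow> (\<Sum>\<gamma>\<in>idx S. laplacian S V \<alpha> \<gamma> * c \<gamma>) = 0"
    and v: "v \<in> V" and \<alpha>: "\<alpha> \<in> idx S"
  shows "(\<Sum>\<beta>\<in>idx S. tensor_power S (reflection v) \<alpha> \<beta> * c \<beta>) = c \<alpha>"
proof -
  define s where "s v \<alpha> = (\<Sum>\<beta>\<in>idx S. tensor_power S (reflection v) \<alpha> \<beta> * c \<beta>)" for v \<alpha>
  note fin = finite_idx[OF S, where ?'n = 'n]
  have norm: "(\<Sum>\<alpha>\<in>idx S. s v \<alpha> * s v \<alpha>) = (\<Sum>\<alpha>\<in>idx S. c \<alpha> * c \<alpha>)" for v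
  proof -
    have "(\<Sum>\<alpha>\<in>idx S. s v \<alpha> * s v \<alpha>)
        = (\<Sum>\<alpha>\<in>idx S. \<Sum>\<beta>\<in>idx S. s v \<alpha> * (tensor_power S (reflection v) \<alpha> \<beta> * c \<beta>))"
      unfolding s_def[of v] sum_distrib_left ..
    also have "\<dots> = (\<Sum>\<beta>\<in>idx S. c \<beta> * (\<Sum>\<alpha>\<in>idx S. tensor_power S (reflection v) \<beta> \<alpha> * s v \<alpha>))"
      by (subst sum.swap) (simp add: sum_distrib_left tensor_power_reflection_sym[of S v] mult_ac)
    also have "\<dots> = (\<Sum>\<beta>\<in>idx S. c \<beta> * c \<beta>)"
    proof (intro sum.cong refl arg_cong2[of _ _ _ _ "(*)"])
      fix \<beta> :: "'s \<Rightarrow> 'n" assume \<beta>: "\<beta> \<in> idx S"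
      have "(\<Sum>\<alpha>\<in>idx S. tensor_power S (reflection v) \<beta> \<alpha> * s v \<alpha>)
          = (\<Sum>\<gamma>\<in>idx S. (\<Sum>\<alpha>\<in>idx S. tensor_power S (reflection v) \<beta> \<alpha> * tensor_power S (reflection v) \<alpha> \<gamma>) * c \<gamma>)"
        unfolding s_def sum_distrib_left sum_distrib_right by (subst sum.swap) (simp add: mult.assoc)
      also have "\<dots> = (\<Sum>\<gamma>\<in>idx S. of_bool (\<beta> = \<gamma>) * c \<gamma>)"
        by (intro sum.cong refl) (simp add: tensor_power_reflection_involution[OF S \<beta>])
      finally show "(\<Sum>\<alpha>\<in>idx S. tensor_power S (reflection v) \<beta> \<alpha> * s v \<alpha>) = c \<beta>"
        using \<beta> fin by (simp add: of_bool_def if_distrib[of "\<lambda>x. x * _"] cong: if_cong)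
    qed
    finally show ?thesis .
  qed
  have "(\<Sum>v\<in>V. \<Sum>\<alpha>\<in>idx S. (c \<alpha> - s v \<alpha>)\<^sup>2)
      = (\<Sum>v\<in>V. \<Sum>\<alpha>\<in>idx S. c \<alpha> * c \<alpha> - 2 * (c \<alpha> * s v \<alpha>) + s v \<alpha> * s v \<alpha>)"
    by (simp add: power2_eq_square algebra_simps)
  also have "\<dots> = 2 * (\<Sum>\<alpha>\<in>idx S. c \<alpha> * (\<Sum>v\<in>V. c \<alpha> - s v \<alpha>))"
  proof -
    have "(\<Sum>v\<in>V. \<Sum>\<alpha>\<in>idx S. c \<alpha> * c \<alpha> - 2 * (c \<alpha> * s v \<alpha>) + s v \<alpha> * s v \<alpha>)
        = (\<Sum>v\<in>V. 2 * (\<Sum>\<alpha>\<in>idx S. c \<alpha> * (c \<alpha> - s v \<alpha>)))"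
      by (intro sum.cong refl) (simp add: sum.distrib sum_subtractf norm right_diff_distrib sum_distrib_left[symmetric])
    also have "\<dots> = 2 * (\<Sum>\<alpha>\<in>idx S. \<Sum>v\<in>V. c \<alpha> * (c \<alpha> - s v \<alpha>))"
      unfolding sum_distrib_left[of 2, symmetric] by (subst sum.swap) (rule refl)
    also have "(\<Sum>\<alpha>\<in>idx S. \<Sum>v\<in>V. c \<alpha> * (c \<alpha> - s v \<alpha>)) = (\<Sum>\<alpha>\<in>idx S. c \<alpha> * (\<Sum>v\<in>V. c \<alpha> - s v \<alpha>))"
      by (intro sum.cong refl sum_distrib_left[symmetric])
    finally show ?thesis .
  qed
  also have "\<dots> = 0"
    using ker laplacian_apply[OF S, of _ V c] by (simp add: s_def)
  finally have "(\<Sum>\<alpha>\<in>idx S. (c \<alpha> - s v \<alpha>)\<^sup>2) = 0"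
    using v V by (subst (asm) sum_nonneg_eq_0_iff) (auto intro: sum_nonneg)
  then have "(c \<alpha> - s v \<alpha>)\<^sup>2 = 0"
    using \<alpha> fin by (subst (asm) sum_nonneg_eq_0_iff) auto
  then show ?thesis by (simp add: s_def)
qed

lemma invariant_kernel_eq_0:
  fixes c :: "('s \<Rightarrow> 'n::finite) \<Rightarrow> rat"
  assumes S: "finite S" and L: "2 * card S \<le> L"
    and ker: "\<And>\<alpha>. \<alpha> \<in> idx S \<Longrightarrow> (\<Sum>\<gamma>\<in>idx S. laplacian S (test_vectors L) \<alpha> \<gamma> * c \<gamma>) = 0"
    and orth: "\<And>\<theta>. matching S \<theta> \<Longrightarrow> (\<Sum>\<alpha>\<in>idx S. \<theta> \<alpha> * c \<alpha>) = 0"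
    and \<alpha>: "\<alpha> \<in> idx S"
  shows "c \<alpha> = 0"
proof (rule invariant_orthogonal_matchings_eq_0[OF S _ _ orth \<alpha>])
  note fixed = laplacian_kernel[OF S finite_test_vectors ker]
  show "c \<alpha> = 0" if "\<alpha> \<in> idx S" "odd (card {x\<in>S. \<alpha> x = a})" for \<alpha> a
    \<comment> \<open>With \<open>t = 0\<close> this test vector is the coordinate vector of
      \<open>a\<close>.\<close>
    using test_vectors_memI[of 0 L a a]
    by (intro flip_invariant_even[OF S fixed that]) auto
  show "unit_action S a b c \<alpha> = unit_action S b a c \<alpha>" if "\<alpha> \<in> idx S" for \<alpha> a b
    by (rule reflection_invariant_infinitesimal[OF S L fixed that])
qed

text \<open>
  Project the identity matrix orthogonally to the span of the positive powers of the laplacian and the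
  matrices whose columns are matchings. The remainder is annihilated by the laplacian and orthogonal to
  the matchings, so it vanishes.
\<close>

theorem laplacian_decomposition:
  fixes S :: "'s set"
  assumes S: "finite S" and L: "2 * card S \<le> L"
  shows "\<exists>T r. finite T \<and> (0::nat) \<notin> T \<and>
    (\<forall>\<beta>\<in>idx S. \<exists>w\<in>rat_fun.span {\<theta>. matching S \<theta>}. \<forall>\<alpha>\<in>idx S.
      of_bool (\<alpha> = (\<beta> :: 's \<Rightarrow> 'n::finite))
      = (\<Sum>i\<in>T. r i * laplacian_power S (test_vectors L) i \<alpha> \<beta>) + w \<alpha>)"
proof -
  \<comment> \<open>Matrices are treated as vectors indexed by pairs; the cut-offs to
    \<open>A\<close> give the finite support that the projection requires.\<close>
  define A :: "(('s \<Rightarrow> 'n) \<times> ('s \<Rightarrow> 'n)) set" where "A = idx S \<times> idx S"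
  define lap :: "('s \<Rightarrow> 'n) \<Rightarrow> ('s \<Rightarrow> 'n) \<Rightarrow> rat" where "lap = laplacian S (test_vectors L)"
  define hp :: "nat \<Rightarrow> (('s \<Rightarrow> 'n) \<times> ('s \<Rightarrow> 'n)) \<Rightarrow> rat"
    where "hp i = (\<lambda>(\<alpha>, \<beta>). of_bool ((\<alpha>, \<beta>) \<in> A) * laplacian_power S (test_vectors L) i \<alpha> \<beta>)" for i
  define th where "th \<theta> \<gamma> = (\<lambda>(\<alpha>, \<beta>). of_bool ((\<alpha>, \<beta>) \<in> A \<and> \<beta> = \<gamma>) * \<theta> \<alpha>)"
    for \<theta> :: "('s \<Rightarrow> 'n) \<Rightarrow> rat" and \<gamma>
  define W where "W = hp ` {1..} \<union> {th \<theta> \<gamma> | \<theta> \<gamma>. matching S \<theta>}"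
  \<comment> \<open>Left multiplication by the Laplacian. It shifts the powers \<open>hp\<close> by
    one, kills the matching matrices and is self-adjoint.\<close>
  define K where "K u = (\<lambda>(\<alpha>, \<beta>). of_bool ((\<alpha>, \<beta>) \<in> A) * (\<Sum>\<gamma>\<in>idx S. lap \<alpha> \<gamma> * u (\<gamma>, \<beta>)))"
    for u :: "('s \<Rightarrow> 'n) \<times> ('s \<Rightarrow> 'n) \<Rightarrow> rat"
  note fin = finite_idx[OF S, where ?'n = 'n]
  have finA: "finite A" by (simp add: A_def fin)
  have supp: "u x = 0" if "u \<in> W" "x \<notin> A" for u x
    using that by (cases x) (auto simp: W_def hp_def th_def)
  have "\<exists>w\<in>rat_fun.span W. \<forall>u\<in>rat_fun.span W. (\<Sum>x\<in>A. (hp 0 x - w x) * u x) = 0"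
    by (rule orthogonal_projection[OF finA]) (rule supp)
  then obtain w where w: "w \<in> rat_fun.span W"
    and orth: "\<And>u. u \<in> rat_fun.span W \<Longrightarrow> (\<Sum>x\<in>A. (hp 0 x - w x) * u x) = 0"
    by blast
  \<comment> \<open>\<open>hp 0\<close> is the identity matrix, \<open>w\<close> its projection and
    \<open>t\<close> the remainder to be shown zero.\<close>
  define t where "t = hp 0 - w"
  have orth_t: "(\<Sum>x\<in>A. t x * u x) = 0" if "u \<in> rat_fun.span W" for u
    using orth[OF that] by (simp add: t_def)
  have K_hp: "K (hp i) = hp (Suc i)" for i
    by (auto simp: K_def hp_def fun_eq_iff A_def lap_def)
  have K_th: "K (th \<theta> \<gamma>) = 0" if "matching S \<theta>" for \<theta> \<gamma>
    using laplacian_matching[OF that] by (auto simp: K_def th_def fun_eq_iff A_def lap_def)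
  have K_lin: "K ((\<lambda>i. c * u i) + u') = (\<lambda>i. c * K u i) + K u'" for c u u'
    by (auto simp: K_def fun_eq_iff algebra_simps sum.distrib sum_distrib_left)
  have K_span: "K u \<in> rat_fun.span W" if "u \<in> rat_fun.span W" for u
    using that
  proof (induction rule: rat_fun.span_induct_alt)
    case base
    have "K 0 = 0" by (auto simp: K_def fun_eq_iff)
    then show ?case by (simp only: rat_fun.span_zero)
  next
    case (step c x y)
    have "K x \<in> rat_fun.span W"
    proof (cases "x \<in> hp ` {1..}")
      case True
      then obtain i where "x = hp i" by auto
      then have "K x \<in> W" by (simp add: K_hp W_def)
      then show ?thesis by (rule rat_fun.span_base)
    next
      case False
      then have "K x = 0" using step(1) K_th by (auto simp: W_def)
      then show ?thesis by (simp only: rat_fun.span_zero)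
    qed
    then show ?case unfolding K_lin by (intro rat_fun.span_add rat_fun.span_scale step)
  qed
  \<comment> \<open>The power zero is not among the generators of \<open>W\<close>, but applying
    \<open>K\<close> turns it into \<open>hp 1\<close>, which is.\<close>
  have "K t \<in> rat_fun.span W"
  proof -
    have "t = (\<lambda>i. (-1) * w i) + hp 0" by (auto simp: t_def fun_eq_iff)
    then have "K t = (\<lambda>i. (-1) * K w i) + hp 1" by (simp only: K_lin K_hp One_nat_def)
    moreover have "hp 1 \<in> rat_fun.span W" by (intro rat_fun.span_base) (auto simp: W_def)
    ultimately show ?thesis by (simp only:) (intro rat_fun.span_add rat_fun.span_scale K_span w)
  qed
  have K_sym: "(\<Sum>x\<in>A. u x * K u' x) = (\<Sum>x\<in>A. K u x * u' x)" for u u'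
  proof -
    have "(\<Sum>x\<in>A. u x * K u' x)
        = (\<Sum>\<alpha>\<in>idx S. \<Sum>\<beta>\<in>idx S. \<Sum>\<gamma>\<in>idx S. u (\<alpha>, \<beta>) * (lap \<alpha> \<gamma> * u' (\<gamma>, \<beta>)))"
      unfolding A_def sum.cartesian_product'
      by (intro sum.cong refl) (simp add: K_def A_def sum_distrib_left)
    also have "\<dots> = (\<Sum>\<gamma>\<in>idx S. \<Sum>\<beta>\<in>idx S. \<Sum>\<alpha>\<in>idx S. u (\<alpha>, \<beta>) * (lap \<alpha> \<gamma> * u' (\<gamma>, \<beta>)))"
      by (subst sum.swap, subst (2) sum.swap, rule sum.swap)
    also have "\<dots> = (\<Sum>x\<in>A. K u x * u' x)"
      unfolding A_def sum.cartesian_product'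
      by (intro sum.cong refl) (simp add: K_def A_def sum_distrib_right sum_distrib_left lap_def laplacian_sym[of S _ _ "_ :: 's \<Rightarrow> 'n"] mult_ac)
    finally show ?thesis .
  qed
  \<comment> \<open>By self-adjointness this is the pairing of \<open>t\<close> with
    \<open>K (K t)\<close>, a member of the span to which \<open>t\<close> is orthogonal.\<close>
  have "(\<Sum>x\<in>A. K t x * K t x) = 0"
    using orth_t[OF K_span[OF \<open>K t \<in> rat_fun.span W\<close>]] by (simp only: K_sym)
  then have Kt: "K t x = 0" if "x \<in> A" for x
    using that finA by (subst (asm) sum_nonneg_eq_0_iff) auto
  \<comment> \<open>Each column of \<open>t\<close> lies in the kernel of the Laplacian and is
    orthogonal to the matchings.\<close>
  have t0: "t (\<alpha>, \<beta>) = 0" if "\<alpha> \<in> idx S" "\<beta> \<in> idx S" for \<alpha> \<beta>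
  proof (rule invariant_kernel_eq_0[OF S L _ _ that(1)])
    fix \<gamma> :: "'s \<Rightarrow> 'n" assume "\<gamma> \<in> idx S"
    then show "(\<Sum>\<delta>\<in>idx S. laplacian S (test_vectors L) \<gamma> \<delta> * t (\<delta>, \<beta>)) = 0"
      using Kt[of "(\<gamma>, \<beta>)"] that(2) by (simp add: A_def K_def lap_def)
  next
    fix \<theta> :: "('s \<Rightarrow> 'n) \<Rightarrow> rat" assume \<theta>: "matching S \<theta>"
    have "th \<theta> \<beta> \<in> rat_fun.span W" using \<theta> by (intro rat_fun.span_base) (auto simp: W_def)
    then have "(\<Sum>\<alpha>\<in>idx S. \<Sum>\<beta>'\<in>idx S. t (\<alpha>, \<beta>') * th \<theta> \<beta> (\<alpha>, \<beta>')) = 0"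
      using orth_t[of "th \<theta> \<beta>"] by (simp add: A_def sum.cartesian_product')
    moreover have "(\<Sum>\<beta>'\<in>idx S. t (\<alpha>, \<beta>') * th \<theta> \<beta> (\<alpha>, \<beta>')) = \<theta> \<alpha> * t (\<alpha>, \<beta>)"
      if "\<alpha> \<in> idx S" for \<alpha>
    proof -
      have "(\<Sum>\<beta>'\<in>idx S. t (\<alpha>, \<beta>') * th \<theta> \<beta> (\<alpha>, \<beta>')) = (\<Sum>\<beta>'\<in>idx S. if \<beta>' = \<beta> then \<theta> \<alpha> * t (\<alpha>, \<beta>) else 0)"
        using that by (intro sum.cong) (auto simp: th_def A_def)
      then show ?thesis using \<open>\<beta> \<in> idx S\<close> fin by simp
    qed
    ultimately show "(\<Sum>\<alpha>\<in>idx S. \<theta> \<alpha> * t (\<alpha>, \<beta>)) = 0" by simp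
  qed
  \<comment> \<open>It remains to sort an element of the span into powers, whose coefficients serve
    all columns, and matchings, whose combination may depend on the column
    \<open>\<beta>\<close>.\<close>
  let ?P = "\<lambda>u. \<exists>T r. finite T \<and> (0::nat) \<notin> T \<and> (\<forall>\<beta>\<in>idx S. \<exists>w\<in>rat_fun.span {\<theta>. matching S \<theta>}. \<forall>\<alpha>\<in>idx S.
      u (\<alpha>, \<beta>) = (\<Sum>i\<in>T. r i * laplacian_power S (test_vectors L) i \<alpha> \<beta>) + w \<alpha>)"
  have "?P w"
    using w
  proof (induction rule: rat_fun.span_induct_alt)
    case base
    show ?case by (rule exI[of _ "{}"]) (auto intro!: bexI[of _ 0] rat_fun.span_zero)
  next
    case (step c x y)
    obtain T r where T: "finite T" "0 \<notin> T"
      and y: "\<And>\<beta>. \<beta> \<in> idx S \<Longrightarrow> \<exists>w\<in>rat_fun.span {\<theta>. matching S \<theta>}. \<forall>\<alpha>\<in>idx S.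
        y (\<alpha>, \<beta>) = (\<Sum>i\<in>T. r i * laplacian_power S (test_vectors L) i \<alpha> \<beta>) + w \<alpha>"
      using step.IH by blast
    show ?case
    proof (cases "x \<in> hp ` {1..}")
      case True
      then obtain j where j: "x = hp j" "j \<noteq> 0" by auto
      \<comment> \<open>The exponent \<open>j\<close> may already occur in \<open>T\<close>, so its
        coefficients are added.\<close>
      define r' where "r' i = (if i \<in> T then r i else 0) + (if i = j then c else 0)" for i
      have sum_r': "(\<Sum>i\<in>insert j T. r' i * f i) = c * f j + (\<Sum>i\<in>T. r i * f i)" for f :: "nat \<Rightarrow> rat"
      proof -
        have "(\<Sum>i\<in>insert j T. r' i * f i)
            = (\<Sum>i\<in>insert j T. (if i \<in> T then r i * f i else 0) + (if i = j then c * f i else 0))"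
          by (intro sum.cong) (auto simp: r'_def algebra_simps)
        also have "\<dots> = (\<Sum>i\<in>insert j T. if i \<in> T then r i * f i else 0) + c * f j"
          using T by (simp add: sum.distrib)
        also have "(\<Sum>i\<in>insert j T. if i \<in> T then r i * f i else 0) = (\<Sum>i\<in>T. r i * f i)"
          using T by (intro sum.mono_neutral_cong_right) auto
        finally show ?thesis by simp
      qed
      show ?thesis
      proof (intro exI[of _ "insert j T"] exI[of _ r'] conjI ballI)
        fix \<beta> :: "'s \<Rightarrow> 'n" assume \<beta>: "\<beta> \<in> idx S"
        from y[OF this] obtain w where w: "w \<in> rat_fun.span {\<theta>. matching S \<theta>}"
          and yw: "\<And>\<alpha>. \<alpha> \<in> idx S \<Longrightarrow>
            y (\<alpha>, \<beta>) = (\<Sum>i\<in>T. r i * laplacian_power S (test_vectors L) i \<alpha> \<beta>) + w \<alpha>" by blast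
        show "\<exists>w\<in>rat_fun.span {\<theta>. matching S \<theta>}. \<forall>\<alpha>\<in>idx S. ((\<lambda>i. c * x i) + y) (\<alpha>, \<beta>)
            = (\<Sum>i\<in>insert j T. r' i * laplacian_power S (test_vectors L) i \<alpha> \<beta>) + w \<alpha>"
          unfolding sum_r' by (rule bexI[OF _ w]) (use yw \<beta> in \<open>simp add: j hp_def A_def\<close>)
      qed (use T j(2) in auto)
    next
      case False
      then obtain \<theta> \<gamma> where \<theta>: "x = th \<theta> \<gamma>" "matching S \<theta>" using step(1) by (auto simp: W_def)
      show ?thesis
      proof (intro exI[of _ T] exI[of _ r] conjI ballI T)
        fix \<beta> :: "'s \<Rightarrow> 'n" assume \<beta>: "\<beta> \<in> idx S"
        from y[OF this] obtain w where w: "w \<in> rat_fun.span {\<theta>. matching S \<theta>}"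
          and yw: "\<And>\<alpha>. \<alpha> \<in> idx S \<Longrightarrow>
            y (\<alpha>, \<beta>) = (\<Sum>i\<in>T. r i * laplacian_power S (test_vectors L) i \<alpha> \<beta>) + w \<alpha>" by blast
        have "(\<lambda>\<alpha>. (c * of_bool (\<beta> = \<gamma>)) * \<theta> \<alpha>) + w \<in> rat_fun.span {\<theta>. matching S \<theta>}"
          by (intro rat_fun.span_add rat_fun.span_scale w) (rule rat_fun.span_base, simp add: \<theta>(2))
        then show "\<exists>w\<in>rat_fun.span {\<theta>. matching S \<theta>}. \<forall>\<alpha>\<in>idx S. ((\<lambda>i. c * x i) + y) (\<alpha>, \<beta>)
            = (\<Sum>i\<in>T. r i * laplacian_power S (test_vectors L) i \<alpha> \<beta>) + w \<alpha>"
          by (rule bexI[rotated]) (use yw \<beta> in \<open>auto simp: \<theta>(1) th_def A_def\<close>)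
      qed
    qed
  qed
  moreover have "of_bool (\<alpha> = \<beta>) = w (\<alpha>, \<beta>)" if "\<alpha> \<in> idx S" "\<beta> \<in> idx S" for \<alpha> \<beta>
    using t0[OF that] that by (simp add: t_def hp_def A_def)
  ultimately show ?thesis by simp
qed


section \<open>Contractions as products of traces\<close>

text \<open>Rational numbers enter through the base field, so that multiplication by them is a
  scalar multiplication of the algebra over \<open>'k\<close>.\<close>

definition rat_ac :: "rat \<Rightarrow> 'k::field_char_0 alg_closure" where
  "rat_ac r = to_ac (of_rat r)"

lemma rat_ac_simps [simp]:
  "rat_ac 0 = 0" "rat_ac 1 = 1" "rat_ac (x + y) = rat_ac x + rat_ac y"
  "rat_ac (x - y) = rat_ac x - rat_ac y" "rat_ac (x * y) = rat_ac x * rat_ac y"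
  "rat_ac (of_bool P) = of_bool P"
  by (simp_all add: rat_ac_def of_rat_add of_rat_diff of_rat_mult of_bool_def)

lemma rat_ac_sum: "rat_ac (\<Sum>x\<in>A. f x) = (\<Sum>x\<in>A. rat_ac (f x))"
  by (induction A rule: infinite_finite_induct) auto

lemma rat_ac_prod: "rat_ac (\<Prod>x\<in>A. f x) = (\<Prod>x\<in>A. rat_ac (f x))"
  by (induction A rule: infinite_finite_induct) auto

text \<open>
  The edge \<open>j\<close> carries the matrix \<open>N j\<close>, with row slot \<open>e (j, False)\<close> and column slot \<open>e (j, True)\<close>.
  Contracting a pair of slots either closes an edge to a trace or merges two edges.
\<close>

lemma matching_contraction:
  fixes \<M> :: "('g \<Rightarrow> 'k::field_char_0 alg_closure ^ 'n ^ 'n) set" and \<A> :: "('g \<Rightarrow> 'k alg_closure) set"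
    and e :: "'j \<times> bool \<Rightarrow> 's"
  assumes "matching S \<theta>"
    and one: "(\<lambda>_. 1) \<in> \<A>"
    and mult: "\<And>f h. f \<in> \<A> \<Longrightarrow> h \<in> \<A> \<Longrightarrow> (\<lambda>g. f g * h g) \<in> \<A>"
    and tr: "\<And>N. N \<in> \<M> \<Longrightarrow> (\<lambda>g. trace (N g)) \<in> \<A>"
    and m_mult: "\<And>N N'. N \<in> \<M> \<Longrightarrow> N' \<in> \<M> \<Longrightarrow> (\<lambda>g. N g ** N' g) \<in> \<M>"
    and m_transpose: "\<And>N. N \<in> \<M> \<Longrightarrow> (\<lambda>g. Finite_Cartesian_Product.transpose (N g)) \<in> \<M>"
    and "finite J" "bij_betw e (J \<times> UNIV) S" "\<And>j. j \<in> J \<Longrightarrow> N j \<in> \<M>"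
  shows "(\<lambda>g. \<Sum>\<beta>\<in>idx S. rat_ac (\<theta> \<beta>) * (\<Prod>j\<in>J. N j g $ \<beta> (e (j, False)) $ \<beta> (e (j, True)))) \<in> \<A>"
  using assms(1,7-9)
proof (induction arbitrary: J e N rule: matching.induct)
  case empty
  then have "J = {}" by (auto simp: bij_betw_def)
  then show ?case using one by simp
next
  case (pair S \<theta> y z)
  note J = pair.prems(1) and bij = pair.prems(2) and N = pair.prems(3)
  define ent where "ent \<beta> g i = N i g $ \<beta> (e (i, False)) $ \<beta> (e (i, True))" for \<beta> g i
  have surj: "y \<in> e ` (J \<times> UNIV)" "z \<in> e ` (J \<times> UNIV)"
    unfolding bij_betw_imp_surj_on[OF bij] by simp_all
  obtain j s where js: "j \<in> J" "e (j, s) = y" using surj(1) by blast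
  obtain j' s' where js': "j' \<in> J" "e (j', s') = z" using surj(2) by blast
  \<comment> \<open>The ends of edges that remain free once \<open>y\<close> and \<open>z\<close>
    are joined.\<close>
  define R where "R = J \<times> UNIV - {(j, s), (j', s')}"
  have bijR: "bij_betw e R S"
  proof -
    have "bij_betw e {(j, s), (j', s')} {y, z}"
      using js js' pair.hyps(4) by (auto simp: bij_betw_def inj_on_def)
    then have "bij_betw e R (insert y (insert z S) - {y, z})"
      unfolding R_def by (rule bij_betw_DiffI[OF bij]) (use js js' in auto)
    moreover have "insert y (insert z S) - {y, z} = S" using pair.hyps by auto
    ultimately show ?thesis by simp
  qed
  have eS: "e x \<in> S" if "x \<in> R" for x using bijR that by (auto simp: bij_betw_def)
  have outside: "(\<beta>(y := w, z := w')) (e x) = \<beta> (e x)" if "x \<in> R" for \<beta> :: "'s \<Rightarrow> 'n" and w w' x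
    using eS[OF that] pair.hyps by auto
  have ent_outside: "ent (\<beta>(y := w, z := w')) g i = ent \<beta> g i" if "i \<in> J" "i \<noteq> j" "i \<noteq> j'" for \<beta> w w' g i
    unfolding ent_def using that by (simp add: outside R_def del: fun_upd_apply)
  have sum_eq: "(\<Sum>\<beta>\<in>idx (insert y (insert z S)). rat_ac (if \<beta> y = \<beta> z then \<theta> \<beta> else 0) * (\<Prod>i\<in>J. ent \<beta> g i))
      = (\<Sum>\<beta>\<in>idx S. rat_ac (\<theta> \<beta>) * (\<Sum>w\<in>UNIV. \<Prod>i\<in>J. ent (\<beta>(y := w, z := w)) g i))" for g
  proof -
    have "(\<Sum>\<beta>\<in>idx (insert y (insert z S)). rat_ac (if \<beta> y = \<beta> z then \<theta> \<beta> else 0) * (\<Prod>i\<in>J. ent \<beta> g i))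
        = (\<Sum>\<beta>\<in>idx S. \<Sum>w\<in>UNIV. \<Sum>w'\<in>UNIV. if w = w' then rat_ac (\<theta> \<beta>) * (\<Prod>i\<in>J. ent (\<beta>(y := w, z := w')) g i) else 0)"
      unfolding sum_idx_insert2[OF pair.hyps(2-4)]
      using pair.hyps(2-4) by (intro sum.cong refl) (auto simp: matching_upd[OF pair.hyps(1)])
    then show ?thesis by (simp add: sum_distrib_left)
  qed
  show ?case
  proof (cases "j = j'")
    case True
    \<comment> \<open>Both slots are the two ends of one edge, which closes up to a trace.\<close>
    have ss: "s' = (\<not> s)" using js js' True pair.hyps(4) by (cases s; cases s') auto
    have R: "R = (J - {j}) \<times> UNIV" unfolding R_def True[symmetric] ss by (cases s) auto
    have "(\<Sum>w\<in>UNIV. \<Prod>i\<in>J. ent (\<beta>(y := w, z := w)) g i) = trace (N j g) * (\<Prod>i\<in>J-{j}. ent \<beta> g i)" for \<beta> g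
    proof -
      have "ent (\<beta>(y := w, z := w)) g j = N j g $ w $ w" for w
        unfolding ent_def using js js' ss True pair.hyps(4) by (cases s) auto
      moreover have "(\<Prod>i\<in>J-{j}. ent (\<beta>(y := w, z := w)) g i) = (\<Prod>i\<in>J-{j}. ent \<beta> g i)" for w
        using True by (intro prod.cong refl ent_outside) auto
      ultimately show ?thesis
        by (simp add: prod.remove[OF J js(1)] trace_def sum_distrib_right)
    qed
    then have "(\<lambda>g. \<Sum>\<beta>\<in>idx (insert y (insert z S)). rat_ac (if \<beta> y = \<beta> z then \<theta> \<beta> else 0) * (\<Prod>i\<in>J. ent \<beta> g i))
        = (\<lambda>g. trace (N j g) * (\<Sum>\<beta>\<in>idx S. rat_ac (\<theta> \<beta>) * (\<Prod>i\<in>J-{j}. ent \<beta> g i)))"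
      unfolding sum_eq by (simp add: sum_distrib_left mult_ac)
    moreover have "(\<lambda>g. \<Sum>\<beta>\<in>idx S. rat_ac (\<theta> \<beta>) * (\<Prod>i\<in>J-{j}. ent \<beta> g i)) \<in> \<A>"
      unfolding ent_def by (rule pair.IH) (use J bijR N R in auto)
    ultimately show ?thesis using mult[OF tr[OF N[OF js(1)]]] unfolding ent_def by simp
  next
    case False
    let ?T = "Finite_Cartesian_Product.transpose"
    \<comment> \<open>Transposes orient the two edges so that the contracted index is the column of
      \<open>P\<close> and the row of \<open>Q\<close>; summing over it gives the matrix
      product.\<close>
    define P where "P g = (if s then N j g else ?T (N j g))" for g
    define Q where "Q g = (if s' then ?T (N j' g) else N j' g)" for g
    define N' where "N' = N(j := (\<lambda>g. P g ** Q g))"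
    \<comment> \<open>The merged edge keeps the name \<open>j\<close>: its row end is the free end
      of the old \<open>j\<close>, its column end the free end of \<open>j'\<close>.\<close>
    define h where "h = (\<lambda>(i, b). if i = j then (if b then (j', \<not> s') else (j, \<not> s)) else (i, b))"
    have PQ: "P \<in> \<M>" "Q \<in> \<M>"
      unfolding P_def Q_def using N[OF js(1)] N[OF js'(1)] m_transpose by (cases s; cases s'; auto)+
    have "bij_betw h ((J - {j'}) \<times> UNIV) R"
    proof (rule bij_betw_imageI)
      show "inj_on h ((J - {j'}) \<times> UNIV)" by (auto simp: inj_on_def h_def split: if_splits)
      show "h ` ((J - {j'}) \<times> UNIV) = R"
      proof
        show "h ` ((J - {j'}) \<times> UNIV) \<subseteq> R"
          using js(1) js'(1) False by (auto simp: h_def R_def split: if_splits)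
        show "R \<subseteq> h ` ((J - {j'}) \<times> UNIV)"
        proof
          fix x assume x: "x \<in> R"
          consider "fst x = j'" | "fst x = j" | "fst x \<noteq> j" "fst x \<noteq> j'" by blast
          then show "x \<in> h ` ((J - {j'}) \<times> UNIV)"
          proof cases
            case 1
            then have "x = h (j, True)" using x by (auto simp: R_def h_def)
            then show ?thesis using js(1) False by auto
          next
            case 2
            then have "x = h (j, False)" using x by (auto simp: R_def h_def)
            then show ?thesis using js(1) False by auto
          next
            case 3
            then have "x = h x" by (auto simp: h_def split: prod.splits)
            then show ?thesis using x 3 by (intro image_eqI[of _ _ x]) (auto simp: R_def)
          qed
        qed
      qed
    qed
    then have bij': "bij_betw (e \<circ> h) ((J - {j'}) \<times> UNIV) S" using bijR by (rule bij_betw_trans)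
    have N': "N' i \<in> \<M>" if "i \<in> J - {j'}" for i
      using that N m_mult[OF PQ] by (simp add: N'_def)
    define J0 where "J0 = J - {j, j'}"
    have J0: "J = insert j (insert j' J0)" "J - {j'} = insert j J0" "j \<notin> J0" "j' \<notin> J0" "finite J0"
      using js(1) js'(1) False J by (auto simp: J0_def)
    have "(\<Sum>w\<in>UNIV. \<Prod>i\<in>J. ent (\<beta>(y := w, z := w)) g i)
        = (\<Prod>i\<in>J-{j'}. N' i g $ \<beta> ((e \<circ> h) (i, False)) $ \<beta> ((e \<circ> h) (i, True)))" for \<beta> g
    proof -
      have E0: "(\<Prod>i\<in>J0. ent (\<beta>(y := w, z := w)) g i) = (\<Prod>i\<in>J0. ent \<beta> g i)" for w
        by (intro prod.cong refl ent_outside) (auto simp: J0_def)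
      have "(j, \<not> s) \<in> R" "(j', \<not> s') \<in> R" using js(1) js'(1) False by (auto simp: R_def)
      note out = outside[OF this(1)] outside[OF this(2)]
      have y: "(\<beta>(y := w, z := w)) (e (j, s)) = w" "(\<beta>(y := w, z := w)) (e (j', s')) = w" for w
        using js js' by auto
      have Ej: "ent (\<beta>(y := w, z := w)) g j = P g $ \<beta> (e (j, \<not> s)) $ w" for w
        using out(1)[of \<beta> w w] y(1)[of w] unfolding ent_def P_def
        by (cases s) (simp_all del: fun_upd_apply add: Finite_Cartesian_Product.transpose_def)
      have Ej': "ent (\<beta>(y := w, z := w)) g j' = Q g $ w $ \<beta> (e (j', \<not> s'))" for w
        using out(2)[of \<beta> w w] y(2)[of w] unfolding ent_def Q_def
        by (cases s') (simp_all del: fun_upd_apply add: Finite_Cartesian_Product.transpose_def)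
      have "(\<Sum>w\<in>UNIV. \<Prod>i\<in>J. ent (\<beta>(y := w, z := w)) g i)
          = (\<Sum>w\<in>UNIV. P g $ \<beta> (e (j, \<not> s)) $ w * Q g $ w $ \<beta> (e (j', \<not> s')) * (\<Prod>i\<in>J0. ent \<beta> g i))"
        using J0 False by (simp add: Ej Ej' E0 mult.assoc del: fun_upd_apply)
      also have "\<dots> = (P g ** Q g) $ \<beta> (e (j, \<not> s)) $ \<beta> (e (j', \<not> s')) * (\<Prod>i\<in>J0. ent \<beta> g i)"
        by (simp add: matrix_matrix_mult_def sum_distrib_right)
      also have "(\<Prod>i\<in>J0. ent \<beta> g i) = (\<Prod>i\<in>J0. N' i g $ \<beta> ((e \<circ> h) (i, False)) $ \<beta> ((e \<circ> h) (i, True)))"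
        using J0(3,4) by (intro prod.cong refl) (auto simp: ent_def N'_def h_def)
      also have "(P g ** Q g) $ \<beta> (e (j, \<not> s)) $ \<beta> (e (j', \<not> s'))
          = N' j g $ \<beta> ((e \<circ> h) (j, False)) $ \<beta> ((e \<circ> h) (j, True))"
        by (simp add: N'_def h_def)
      finally show ?thesis
        unfolding J0(2) by (subst prod.insert[OF J0(5,3)])
    qed
    then have "(\<lambda>g. \<Sum>\<beta>\<in>idx (insert y (insert z S)). rat_ac (if \<beta> y = \<beta> z then \<theta> \<beta> else 0) * (\<Prod>i\<in>J. ent \<beta> g i))
        = (\<lambda>g. \<Sum>\<beta>\<in>idx S. rat_ac (\<theta> \<beta>) * (\<Prod>i\<in>J-{j'}. N' i g $ \<beta> ((e \<circ> h) (i, False)) $ \<beta> ((e \<circ> h) (i, True))))"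
      unfolding sum_eq by simp
    moreover have "\<dots> \<in> \<A>" by (rule pair.IH[OF _ bij']) (use J N' in auto)
    ultimately show ?thesis unfolding ent_def by simp
  qed
qed

text \<open>Expanding the product chooses a row and a column index for each factor; the choices are
  recorded in a single tuple over \<open>J \<times> UNIV\<close>.\<close>

lemma prod_sum_pairs:
  fixes h :: "'j \<Rightarrow> 'n::finite \<Rightarrow> 'n \<Rightarrow> 'a::comm_semiring_1"
  assumes "finite J"
  shows "(\<Prod>j\<in>J. \<Sum>a\<in>UNIV. \<Sum>b\<in>UNIV. h j a b)
    = (\<Sum>\<beta>\<in>idx (J \<times> (UNIV :: bool set)). \<Prod>j\<in>J. h j (\<beta> (j, False)) (\<beta> (j, True)))"
  using assms
proof (induction J rule: finite_induct)
  case (insert j J)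
  have ins: "insert j J \<times> (UNIV :: bool set) = insert (j, False) (insert (j, True) (J \<times> UNIV))"
    by (auto simp: UNIV_bool)
  have "(\<Prod>i\<in>insert j J. h i ((\<beta>((j, False) := w, (j, True) := w')) (i, False)) ((\<beta>((j, False) := w, (j, True) := w')) (i, True)))
      = h j w w' * (\<Prod>i\<in>J. h i (\<beta> (i, False)) (\<beta> (i, True)))" for \<beta> w w'
  proof -
    have "(\<Prod>i\<in>J. h i ((\<beta>((j, False) := w, (j, True) := w')) (i, False)) ((\<beta>((j, False) := w, (j, True) := w')) (i, True)))
        = (\<Prod>i\<in>J. h i (\<beta> (i, False)) (\<beta> (i, True)))"
      using insert.hyps by (intro prod.cong) auto
    then show ?thesis using insert.hyps by simp
  qed
  then show ?case
    unfolding ins using insert by (subst sum_idx_insert2) (auto simp: sum_distrib_right sum_distrib_left sum_product)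
qed simp

section \<open>Rational reflections as elements of the general orthogonal group\<close>

definition reflection_matrix :: "('n::finite \<Rightarrow> rat) \<Rightarrow> 'k::field_char_0 alg_closure ^ 'n ^ 'n" where
  "reflection_matrix v = (\<chi> p q. rat_ac (reflection v p q))"

lemma reflection_matrix_transpose:
  "Finite_Cartesian_Product.transpose (reflection_matrix v) = reflection_matrix v"
  by (simp add: reflection_matrix_def vec_eq_iff Finite_Cartesian_Product.transpose_def reflection_sym)

lemma reflection_matrix_gram:
  "reflection_matrix v ** Finite_Cartesian_Product.transpose (reflection_matrix v) = mat 1"
  unfolding reflection_matrix_transpose
  by (simp add: reflection_matrix_def vec_eq_iff matrix_matrix_mult_def mat_def
      rat_ac_simps(5)[symmetric] rat_ac_sum[symmetric] reflection_involution del: rat_ac_simps(5))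

lemma reflection_matrix_GO: "reflection_matrix v \<in> carrier GO"
  by (rule GO_I[OF reflection_matrix_gram]) simp

lemma inv_reflection_matrix:
  fixes v :: "'n::finite \<Rightarrow> rat"
  defines "s \<equiv> reflection_matrix v :: 'k::field_char_0 alg_closure ^ 'n ^ 'n"
  shows "inv\<^bsub>GO\<^esub> s = s"
proof -
  have "similitude s = 1" unfolding s_def by (rule similitude_eqI[OF reflection_matrix_gram])
  moreover have "Finite_Cartesian_Product.transpose s = s"
    unfolding s_def by (rule reflection_matrix_transpose)
  moreover have "s \<in> carrier GO" unfolding s_def by (rule reflection_matrix_GO)
  ultimately show ?thesis by (simp add: inv_GO)
qed

text \<open>Since a reflection is symmetric, conjugation transforms row and column indices by the
  same matrix. Simultaneous conjugation of \<open>M\<close> matrices is therefore the tensor power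
  on \<open>2 * M\<close> slots.\<close>

lemma prod_conj_reflection:
  fixes N :: "nat \<Rightarrow> 'k::field_char_0 alg_closure ^ 'n ^ 'n" and M :: nat
  defines "S \<equiv> {..<M} \<times> (UNIV :: bool set)"
  shows "(\<Prod>j<M. (reflection_matrix v ** N j ** reflection_matrix v) $ \<alpha> (j, False) $ \<alpha> (j, True))
    = (\<Sum>\<beta>\<in>idx S. rat_ac (tensor_power S (reflection v) \<alpha> \<beta>) * (\<Prod>j<M. N j $ \<beta> (j, False) $ \<beta> (j, True)))"
proof -
  let ?r = "\<lambda>p q. rat_ac (reflection v p q) :: 'k alg_closure"
  have "(reflection_matrix v ** N j ** reflection_matrix v) $ p $ q
      = (\<Sum>a\<in>UNIV. \<Sum>b\<in>UNIV. ?r p a * ?r q b * N j $ a $ b)" for j p q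
    unfolding matrix_matrix_mult_def reflection_matrix_def
    by (subst sum.swap) (simp add: sum_distrib_right sum_distrib_left reflection_sym[of v q] mult_ac)
  then have "(\<Prod>j<M. (reflection_matrix v ** N j ** reflection_matrix v) $ \<alpha> (j, False) $ \<alpha> (j, True))
      = (\<Sum>\<beta>\<in>idx S. \<Prod>j<M. ?r (\<alpha> (j, False)) (\<beta> (j, False)) * ?r (\<alpha> (j, True)) (\<beta> (j, True))
          * N j $ \<beta> (j, False) $ \<beta> (j, True))"
    unfolding S_def by (simp only: prod_sum_pairs[OF finite_lessThan])
  also have "\<dots> = (\<Sum>\<beta>\<in>idx S. rat_ac (tensor_power S (reflection v) \<alpha> \<beta>) * (\<Prod>j<M. N j $ \<beta> (j, False) $ \<beta> (j, True)))"
  proof (intro sum.cong refl)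
    fix \<beta> :: "nat \<times> bool \<Rightarrow> 'n"
    have "rat_ac (tensor_power S (reflection v) \<alpha> \<beta>)
        = (\<Prod>j<M. \<Prod>b\<in>UNIV. ?r (\<alpha> (j, b)) (\<beta> (j, b)))"
      unfolding tensor_power_def rat_ac_prod S_def by (simp add: prod.cartesian_product')
    then show "(\<Prod>j<M. ?r (\<alpha> (j, False)) (\<beta> (j, False)) * ?r (\<alpha> (j, True)) (\<beta> (j, True))
          * N j $ \<beta> (j, False) $ \<beta> (j, True))
      = rat_ac (tensor_power S (reflection v) \<alpha> \<beta>) * (\<Prod>j<M. N j $ \<beta> (j, False) $ \<beta> (j, True))"
      by (simp add: UNIV_bool prod.distrib)
  qed
  finally show ?thesis .
qed


section \<open>Invariant functions on tuples of similitudes\<close>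

definition homogeneous_entry :: "(nat \<Rightarrow> 'a::field ^ 'n ^ 'n) \<Rightarrow> nat option \<Rightarrow> 'a ^ 'n ^ 'n" where
  "homogeneous_entry g x = (case x of None \<Rightarrow> mat 1 | Some i \<Rightarrow> g i)"

text \<open>
  Polynomials in the matrix entries, homogenized to degree \<open>M\<close> by means of the entries of the
  identity matrix, which is fixed under conjugation.
\<close>

inductive homogenized ::
    "nat set \<Rightarrow> nat \<Rightarrow> ((nat \<Rightarrow> 'k::field alg_closure ^ 'n::finite ^ 'n) \<Rightarrow> 'k alg_closure) \<Rightarrow> bool"
  for I M where
  monomial: "(\<And>j. j < M \<Longrightarrow> x j \<in> insert None (Some ` I)) \<Longrightarrow>
    homogenized I M (\<lambda>g. \<Prod>j<M. homogeneous_entry g (x j) $ a j $ b j)"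
| add: "homogenized I M F \<Longrightarrow> homogenized I M H \<Longrightarrow> homogenized I M (\<lambda>g. F g + H g)"
| scale: "homogenized I M F \<Longrightarrow> homogenized I M (\<lambda>g. to_ac c * F g)"

text \<open>A product of diagonal entries of the identity matrix, used as padding to raise the
  degree.\<close>

lemma homogenized_one: "homogenized I M (\<lambda>_. 1)"
  using homogenized.monomial[of M "\<lambda>_. None" I "\<lambda>_. undefined" "\<lambda>_. undefined"]
  by (simp add: homogeneous_entry_def mat_def)

lemma prod_lessThan_add:
  "(\<Prod>j<M + M'. f j) = (\<Prod>j<M. f j) * (\<Prod>j<M'. f (M + j :: nat) :: 'a::comm_monoid_mult)"
  by (induction M') (simp_all add: mult.assoc)

text \<open>For two monomials the lists of factors are concatenated; bilinearity does the rest
  through a nested induction.\<close>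

lemma homogenized_mult:
  assumes "homogenized I M F" "homogenized I M' H"
  shows "homogenized I (M + M') (\<lambda>g. F g * H g)"
  using assms(1)
proof (induction rule: homogenized.induct)
  case mono: (monomial x a b)
  show ?case
    using assms(2)
  proof (induction rule: homogenized.induct)
    case (monomial x' a' b')
    define y where "y j = (if j < M then x j else x' (j - M))" for j
    define c where "c j = (if j < M then a j else a' (j - M))" for j
    define d where "d j = (if j < M then b j else b' (j - M))" for j
    have "homogenized I (M + M') (\<lambda>g. \<Prod>j<M + M'. homogeneous_entry g (y j) $ c j $ d j)"
      using mono monomial by (intro homogenized.monomial) (simp add: y_def)
    then show ?case by (simp add: prod_lessThan_add y_def c_def d_def)
  next
    case (add F H)
    from homogenized.add[OF add.IH] show ?case by (simp add: distrib_left)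
  next
    case (scale F c)
    from homogenized.scale[OF scale.IH, of c] show ?case by (simp add: mult_ac)
  qed
next
  case (add F H)
  from homogenized.add[OF add.IH] show ?case by (simp add: distrib_right)
next
  case (scale F c)
  from homogenized.scale[OF scale.IH, of c] show ?case by (simp add: mult.assoc)
qed

definition polynomial_on ::
    "nat set \<Rightarrow> ((nat \<Rightarrow> 'k::field alg_closure ^ 'n::finite ^ 'n) \<Rightarrow> 'k alg_closure) \<Rightarrow> bool" where
  "polynomial_on I F \<longleftrightarrow> (\<exists>M. homogenized I M F)"

lemma polynomial_on_const: "polynomial_on I (\<lambda>_. to_ac c)"
  unfolding polynomial_on_def using homogenized.scale[OF homogenized_one, of I 0 c] by auto

lemma polynomial_on_entry: "i \<in> I \<Longrightarrow> polynomial_on I (\<lambda>g. g i $ a $ b)"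
  unfolding polynomial_on_def
  using homogenized.monomial[of 1 "\<lambda>_. Some i" I "\<lambda>_. a" "\<lambda>_. b"]
  by (intro exI[of _ 1]) (simp add: homogeneous_entry_def)

lemma polynomial_on_mult:
  "polynomial_on I F \<Longrightarrow> polynomial_on I H \<Longrightarrow> polynomial_on I (\<lambda>g. F g * H g)"
  unfolding polynomial_on_def using homogenized_mult by blast

text \<open>The summands may have different degrees; each is padded by
  \<open>homogenized_one\<close> to the degree \<open>M + M'\<close>.\<close>

lemma polynomial_on_add:
  assumes "polynomial_on I F" "polynomial_on I H"
  shows "polynomial_on I (\<lambda>g. F g + H g)"
proof -
  obtain M M' where "homogenized I M F" "homogenized I M' H"
    using assms by (auto simp: polynomial_on_def)
  from homogenized.add[OF homogenized_mult[OF this(1) homogenized_one] homogenized_mult[OF homogenized_one this(2)]]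
  have "homogenized I (M + M') (\<lambda>g. F g + H g)" by simp
  then show ?thesis unfolding polynomial_on_def by blast
qed

lemma polynomial_on_sum:
  "(\<And>x. x \<in> A \<Longrightarrow> polynomial_on I (F x)) \<Longrightarrow> polynomial_on I (\<lambda>g. \<Sum>x\<in>A. F x g)"
  using polynomial_on_const[of I 0]
  by (induction A rule: infinite_finite_induct) (auto intro: polynomial_on_add)

lemma polynomial_on_prod:
  "(\<And>x. x \<in> A \<Longrightarrow> polynomial_on I (F x)) \<Longrightarrow> polynomial_on I (\<lambda>g. \<Prod>x\<in>A. F x g)"
  using polynomial_on_const[of I 1]
  by (induction A rule: infinite_finite_induct) (auto intro: polynomial_on_mult)

text \<open>A polynomial expression for the similitude, valid on the group. The index
  \<open>undefined\<close> denotes an arbitrary fixed row.\<close>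

definition row_norm :: "'a::field ^ 'n ^ 'n \<Rightarrow> 'a" where
  "row_norm A = (\<Sum>b\<in>UNIV. A $ undefined $ b * A $ undefined $ b)"

lemma row_norm_GO: "A \<in> carrier GO \<Longrightarrow> row_norm A = similitude A"
  unfolding row_norm_def by (rule similitude_eq_sum[symmetric])

lemma polynomial_on_row_norms: "J \<subseteq> I \<Longrightarrow> polynomial_on I (\<lambda>g. \<Prod>i\<in>J. row_norm (g i))"
  unfolding row_norm_def
  by (intro polynomial_on_prod polynomial_on_sum polynomial_on_mult polynomial_on_entry) auto

lemma polynomial_on_power: "polynomial_on I F \<Longrightarrow> polynomial_on I (\<lambda>g. F g ^ N)"
  using polynomial_on_const[of I 1] by (induction N) (auto intro: polynomial_on_mult)

text \<open>Powers of one common denominator, the product of all row norms, suffice: multiplying the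
  inverse of one similitude by it leaves the product over the other indices.\<close>

lemma regular_clear_denominator:
  fixes f :: "(nat \<Rightarrow> 'k::field alg_closure ^ 'n::finite ^ 'n) \<Rightarrow> 'k alg_closure"
  assumes "f \<in> regular I" "finite I"
  shows "\<exists>N F. polynomial_on I F \<and> (\<forall>g\<in>GO_pow I. f g * (\<Prod>i\<in>I. row_norm (g i)) ^ N = F g)"
  using assms(1)
proof (induction rule: regular.induct)
  case (const c)
  show ?case by (rule exI[of _ 0], rule exI, rule conjI[OF polynomial_on_const[of I c]]) simp
next
  case (entry i a b)
  show ?case by (rule exI[of _ 0], rule exI, rule conjI[OF polynomial_on_entry[OF entry, of a b]]) simp
next
  case (inv_similitude i)
  have "inverse (similitude (g i)) * (\<Prod>i\<in>I. row_norm (g i)) ^ 1 = (\<Prod>i\<in>I - {i}. row_norm (g i))"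
    if "g \<in> GO_pow I" for g :: "nat \<Rightarrow> 'k alg_closure ^ 'n ^ 'n"
  proof -
    have "g i \<in> carrier GO" using that inv_similitude by auto
    then have "similitude (g i) \<noteq> 0" "row_norm (g i) = similitude (g i)"
      by (auto simp: row_norm_GO GO_carrier_iff)
    then show ?thesis using inv_similitude by (simp add: prod.remove[OF assms(2)] mult.assoc[symmetric])
  qed
  then show ?case
    by (intro exI[of _ 1] exI[of _ "\<lambda>g. \<Prod>i\<in>I - {i}. row_norm (g i)"] conjI ballI polynomial_on_row_norms)
       (auto simp del: power_one_right)
next
  case (add f h)
  let ?D = "\<lambda>g. \<Prod>i\<in>I. row_norm (g i) :: 'k alg_closure"
  obtain N F where F: "polynomial_on I F" "\<forall>g\<in>GO_pow I. f g * ?D g ^ N = F g"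
    using add.IH(1) by (elim exE conjE)
  obtain N' H where H: "polynomial_on I H" "\<forall>g\<in>GO_pow I. h g * ?D g ^ N' = H g"
    using add.IH(2) by (elim exE conjE)
  show ?case
  proof (intro exI[of _ "N + N'"] exI[of _ "\<lambda>g. F g * ?D g ^ N' + H g * ?D g ^ N"] conjI ballI)
    show "polynomial_on I (\<lambda>g. F g * ?D g ^ N' + H g * ?D g ^ N)"
      by (intro polynomial_on_add polynomial_on_mult polynomial_on_power polynomial_on_row_norms F H order_refl)
    fix g :: "nat \<Rightarrow> 'k alg_closure ^ 'n ^ 'n" assume "g \<in> GO_pow I"
    then have eqs: "F g = f g * ?D g ^ N" "H g = h g * ?D g ^ N'" using F(2) H(2) by simp_all
    show "(\<lambda>g\<in>GO_pow I. f g + h g) g * ?D g ^ (N + N') = F g * ?D g ^ N' + H g * ?D g ^ N"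
      using \<open>g \<in> GO_pow I\<close> by (simp only: restrict_apply' power_add eqs) (simp add: algebra_simps)
  qed
next
  case (mult f h)
  let ?D = "\<lambda>g. \<Prod>i\<in>I. row_norm (g i) :: 'k alg_closure"
  obtain N F where F: "polynomial_on I F" "\<forall>g\<in>GO_pow I. f g * ?D g ^ N = F g"
    using mult.IH(1) by (elim exE conjE)
  obtain N' H where H: "polynomial_on I H" "\<forall>g\<in>GO_pow I. h g * ?D g ^ N' = H g"
    using mult.IH(2) by (elim exE conjE)
  show ?case
  proof (intro exI[of _ "N + N'"] exI[of _ "\<lambda>g. F g * H g"] conjI ballI)
    show "polynomial_on I (\<lambda>g. F g * H g)" by (intro polynomial_on_mult F H)
    fix g :: "nat \<Rightarrow> 'k alg_closure ^ 'n ^ 'n" assume "g \<in> GO_pow I"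
    then have eqs: "F g = f g * ?D g ^ N" "H g = h g * ?D g ^ N'" using F(2) H(2) by simp_all
    show "(\<lambda>g\<in>GO_pow I. f g * h g) g * ?D g ^ (N + N') = F g * H g"
      using \<open>g \<in> GO_pow I\<close> by (simp only: restrict_apply' power_add eqs) (simp add: algebra_simps)
  qed
qed

section \<open>The Laplacian on functions of tuples and its agreement with the tensor
  Laplacian\<close>

definition conj_tuple ::
    "nat set \<Rightarrow> 'a::field ^ 'n ^ 'n \<Rightarrow> (nat \<Rightarrow> 'a ^ 'n ^ 'n) \<Rightarrow> nat \<Rightarrow> 'a ^ 'n ^ 'n" where
  "conj_tuple I h g = (\<lambda>i\<in>I. h \<otimes>\<^bsub>GO\<^esub> g i \<otimes>\<^bsub>GO\<^esub> inv\<^bsub>GO\<^esub> h)"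

definition function_laplacian ::
    "nat set \<Rightarrow> ('n::finite \<Rightarrow> rat) set \<Rightarrow> ((nat \<Rightarrow> 'k::field_char_0 alg_closure ^ 'n ^ 'n) \<Rightarrow> 'k alg_closure)
      \<Rightarrow> (nat \<Rightarrow> 'k alg_closure ^ 'n ^ 'n) \<Rightarrow> 'k alg_closure" where
  "function_laplacian I V F g = (\<Sum>v\<in>V. F g - F (conj_tuple I (reflection_matrix v) g))"

lemma conj_tuple_in_GO_pow: "h \<in> carrier GO \<Longrightarrow> g \<in> GO_pow I \<Longrightarrow> conj_tuple I h g \<in> GO_pow I"
  unfolding conj_tuple_def by (rule conj_in_GO_pow)

lemma reflection_matrix_square:
  "reflection_matrix v ** reflection_matrix v = (mat 1 :: 'k::field_char_0 alg_closure ^ 'n::finite ^ 'n)"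
  using reflection_matrix_gram[of v, where ?'a = 'k] by (simp add: reflection_matrix_transpose)

text \<open>A reflection is its own inverse, so the padding entries, being those of the identity,
  obey the same formula as the variables.\<close>

lemma homogeneous_entry_conj:
  assumes "x \<in> insert None (Some ` I)"
  shows "homogeneous_entry (conj_tuple I (reflection_matrix v) g) x
    = reflection_matrix v ** homogeneous_entry g x ** reflection_matrix v"
  using assms
  by (auto simp: homogeneous_entry_def conj_tuple_def inv_reflection_matrix GO_mult reflection_matrix_square)

lemma function_laplacian_add:
  "function_laplacian I V (\<lambda>g. F g + H g) = (\<lambda>g. function_laplacian I V F g + function_laplacian I V H g)"
  by (auto simp: function_laplacian_def fun_eq_iff sum.distrib[symmetric] intro!: sum.cong)

lemma function_laplacian_scale:
  "function_laplacian I V (\<lambda>g. c * F g) = (\<lambda>g. c * function_laplacian I V F g)"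
  by (simp add: function_laplacian_def fun_eq_iff sum_distrib_left right_diff_distrib)

lemma function_laplacian_power_add:
  "(function_laplacian I V ^^ i) (\<lambda>g. F g + H g)
    = (\<lambda>g. (function_laplacian I V ^^ i) F g + (function_laplacian I V ^^ i) H g)"
  by (induction i) (simp_all add: function_laplacian_add)

lemma function_laplacian_power_scale:
  "(function_laplacian I V ^^ i) (\<lambda>g. c * F g) = (\<lambda>g. c * (function_laplacian I V ^^ i) F g)"
  by (induction i) (simp_all add: function_laplacian_scale)

text \<open>The first application gives zero on \<open>GO_pow I\<close>. Conjugation by a reflection
  stays in this set, so higher powers vanish there too, whatever happens elsewhere.\<close>

lemma function_laplacian_invariant:
  assumes inv: "\<And>h g. h \<in> carrier GO \<Longrightarrow> g \<in> GO_pow I \<Longrightarrow> F (conj_tuple I h g) = F g"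
    and "i \<noteq> 0" "g \<in> GO_pow I"
  shows "(function_laplacian I V ^^ i) F g = 0"
  using assms(2,3)
proof (induction i arbitrary: g)
  case (Suc i)
  show ?case
  proof (cases "i = 0")
    case True
    then show ?thesis using inv[OF reflection_matrix_GO Suc.prems(2)] by (simp add: function_laplacian_def)
  next
    case False
    then show ?thesis
      using Suc.IH[OF False Suc.prems(2)] Suc.IH[OF False conj_tuple_in_GO_pow[OF reflection_matrix_GO Suc.prems(2)]]
      by (simp add: function_laplacian_def)
  qed
qed simp

text \<open>By \<open>prod_conj_reflection\<close>, conjugation acts linearly on the monomials with
  fixed factors \<open>x\<close>, through tensor powers of reflections. Symmetry of the tensor
  Laplacian makes the order of its indices immaterial in the induction.\<close>

lemma function_laplacian_power_monomial:
  fixes g :: "nat \<Rightarrow> 'k::field_char_0 alg_closure ^ 'n::finite ^ 'n" and \<beta> :: "nat \<times> bool \<Rightarrow> 'n"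
  assumes x: "\<And>j. j < M \<Longrightarrow> x j \<in> insert None (Some ` I)"
  defines "S \<equiv> {..<M} \<times> (UNIV :: bool set)"
  defines "m \<equiv> \<lambda>\<beta> g. \<Prod>j<M. homogeneous_entry g (x j) $ \<beta> (j, False) $ \<beta> (j, True)"
  assumes "\<beta> \<in> idx S"
  shows "(function_laplacian I V ^^ i) (m \<beta>) g = (\<Sum>\<alpha>\<in>idx S. rat_ac (laplacian_power S V i \<alpha> \<beta>) * m \<alpha> g)"
proof -
  have fin: "finite S" by (simp add: S_def)
  note fin' = finite_idx[OF fin, where ?'n = 'n]
  show ?thesis
  proof (induction i arbitrary: g)
    case 0
    have "(\<Sum>\<alpha>\<in>idx S. of_bool (\<alpha> = \<beta>) * m \<alpha> g) = (\<Sum>\<alpha>\<in>idx S. if \<alpha> = \<beta> then m \<alpha> g else 0)"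
      by (intro sum.cong) auto
    then show ?case using fin' assms(4) by simp
  next
    case (Suc i)
    let ?c = "\<lambda>v g. conj_tuple I (reflection_matrix v) g"
    have conj: "m \<alpha> (?c v g) = (\<Sum>\<gamma>\<in>idx S. rat_ac (tensor_power S (reflection v) \<alpha> \<gamma>) * m \<gamma> g)" for \<alpha> v g
    proof -
      have "m \<alpha> (?c v g) = (\<Prod>j<M. (reflection_matrix v ** homogeneous_entry g (x j) ** reflection_matrix v)
          $ \<alpha> (j, False) $ \<alpha> (j, True))"
        unfolding m_def by (intro prod.cong refl) (simp only: homogeneous_entry_conj x lessThan_iff)
      then show ?thesis
        unfolding S_def m_def prod_conj_reflection[where N = "\<lambda>j. homogeneous_entry g (x j)"] .
    qed
    have lap: "(\<Sum>v\<in>V. m \<alpha> g - m \<alpha> (?c v g)) = (\<Sum>\<gamma>\<in>idx S. rat_ac (laplacian S V \<alpha> \<gamma>) * m \<gamma> g)"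
      if "\<alpha> \<in> idx S" for \<alpha>
    proof -
      have "m \<alpha> g = (\<Sum>\<gamma>\<in>idx S. of_bool (\<alpha> = \<gamma>) * m \<gamma> g)"
      proof -
        have "(\<Sum>\<gamma>\<in>idx S. of_bool (\<alpha> = \<gamma>) * m \<gamma> g) = (\<Sum>\<gamma>\<in>idx S. if \<gamma> = \<alpha> then m \<gamma> g else 0)"
          by (intro sum.cong) auto
        then show ?thesis using that fin' by simp
      qed
      then have "(\<Sum>v\<in>V. m \<alpha> g - m \<alpha> (?c v g)) = (\<Sum>v\<in>V. \<Sum>\<gamma>\<in>idx S.
          (of_bool (\<alpha> = \<gamma>) - rat_ac (tensor_power S (reflection v) \<alpha> \<gamma>)) * m \<gamma> g)"
        unfolding conj by (simp add: left_diff_distrib sum_subtractf)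
      also have "\<dots> = (\<Sum>\<gamma>\<in>idx S. rat_ac (laplacian S V \<alpha> \<gamma>) * m \<gamma> g)"
        by (subst sum.swap) (simp add: laplacian_def rat_ac_sum sum_distrib_right)
      finally show ?thesis .
    qed
    have "(function_laplacian I V ^^ Suc i) (m \<beta>) g
        = (\<Sum>v\<in>V. \<Sum>\<alpha>\<in>idx S. rat_ac (laplacian_power S V i \<alpha> \<beta>) * (m \<alpha> g - m \<alpha> (?c v g)))"
      by (simp add: function_laplacian_def Suc.IH sum_subtractf right_diff_distrib)
    also have "\<dots> = (\<Sum>\<alpha>\<in>idx S. rat_ac (laplacian_power S V i \<alpha> \<beta>) * (\<Sum>v\<in>V. m \<alpha> g - m \<alpha> (?c v g)))"
      by (subst sum.swap) (simp only: sum_distrib_left)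
    also have "\<dots> = (\<Sum>\<alpha>\<in>idx S. \<Sum>\<gamma>\<in>idx S. rat_ac (laplacian_power S V i \<alpha> \<beta>) * (rat_ac (laplacian S V \<alpha> \<gamma>) * m \<gamma> g))"
      by (intro sum.cong refl) (simp only: lap sum_distrib_left)
    also have "\<dots> = (\<Sum>\<gamma>\<in>idx S. rat_ac (laplacian_power S V (Suc i) \<gamma> \<beta>) * m \<gamma> g)"
      by (subst sum.swap) (simp add: rat_ac_sum sum_distrib_right sum_distrib_left laplacian_sym[of S V] mult_ac)
    finally show ?case .
  qed
qed


section \<open>Closure properties of an arbitrary subalgebra containing the trace and the
  similitude\<close>

locale sub_algebra_tr_similitude =
  fixes B :: "nat set \<Rightarrow> ((nat \<Rightarrow> 'k::field_char_0 alg_closure ^ 'n::finite ^ 'n) \<Rightarrow> 'k alg_closure) set"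
  assumes sub: "sub_FFG_algebra ring_of_type_algebra
      (GO_invariants :: ('k, (nat \<Rightarrow> 'k alg_closure ^ 'n ^ 'n) \<Rightarrow> 'k alg_closure) FFG_data) B"
    and tr_mem: "tr_fun \<in> B {0}"
    and similitude_mem: "similitude_fun \<in> B {0}"
begin

text \<open>Membership is tested after restriction to \<open>GO_pow I\<close>, so that functions can
  be combined without tracking their values elsewhere.\<close>

definition members :: "nat set \<Rightarrow> ((nat \<Rightarrow> 'k alg_closure ^ 'n ^ 'n) \<Rightarrow> 'k alg_closure) set" where
  "members I = {F. (\<lambda>g\<in>GO_pow I. F g) \<in> B I}"

lemma members_cong:
  assumes "F \<in> members I" "\<And>g. g \<in> GO_pow I \<Longrightarrow> F g = H g"
  shows "H \<in> members I"
  using assms restrict_ext[of "GO_pow I" F H] by (simp add: members_def)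

context
  fixes I :: "nat set"
  assumes I: "I \<in> FFG_obj"
begin

lemma subring_B: "subring (B I) (alg GO_invariants I)"
  and submodule_B: "submodule (B I) ring_of_type_algebra (alg GO_invariants I)"
  using sub I by (auto simp: sub_FFG_algebra_def)

lemma members_add: "F \<in> members I \<Longrightarrow> H \<in> members I \<Longrightarrow> (\<lambda>g. F g + H g) \<in> members I"
  using subringE(7)[OF subring_B, of "restrict F (GO_pow I)" "restrict H (GO_pow I)"]
  unfolding members_def GO_invariants_simps
  by (simp del: restrict_apply add: restrict_apply' cong: restrict_cong)

lemma members_mult: "F \<in> members I \<Longrightarrow> H \<in> members I \<Longrightarrow> (\<lambda>g. F g * H g) \<in> members I"
  using subringE(6)[OF subring_B, of "restrict F (GO_pow I)" "restrict H (GO_pow I)"]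
  unfolding members_def GO_invariants_simps
  by (simp del: restrict_apply add: restrict_apply' cong: restrict_cong)

lemma members_scale: "F \<in> members I \<Longrightarrow> (\<lambda>g. to_ac c * F g) \<in> members I"
  using submodule.smult_closed[OF submodule_B, of c "restrict F (GO_pow I)"]
  unfolding members_def GO_invariants_simps
  by (simp del: restrict_apply add: restrict_apply' ring_of_type_algebra_def cong: restrict_cong)

lemma members_one: "(\<lambda>_. 1) \<in> members I"
  using subringE(3)[OF subring_B] unfolding members_def GO_invariants_simps by simp

lemma members_zero: "(\<lambda>_. 0) \<in> members I"
  using members_scale[OF members_one, of 0] by simp

lemma members_rat_scale: "F \<in> members I \<Longrightarrow> (\<lambda>g. rat_ac c * F g) \<in> members I"
  unfolding rat_ac_def by (rule members_scale)

lemma members_prod: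
  "(\<And>x. x \<in> T \<Longrightarrow> F x \<in> members I) \<Longrightarrow> (\<lambda>g. \<Prod>x\<in>T. F x g) \<in> members I"
  using members_one by (induction T rule: infinite_finite_induct) (auto intro: members_mult)

lemma members_power: "F \<in> members I \<Longrightarrow> (\<lambda>g. F g ^ N) \<in> members I"
  using members_one by (induction N) (auto intro: members_mult)

text \<open>The homomorphism from \<open>FG {0}\<close> that sends the generator to \<open>w\<close>
  pulls a function of one matrix back to its value at the word \<open>w\<close>. This is where the
  functoriality of the subalgebra is used.\<close>

lemma members_word:
  assumes F: "(\<lambda>g\<in>GO_pow {0}. F (g 0)) \<in> B {0}" and w: "w \<in> carrier (FG I)"
  shows "(\<lambda>g. F (eval_word GO g w)) \<in> members I"
proof -
  interpret FG: group "FG I" by (rule group_FG)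
  define \<phi> where "\<phi> = eval_word (FG I) (\<lambda>_. w)"
  have \<phi>: "\<phi> \<in> hom (FG {0}) (FG I)"
    unfolding \<phi>_def using w by (intro FG.eval_word_hom) auto
  have \<phi>0: "\<phi> (gen 0) = w" unfolding \<phi>_def using w by (intro FG.eval_word_gen)
  have "{0} \<in> FFG_obj" by (simp add: FFG_obj_def)
  with sub I \<phi> have "amap GO_invariants {0} I \<phi> ` B {0} \<subseteq> B I"
    unfolding sub_FFG_algebra_def by blast
  with F have "amap GO_invariants {0} I \<phi> (\<lambda>g\<in>GO_pow {0}. F (g 0)) \<in> B I" by (elim subsetD) (rule imageI)
  moreover have "amap GO_invariants {0} I \<phi> (\<lambda>g\<in>GO_pow {0}. F (g 0)) = (\<lambda>g\<in>GO_pow I. F (eval_word GO g w))"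
    unfolding GO_invariants_simps
  proof (rule restrict_ext)
    fix g :: "nat \<Rightarrow> 'k alg_closure ^ 'n ^ 'n" assume "g \<in> GO_pow I"
    from restrict_apply'[OF GO_subst_in_GO_pow[OF \<phi> this]]
    have "(\<lambda>g\<in>GO_pow {0}. F (g 0)) (GO_subst {0} \<phi> g) = F (GO_subst {0} \<phi> g 0)" .
    moreover have "GO_subst {0} \<phi> g 0 = eval_word GO g w" by (simp add: GO_subst_def \<phi>0)
    ultimately show "(\<lambda>g\<in>GO_pow {0}. F (g 0)) (GO_subst {0} \<phi> g) = F (eval_word GO g w)"
      by (simp only:)
  qed
  ultimately show ?thesis by (simp add: members_def)
qed

lemma trace_word: "w \<in> carrier (FG I) \<Longrightarrow> (\<lambda>g. trace (eval_word GO g w)) \<in> members I"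
  using tr_mem unfolding tr_fun_def by (rule members_word)

lemma similitude_word: "w \<in> carrier (FG I) \<Longrightarrow> (\<lambda>g. similitude (eval_word GO g w)) \<in> members I"
  using similitude_mem unfolding similitude_fun_def by (rule members_word)

text \<open>Words alone are not closed under transposition, because the transpose of a similitude is
  a scalar multiple of its inverse. The factor \<open>u\<close> absorbs such scalars.\<close>

definition matrices :: "((nat \<Rightarrow> 'k alg_closure ^ 'n ^ 'n) \<Rightarrow> 'k alg_closure ^ 'n ^ 'n) set" where
  "matrices = {N. \<exists>u\<in>members I. \<exists>w\<in>carrier (FG I). \<forall>g\<in>GO_pow I. N g = mat (u g) ** eval_word GO g w}"

lemma matricesE:
  assumes "N \<in> matrices"
  obtains u w where "u \<in> members I" "w \<in> carrier (FG I)" "\<forall>g\<in>GO_pow I. N g = mat (u g) ** eval_word GO g w"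
  using assms unfolding matrices_def by blast

lemma matricesI:
  assumes "u \<in> members I" "w \<in> carrier (FG I)" "\<And>g. g \<in> GO_pow I \<Longrightarrow> N g = mat (u g) ** eval_word GO g w"
  shows "N \<in> matrices"
  using assms unfolding matrices_def by blast

lemma eval_word_GO_hom: "g \<in> GO_pow I \<Longrightarrow> eval_word GO g \<in> hom (FG I) (GO :: ('k alg_closure ^ 'n ^ 'n) monoid)"
  by (rule group.eval_word_hom[OF group_GO]) auto

lemma eval_word_GO_carrier:
  "g \<in> GO_pow I \<Longrightarrow> w \<in> carrier (FG I) \<Longrightarrow> eval_word GO g w \<in> carrier (GO :: ('k alg_closure ^ 'n ^ 'n) monoid)"
  using eval_word_GO_hom by (auto simp: hom_def)

lemma matrices_mult:
  assumes "N \<in> matrices" "N' \<in> matrices"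
  shows "(\<lambda>g. N g ** N' g) \<in> matrices"
proof -
  interpret FG: group "FG I" by (rule group_FG)
  obtain u w where N: "u \<in> members I" "w \<in> carrier (FG I)"
    "\<forall>g\<in>GO_pow I. N g = mat (u g) ** eval_word GO g w" using assms(1) by (rule matricesE)
  obtain u' w' where N': "u' \<in> members I" "w' \<in> carrier (FG I)"
    "\<forall>g\<in>GO_pow I. N' g = mat (u' g) ** eval_word GO g w'" using assms(2) by (rule matricesE)
  show ?thesis
  proof (rule matricesI[OF members_mult[OF N(1) N'(1)] FG.m_closed[OF N(2) N'(2)]])
    fix g :: "nat \<Rightarrow> 'k alg_closure ^ 'n ^ 'n" assume g: "g \<in> GO_pow I"
    let ?W = "eval_word GO g w" and ?W' = "eval_word GO g w'"
    have "eval_word GO g (w \<otimes>\<^bsub>FG I\<^esub> w') = ?W ** ?W'"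
      using eval_word_GO_hom[OF g] N(2) N'(2) by (simp add: hom_def GO_mult)
    moreover have "mat (u g) ** ?W ** (mat (u' g) ** ?W') = mat (u g) ** (?W ** mat (u' g)) ** ?W'"
      by (simp only: matrix_mul_assoc)
    then have "mat (u g) ** ?W ** (mat (u' g) ** ?W') = mat (u g * u' g) ** (?W ** ?W')"
      by (simp only: mat_commute[of ?W] matrix_mul_assoc mat_mult_mat)
    ultimately show "N g ** N' g = mat (u g * u' g) ** eval_word GO g (w \<otimes>\<^bsub>FG I\<^esub> w')"
      by (simp only: N(3)[rule_format, OF g] N'(3)[rule_format, OF g])
  qed
qed

text \<open>On the group the transpose of \<open>W\<close> is \<open>similitude W\<close> times the
  inverse of \<open>W\<close>; the inverse is again a word and the scalar is in the subalgebra by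
  \<open>similitude_word\<close>.\<close>

lemma matrices_transpose:
  assumes "N \<in> matrices"
  shows "(\<lambda>g. Finite_Cartesian_Product.transpose (N g)) \<in> matrices"
proof -
  let ?T = "Finite_Cartesian_Product.transpose"
  interpret FG: group "FG I" by (rule group_FG)
  obtain u w where N: "u \<in> members I" "w \<in> carrier (FG I)"
    "\<forall>g\<in>GO_pow I. N g = mat (u g) ** eval_word GO g w" using assms by (rule matricesE)
  show ?thesis
  proof (rule matricesI[OF members_mult[OF N(1) similitude_word[OF N(2)]] FG.inv_closed[OF N(2)]])
    fix g :: "nat \<Rightarrow> 'k alg_closure ^ 'n ^ 'n" assume g: "g \<in> GO_pow I"
    let ?W = "eval_word GO g w"
    have W: "?W \<in> carrier GO" by (rule eval_word_GO_carrier[OF g N(2)])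
    then have nz: "similitude ?W \<noteq> 0" by (simp add: GO_carrier_iff)
    interpret group_hom "FG I" GO "eval_word GO g"
      using group_FG group_GO eval_word_GO_hom[OF g] by (simp add: group_hom_def group_hom_axioms_def)
    have "eval_word GO g (inv\<^bsub>FG I\<^esub> w) = mat (inverse (similitude ?W)) ** ?T ?W"
      using N(2) inv_GO[OF W] by simp
    then have "mat (u g * similitude ?W) ** eval_word GO g (inv\<^bsub>FG I\<^esub> w)
        = mat (u g * similitude ?W * inverse (similitude ?W)) ** ?T ?W"
      by (simp only: matrix_mul_assoc mat_mult_mat)
    also have "\<dots> = mat (u g) ** ?T ?W" using nz by (simp add: mult.assoc)
    also have "\<dots> = ?T (mat (u g) ** ?W)"
      by (simp add: matrix_transpose_mul transpose_mat mat_commute)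
    finally show "?T (N g) = mat (u g * similitude ?W) ** eval_word GO g (inv\<^bsub>FG I\<^esub> w)"
      by (simp add: N(3)[rule_format, OF g])
  qed
qed

lemma trace_matrices:
  assumes "N \<in> matrices"
  shows "(\<lambda>g. trace (N g)) \<in> members I"
proof -
  obtain u w where N: "u \<in> members I" "w \<in> carrier (FG I)"
    "\<forall>g\<in>GO_pow I. N g = mat (u g) ** eval_word GO g w" using assms by (rule matricesE)
  show ?thesis
    by (rule members_cong[OF members_mult[OF N(1) trace_word[OF N(2)]]])
       (simp add: N(3) trace_def mat_mult_nth sum_distrib_left)
qed

lemma homogeneous_entry_matrices:
  assumes "x \<in> insert None (Some ` I)"
  shows "(\<lambda>g. homogeneous_entry g x) \<in> matrices"
proof (cases x)
  case None
  show ?thesis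
    by (rule matricesI[OF members_one, of "[]"]) (simp_all add: None homogeneous_entry_def FG_def GO_def)
next
  case (Some i)
  then have i: "i \<in> I" using assms by auto
  show ?thesis
  proof (rule matricesI[OF members_one gen_in_FG[OF i]])
    fix g :: "nat \<Rightarrow> 'k alg_closure ^ 'n ^ 'n" assume "g \<in> GO_pow I"
    then have "g i \<in> carrier GO" using i by auto
    then show "homogeneous_entry g x = mat 1 ** eval_word GO g (gen i)"
      by (simp add: Some homogeneous_entry_def group.eval_word_gen[OF group_GO])
  qed
qed

text \<open>An instance of \<open>matching_contraction\<close> in which the slots are the ends of
  the edges themselves.\<close>

lemma matching_members:
  fixes M :: nat
  assumes "matching ({..<M} \<times> (UNIV :: bool set)) \<theta>" "\<And>j. j < M \<Longrightarrow> x j \<in> insert None (Some ` I)"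
  shows "(\<lambda>g. \<Sum>\<alpha>\<in>idx ({..<M} \<times> UNIV). rat_ac (\<theta> \<alpha>) *
    (\<Prod>j<M. homogeneous_entry g (x j) $ \<alpha> (j, False) $ \<alpha> (j, True))) \<in> members I"
proof -
  have "(\<lambda>g. \<Sum>\<alpha>\<in>idx ({..<M} \<times> UNIV). rat_ac (\<theta> \<alpha>) *
    (\<Prod>j<M. homogeneous_entry g (x j) $ \<alpha> (id (j, False)) $ \<alpha> (id (j, True)))) \<in> members I"
    by (rule matching_contraction[where \<M> = matrices and N = "\<lambda>j g. homogeneous_entry g (x j)"])
       (use assms homogeneous_entry_matrices in \<open>simp_all add: bij_betw_id[unfolded id_def] members_one members_mult trace_matrices
          matrices_mult matrices_transpose\<close>)
  then show ?thesis by simp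
qed

lemma span_matching_members:
  fixes M :: nat
  assumes "w \<in> rat_fun.span {\<theta>. matching ({..<M} \<times> (UNIV :: bool set)) \<theta>}"
    and x: "\<And>j. j < M \<Longrightarrow> x j \<in> insert None (Some ` I)"
  shows "(\<lambda>g. \<Sum>\<alpha>\<in>idx ({..<M} \<times> UNIV). rat_ac (w \<alpha>) *
    (\<Prod>j<M. homogeneous_entry g (x j) $ \<alpha> (j, False) $ \<alpha> (j, True))) \<in> members I"
  using assms(1)
proof (induction rule: rat_fun.span_induct_alt)
  case base
  show ?case using members_zero by simp
next
  case (step c \<theta> w)
  have "matching ({..<M} \<times> (UNIV :: bool set)) \<theta>" using step(1) by simp
  from members_add[OF members_rat_scale[OF matching_members[OF this x], where c = c] step.IH]
  show ?case by (simp add: distrib_right sum.distrib sum_distrib_left mult.assoc)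
qed

text \<open>The coefficients come from \<open>laplacian_decomposition\<close> and depend on
  \<open>M\<close> alone. Hence the claim is linear in \<open>F\<close> and reduces to monomials,
  where the remainder is a combination of contractions along matchings.\<close>

lemma homogenized_reduction:
  fixes M :: nat
  shows "\<exists>T r. finite T \<and> (0::nat) \<notin> T \<and> (\<forall>F. homogenized I M F \<longrightarrow>
    (\<lambda>g. F g - (\<Sum>i\<in>T. rat_ac (r i) * (function_laplacian I (test_vectors (4 * M)) ^^ i) F g)) \<in> members I)"
proof -
  define S where "S = {..<M} \<times> (UNIV :: bool set)"
  define V :: "('n \<Rightarrow> rat) set" where "V = test_vectors (4 * M)"
  \<comment> \<open>There are \<open>2 * M\<close> slots, and the decomposition needs test vectors
    up to twice that number.\<close>
  have S: "finite S" "2 * card S \<le> 4 * M" by (simp_all add: S_def card_cartesian_product)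
  note fin = finite_idx[OF S(1), where ?'n = 'n]
  obtain T r where T: "finite T" "(0::nat) \<notin> T"
    and dec: "\<forall>\<beta>\<in>idx S. \<exists>w\<in>rat_fun.span {\<theta>. matching S \<theta>}. \<forall>\<alpha>\<in>idx S.
      of_bool (\<alpha> = (\<beta> :: nat \<times> bool \<Rightarrow> 'n)) = (\<Sum>i\<in>T. r i * laplacian_power S V i \<alpha> \<beta>) + w \<alpha>"
    using laplacian_decomposition[OF S, where ?'n = 'n] unfolding V_def by blast
  let ?R = "\<lambda>F g. F g - (\<Sum>i\<in>T. rat_ac (r i) * (function_laplacian I V ^^ i) F g)"
  have "?R F \<in> members I" if "homogenized I M F" for F
    using that
  proof (induction rule: homogenized.induct)
    case (monomial x a b)
    define m where "m \<beta> g = (\<Prod>j<M. homogeneous_entry g (x j) $ \<beta> (j, False) $ \<beta> (j, True))"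
      for \<beta> :: "nat \<times> bool \<Rightarrow> 'n" and g :: "nat \<Rightarrow> 'k alg_closure ^ 'n ^ 'n"
    \<comment> \<open>Row indices \<open>a\<close> and column indices \<open>b\<close> are packed
      into one tuple, making the monomial the coordinate at \<open>\<beta>\<close>.\<close>
    define \<beta> where "\<beta> = (\<lambda>y\<in>S. if snd y then b (fst y) else a (fst y))"
    have \<beta>: "\<beta> \<in> idx S" by (simp add: \<beta>_def)
    obtain w where w: "w \<in> rat_fun.span {\<theta>. matching S \<theta>}"
      and dec_w: "\<And>\<alpha>. \<alpha> \<in> idx S \<Longrightarrow> of_bool (\<alpha> = \<beta>) = (\<Sum>i\<in>T. r i * laplacian_power S V i \<alpha> \<beta>) + w \<alpha>"
      using dec \<beta> by blast
    have F: "(\<lambda>g. \<Prod>j<M. homogeneous_entry g (x j) $ a j $ b j) = m \<beta>"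
      unfolding m_def by (intro ext prod.cong) (auto simp: \<beta>_def S_def)
    have lap: "(function_laplacian I V ^^ i) (m \<beta>) g
        = (\<Sum>\<alpha>\<in>idx S. rat_ac (laplacian_power S V i \<alpha> \<beta>) * m \<alpha> g)" for i g
      using function_laplacian_power_monomial[OF monomial, where \<beta> = \<beta> and V = V and i = i and g = g] \<beta> unfolding S_def m_def by simp
    have eq: "?R (m \<beta>) = (\<lambda>g. \<Sum>\<alpha>\<in>idx S. rat_ac (w \<alpha>) * m \<alpha> g)"
    proof
      fix g
      have "(\<Sum>\<alpha>\<in>idx S. rat_ac (of_bool (\<alpha> = \<beta>)) * m \<alpha> g) = (\<Sum>\<alpha>\<in>idx S. if \<alpha> = \<beta> then m \<alpha> g else 0)"
        by (intro sum.cong) auto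
      then have "m \<beta> g = (\<Sum>\<alpha>\<in>idx S. rat_ac (of_bool (\<alpha> = \<beta>)) * m \<alpha> g)" using \<beta> fin by simp
      also have "\<dots> = (\<Sum>\<alpha>\<in>idx S. (\<Sum>i\<in>T. rat_ac (r i) * (rat_ac (laplacian_power S V i \<alpha> \<beta>) * m \<alpha> g))
          + rat_ac (w \<alpha>) * m \<alpha> g)"
        by (intro sum.cong refl) (simp only: dec_w rat_ac_simps rat_ac_sum distrib_right sum_distrib_right mult.assoc)
      also have "\<dots> = (\<Sum>i\<in>T. rat_ac (r i) * (function_laplacian I V ^^ i) (m \<beta>) g) + (\<Sum>\<alpha>\<in>idx S. rat_ac (w \<alpha>) * m \<alpha> g)"
        unfolding sum.distrib lap sum_distrib_left by (subst sum.swap) (rule refl)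
      finally show "?R (m \<beta>) g = (\<Sum>\<alpha>\<in>idx S. rat_ac (w \<alpha>) * m \<alpha> g)" by simp
    qed
    have "?R (m \<beta>) \<in> members I"
      unfolding eq using span_matching_members[OF w[unfolded S_def], of x, OF monomial] unfolding S_def m_def .
    then show ?case unfolding F[symmetric] .
  next
    case (add F H)
    have "?R (\<lambda>g. F g + H g) = (\<lambda>g. ?R F g + ?R H g)"
      by (simp add: fun_eq_iff function_laplacian_power_add distrib_left sum.distrib)
    then show ?case using members_add[OF add.IH] by simp
  next
    case (scale F c)
    have "?R (\<lambda>g. to_ac c * F g) = (\<lambda>g. to_ac c * ?R F g)"
      by (simp add: fun_eq_iff function_laplacian_power_scale right_diff_distrib sum_distrib_left mult_ac)
    then show ?case using members_scale[OF scale.IH, of c] by simp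
  qed
  then show ?thesis using T unfolding V_def by blast
qed

text \<open>Only nonzero powers of the Laplacian occur in the reduction, and these annihilate
  \<open>F\<close> on \<open>GO_pow I\<close>, so the reduction coincides with \<open>F\<close>
  there.\<close>

lemma invariant_polynomial_members:
  assumes "polynomial_on I F"
    and inv: "\<And>h g. h \<in> carrier GO \<Longrightarrow> g \<in> GO_pow I \<Longrightarrow> F (conj_tuple I h g) = F g"
  shows "F \<in> members I"
proof -
  obtain M where M: "homogenized I M F" using assms(1) by (auto simp: polynomial_on_def)
  obtain T r where T: "finite T" "(0::nat) \<notin> T"
    and red: "(\<lambda>g. F g - (\<Sum>i\<in>T. rat_ac (r i) * (function_laplacian I (test_vectors (4 * M)) ^^ i) F g)) \<in> members I"
    using homogenized_reduction[of M] M by blast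
  show ?thesis
  proof (rule members_cong[OF red])
    fix g :: "nat \<Rightarrow> 'k alg_closure ^ 'n ^ 'n" assume g: "g \<in> GO_pow I"
    have "(function_laplacian I (test_vectors (4 * M)) ^^ i) F g = 0" if "i \<in> T" for i
      using that T(2) by (intro function_laplacian_invariant inv g) (assumption | metis)+
    then show "F g - (\<Sum>i\<in>T. rat_ac (r i) * (function_laplacian I (test_vectors (4 * M)) ^^ i) F g) = F g"
      by simp
  qed
qed

text \<open>The similitude is multiplicative, so its inverse is its value at the inverse
  generator.\<close>

lemma inverse_similitude_members:
  assumes i: "i \<in> I"
  shows "(\<lambda>g. inverse (similitude (g i))) \<in> members I"
proof (rule members_cong[OF similitude_word[of "[(i, False)]"]])
  show "[(i, False)] \<in> carrier (FG I)" using i by (simp add: FG_def)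
  fix g :: "nat \<Rightarrow> 'k alg_closure ^ 'n ^ 'n" assume "g \<in> GO_pow I"
  then have gi: "g i \<in> carrier GO" using i by auto
  interpret GO: group "GO :: ('k alg_closure ^ 'n ^ 'n) monoid" by (rule group_GO)
  show "similitude (eval_word GO g [(i, False)]) = inverse (similitude (g i))"
    using gi by (simp add: eval_letter_def similitude_inv)
qed

text \<open>Multiplication by a power of the row norms makes \<open>f\<close> a polynomial function
  without destroying invariance. The power is then divided out again by inverse similitudes, which
  belong to the subalgebra.\<close>

theorem Ad_invariants_subset: "Ad_invariants I \<subseteq> B I"
proof
  fix f :: "(nat \<Rightarrow> 'k alg_closure ^ 'n ^ 'n) \<Rightarrow> 'k alg_closure"
  assume f: "f \<in> Ad_invariants I"
  have fin: "finite I" using I by (simp add: FFG_obj_def)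
  let ?D = "\<lambda>g. \<Prod>i\<in>I. row_norm (g i) :: 'k alg_closure"
  obtain N F where F: "polynomial_on I F" and fF: "\<forall>g\<in>GO_pow I. f g * ?D g ^ N = F g"
    using regular_clear_denominator[OF Ad_invariants_regular[OF f] fin] by (elim exE conjE)
  have D: "?D g = (\<Prod>i\<in>I. similitude (g i))" if "g \<in> GO_pow I" for g
    using that by (intro prod.cong refl row_norm_GO) auto
  have "F \<in> members I"
  proof (rule invariant_polynomial_members[OF F])
    fix h :: "'k alg_closure ^ 'n ^ 'n" and g :: "nat \<Rightarrow> 'k alg_closure ^ 'n ^ 'n"
    assume h: "h \<in> carrier GO" and g: "g \<in> GO_pow I"
    \<comment> \<open>Both tuples lie in \<open>GO_pow I\<close>, where the row norms are
      similitudes and thus unchanged by conjugation.\<close>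
    have c: "conj_tuple I h g \<in> GO_pow I" by (rule conj_tuple_in_GO_pow[OF h g])
    have "?D (conj_tuple I h g) = (\<Prod>i\<in>I. similitude (conj_tuple I h g i))" by (rule D[OF c])
    also have "\<dots> = (\<Prod>i\<in>I. similitude (g i))"
      using g by (intro prod.cong refl) (auto simp: conj_tuple_def intro!: conj_similitude h)
    also have "\<dots> = ?D g" by (rule D[OF g, symmetric])
    finally have "?D (conj_tuple I h g) = ?D g" .
    moreover have "f (conj_tuple I h g) = f g"
      unfolding conj_tuple_def by (rule Ad_invariants_conj[OF f h g])
    ultimately show "F (conj_tuple I h g) = F g" using fF c g by metis
  qed
  then have "(\<lambda>g. F g * (\<Prod>i\<in>I. inverse (similitude (g i))) ^ N) \<in> members I"
    by (intro members_mult members_power members_prod inverse_similitude_members)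
  then have "f \<in> members I"
  proof (rule members_cong)
    fix g :: "nat \<Rightarrow> 'k alg_closure ^ 'n ^ 'n" assume g: "g \<in> GO_pow I"
    have "similitude (g i) \<noteq> 0" if "i \<in> I" for i
      using g that by (auto simp: PiE_iff GO_carrier_iff)
    then have "(\<Prod>i\<in>I. similitude (g i)) * (\<Prod>i\<in>I. inverse (similitude (g i))) = 1"
      unfolding prod.distrib[symmetric] by (intro prod.neutral) simp
    then have "?D g ^ N * (\<Prod>i\<in>I. inverse (similitude (g i))) ^ N = 1"
      unfolding D[OF g] power_mult_distrib[symmetric] by simp
    moreover have "F g = f g * ?D g ^ N" using fF g by simp
    ultimately show "F g * (\<Prod>i\<in>I. inverse (similitude (g i))) ^ N = f g"
      by (simp add: mult.assoc)
  qed
  moreover have "restrict f (GO_pow I) = f"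
    by (rule extensional_restrict[OF regular_extensional[OF Ad_invariants_regular[OF f]]])
  ultimately show "f \<in> B I" by (simp add: members_def)
qed

end

end

text \<open>Makes the whole algebra one of the candidates in the intersection defining
  \<open>FFG_generated\<close>.\<close>

lemma sub_FFG_algebra_carrier:
  assumes "FFG_algebra R A"
  shows "sub_FFG_algebra R A (\<lambda>I. carrier (alg A I))"
  unfolding sub_FFG_algebra_def
proof (intro conjI ballI)
  interpret FFG_algebra R A by fact
  fix I assume I: "I \<in> FFG_obj"
  interpret algebra R "alg A I" by (rule algebra_alg[OF I])
  show "subring (carrier (alg A I)) (alg A I)"
    by (rule ring.carrier_is_subring[OF cring.axioms(1)[OF algebra.axioms(2)[OF algebra_alg[OF I]]]])
  show "submodule (carrier (alg A I)) R (alg A I)" by (rule carrier_is_submodule)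
  fix J \<phi> assume "J \<in> FFG_obj" "\<phi> \<in> hom (FG I) (FG J)"
  from amap_hom[OF I this] show "amap A I J \<phi> ` carrier (alg A I) \<subseteq> carrier (alg A J)"
    by (auto simp: alg_hom_def ring_hom_def)
qed

text \<open>One inclusion holds because the whole algebra is a candidate containing both generators;
  the other because \<open>Ad_invariants_subset\<close> puts all invariants into every
  candidate.\<close>

theorem proposition3p1:
  fixes A :: "('k::field_char_0, (nat \<Rightarrow> 'k alg_closure ^ 'n::finite ^ 'n) \<Rightarrow> 'k alg_closure) FFG_data"
  defines "A \<equiv> GO_invariants"
  assumes "I \<in> FFG_obj"
  shows "FFG_generated ring_of_type_algebra A
           (\<lambda>J. if J = {0} then {tr_fun, similitude_fun} else {}) I = carrier (alg A I)"
proof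
  let ?S = "\<lambda>J. if J = {0} then {tr_fun, similitude_fun :: (nat \<Rightarrow> 'k alg_closure ^ 'n ^ 'n) \<Rightarrow> 'k alg_closure} else {}"
  have "?S J \<subseteq> carrier (alg A J)" for J
    by (simp add: A_def tr_fun_invariant similitude_fun_invariant)
  moreover have "sub_FFG_algebra ring_of_type_algebra A (\<lambda>I. carrier (alg A I))"
    unfolding A_def by (rule sub_FFG_algebra_carrier[OF GO_invariants_FFG_algebra])
  ultimately show "FFG_generated ring_of_type_algebra A ?S I \<subseteq> carrier (alg A I)"
    unfolding FFG_generated_def by blast
  show "carrier (alg A I) \<subseteq> FFG_generated ring_of_type_algebra A ?S I"
    unfolding FFG_generated_def
  proof (rule Inter_greatest)
    fix C assume "C \<in> {B I |B. sub_FFG_algebra ring_of_type_algebra A B \<and> (\<forall>J\<in>FFG_obj. ?S J \<subseteq> B J)}"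
    then obtain B where B: "C = B I" "sub_FFG_algebra ring_of_type_algebra A B"
      "\<forall>J\<in>FFG_obj. ?S J \<subseteq> B J" by blast
    have "{0} \<in> FFG_obj" by (simp add: FFG_obj_def)
    then have "tr_fun \<in> B {0}" "similitude_fun \<in> B {0}" using B(3) by auto
    with B(2) have "sub_algebra_tr_similitude B"
      unfolding A_def by unfold_locales
    from sub_algebra_tr_similitude.Ad_invariants_subset[OF this assms(2)]
    show "carrier (alg A I) \<subseteq> C" unfolding A_def B(1) GO_invariants_simps .
  qed
qed

end
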